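(* Let $n\ge 3$ and let $(\mathcal E,g)$ be an $n$-dimensional $C^0$-asymptotically flat end. Then its isoperimetric mass satisfies $m_{\mathrm{iso}}(\mathcal E,g)\ge 0$.
   Context: **One-ended $C^0$-asymptotically flat manifold.** Let $n\ge 3$ and let $M$ be a smooth $n$-manifold, possibly with boundary, equipped with a $C^0$ Riemannian metric $g$. The pair $(M,g)$ is a one-ended $C^0$-asymptotically flat manifold if there exists a compact set $K\subset M$ such that $M\smallsetminus K$ is diffeomorphic to $\mathbb R^n\smallsetminus \bar B$ for some closed coordinate ball $\bar B$, and in this coordinate chart $$|g_{ij}-\delta_{ij}|\le C|x|^{-\tau}$$ for some constants $C,\tau>0$. Such a coordinate chart $(M\smallsetminus K,g)$ is called a ($C^0$-)asymptotically flat end. No decay of derivatives of $g$ and no curvature condition is assumed. Such $(M,g)$ is necessarily complete, and bounded subsets are those with compact closure. **Volume and perimeter.** For a bounded open set $\Omega\subset M$ with finite perimeter, $|\Omega|$ denotes its volume and $|\partial^*\Omega|$ its perimeter, both with respect to $g$. Here $\partial^*\Omega$ is the reduced boundary of $\Omega$ and its area is measured with $g$. If the boundary $\partial\Omega$ of $\Omega$ is a regular hypersurface, then $|\partial^*\Omega|=|\partial\Omega|$ is its $g$-area. Boundaries are taken as topological boundaries in $M$. **Quasilocal isoperimetric mass.** Let $\omega_{n-1}$ be the area of the unit sphere in $\mathbb R^n$. For a bounded open set $\Omega\subset M$ with finite, positive perimeter, define $$m_{\mathrm{iso}}^{\mathrm{QL}}(\Omega):=\frac{2}{\omega_{n-1}}\left(\frac{\omega_{n-1}}{|\partial^*\Omega|}\right)^{\frac{2}{n-1}}\left(|\Omega|-\frac{1}{n\,\omega_{n-1}^{1/(n-1)}}|\partial^*\Omega|^{\frac{n}{n-1}}\right).$$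 For $n=3$ this reads $$m_{\mathrm{iso}}^{\mathrm{QL}}(\Omega)=\frac{2}{|\partial^*\Omega|}\left(|\Omega|-\frac{1}{6\sqrt\pi}|\partial^*\Omega|^{3/2}\right).$$ **Isoperimetric mass of a manifold.** For a one-ended $C^0$-asymptotically flat manifold $(M,g)$, define $$m_{\mathrm{iso}}(M,g):=\sup_{\{\Omega_i\}}\left(\limsup_{i\to\infty}m_{\mathrm{iso}}^{\mathrm{QL}}(\Omega_i)\right)\in[-\infty,\infty],$$ where the supremum is over all sequences $\{\Omega_i\}$ of bounded open sets with finite perimeter that exhaust $M$ (i.e. $\Omega_1\subset\Omega_2\subset\cdots$ and $\bigcup_i\Omega_i=M$). **Isoperimetric mass of an end.** For an asymptotically flat end $(\mathcal E,g)$, $m_{\mathrm{iso}}(\mathcal E,g)$ is defined to be $m_{\mathrm{iso}}(M,g)$ for any one-ended $C^0$-asymptotically flat manifold $(M,g)$ in which $(\mathcal E,g)$ is isometrically embedded as its asymptotically flat end. This quantity depends only on the geometry near infinity, hence not on the choice of $M$. The theorem thus asserts $m_{\mathrm{iso}}(M,g)\ge0$ for every such $(M,g)$. *)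

theory Defs
  imports "HOL-Analysis.Analysis"
begin

section \<open>Smooth maps\<close>

text \<open>\<open>Ck_on k S f\<close> is meant for open \<open>S\<close>.\<close>

primrec Ck_on ::
  "nat \<Rightarrow> 'a::euclidean_space set \<Rightarrow> ('a \<Rightarrow> 'b::real_normed_vector) \<Rightarrow> bool" where
  "Ck_on 0 S f \<longleftrightarrow> continuous_on S f"
| "Ck_on (Suc k) S f \<longleftrightarrow> (\<forall>x\<in>S. f differentiable (at x)) \<and>
     (\<forall>v. Ck_on k S (\<lambda>x. frechet_derivative f (at x) v))"

text \<open>Smoothness on an arbitrary set (needed for relatively open subsets of a half-space)
  means locally having a smooth extension to an open set.\<close>

definition smooth_on ::
  "'a::euclidean_space set \<Rightarrow> ('a \<Rightarrow> 'b::real_normed_vector) \<Rightarrow> bool" where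
  "smooth_on S f \<longleftrightarrow> (\<forall>x\<in>S. \<exists>W h. open W \<and> x \<in> W \<and>
     (\<forall>k. Ck_on k W h) \<and> (\<forall>y\<in>S \<inter> W. h y = f y))"


section \<open>Smooth manifolds with boundary\<close>

text \<open>The underlying space of the manifold is the whole type \<open>'a\<close>, which will be Hausdorff and
  second countable. Coordinate maps are total functions, only relevant on the chart domain.\<close>

type_synonym ('a, 'n) chart = "'a set \<times> ('a \<Rightarrow> real ^ 'n)"

abbreviation chart_inv :: "('a, 'n) chart \<Rightarrow> real ^ 'n \<Rightarrow> 'a" where
  "chart_inv c \<equiv> inv_into (fst c) (snd c)"

abbreviation chart_image :: "('a, 'n) chart \<Rightarrow> (real ^ 'n) set" where
  "chart_image c \<equiv> snd c ` fst c"

definition is_chart :: "('a::topological_space, 'n::finite) chart \<Rightarrow> bool" where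
  "is_chart c \<longleftrightarrow> open (fst c) \<and>
     (open (chart_image c) \<or>
      (\<exists>k. openin (top_of_set {x. 0 \<le> x $ k}) (chart_image c))) \<and>
     homeomorphism (fst c) (chart_image c) (snd c) (chart_inv c)"

definition smoothly_compatible ::
  "('a, 'n::finite) chart \<Rightarrow> ('a, 'n) chart \<Rightarrow> bool" where
  "smoothly_compatible c d \<longleftrightarrow>
     smooth_on (snd c ` (fst c \<inter> fst d)) (snd d \<circ> chart_inv c) \<and>
     smooth_on (snd d ` (fst c \<inter> fst d)) (snd c \<circ> chart_inv d)"

definition smooth_manifold ::
  "('a::{second_countable_topology, t2_space}, 'n::finite) chart set \<Rightarrow> bool" where
  "smooth_manifold \<A> \<longleftrightarrow>
     (\<forall>c\<in>\<A>. is_chart c) \<and>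
     (\<Union>c\<in>\<A>. fst c) = UNIV \<and>
     (\<forall>c\<in>\<A>. \<forall>d\<in>\<A>. smoothly_compatible c d) \<and>
     (\<forall>c. is_chart c \<and> (\<forall>d\<in>\<A>. smoothly_compatible c d) \<longrightarrow> c \<in> \<A>)"

definition manifold_interior ::
  "('a::topological_space, 'n::finite) chart set \<Rightarrow> 'a set" where
  "manifold_interior \<A> = {p. \<exists>c\<in>\<A>. p \<in> fst c \<and> snd c p \<in> interior (chart_image c)}"

text \<open>Jacobian matrix at \<open>p\<close> of the coordinate change from \<open>c\<close> to \<open>d\<close>; the derivative is taken
  within the domain of the coordinate change, so that it also makes sense at boundary points.\<close>

definition transition_jacobian ::
  "('a, 'n::finite) chart \<Rightarrow> ('a, 'n) chart \<Rightarrow> 'a \<Rightarrow> real ^ 'n ^ 'n" where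
  "transition_jacobian c d p =
     matrix (frechet_derivative (snd d \<circ> chart_inv c)
       (at (snd c p) within snd c ` (fst c \<inter> fst d)))"


section \<open>Continuous Riemannian metrics\<close>

text \<open>\<open>g c p\<close> is the matrix of components, at the point \<open>p\<close>, of the metric in the chart \<open>c\<close>.\<close>

type_synonym ('a, 'n) metric = "('a, 'n) chart \<Rightarrow> 'a \<Rightarrow> real ^ 'n ^ 'n"

definition inner_product_matrix :: "real ^ 'n ^ 'n::finite \<Rightarrow> bool" where
  "inner_product_matrix G \<longleftrightarrow> transpose G = G \<and> (\<forall>v. v \<noteq> 0 \<longrightarrow> 0 < v \<bullet> (G *v v))"

definition C0_metric ::
  "('a::topological_space, 'n::finite) chart set \<Rightarrow> ('a, 'n) metric \<Rightarrow> bool" where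
  "C0_metric \<A> g \<longleftrightarrow>
     (\<forall>c\<in>\<A>. continuous_on (fst c) (g c) \<and> (\<forall>p\<in>fst c. inner_product_matrix (g c p))) \<and>
     (\<forall>c\<in>\<A>. \<forall>d\<in>\<A>. \<forall>p\<in>fst c \<inter> fst d.
        g c p = transpose (transition_jacobian c d p) ** g d p ** transition_jacobian c d p)"

definition riemannian_volume ::
  "('a::topological_space, 'n::finite) chart set \<Rightarrow> ('a, 'n) metric \<Rightarrow> 'a measure" where
  "riemannian_volume \<A> g = (THE \<mu>. sets \<mu> = sets borel \<and>
     (\<forall>c\<in>\<A>. \<forall>B\<in>sets borel. B \<subseteq> fst c \<longrightarrow>
        emeasure \<mu> B = (\<integral>\<^sup>+ x\<in>snd c ` B. ennreal (sqrt (det (g c (chart_inv c x)))) \<partial>lborel)))"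


section \<open>Perimeter\<close>

text \<open>\<open>X c p\<close> is the vector of components, at the point \<open>p\<close>, of the vector field in the chart \<open>c\<close>.\<close>

type_synonym ('a, 'n) vector_field = "('a, 'n) chart \<Rightarrow> 'a \<Rightarrow> real ^ 'n"

definition is_vector_field ::
  "('a, 'n::finite) chart set \<Rightarrow> ('a, 'n) vector_field \<Rightarrow> bool" where
  "is_vector_field \<A> X \<longleftrightarrow>
     (\<forall>c\<in>\<A>. \<forall>d\<in>\<A>. \<forall>p\<in>fst c \<inter> fst d. X d p = transition_jacobian c d p *v X c p)"

definition vector_field_support ::
  "('a::topological_space, 'n::finite) chart set \<Rightarrow> ('a, 'n) vector_field \<Rightarrow> 'a set" where
  "vector_field_support \<A> X = closure {p. \<exists>c\<in>\<A>. p \<in> fst c \<and> X c p \<noteq> 0}"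

text \<open>The coordinate formula \<open>div X = (1 / \<surd>det g) \<Sum>\<^sub>i \<partial>\<^sub>i (\<surd>det g X\<^sup>i)\<close> for the Riemannian divergence.
  As \<open>g\<close> is only continuous, the regularity asked for is that the densities \<open>\<surd>det g X\<^sup>i\<close> be \<open>C\<^sup>1\<close>.
  Both this and the value of the formula do not depend on the chart.\<close>

definition has_divergence ::
  "('a::topological_space, 'n::finite) chart set \<Rightarrow> ('a, 'n) metric \<Rightarrow>
   ('a, 'n) vector_field \<Rightarrow> ('a \<Rightarrow> real) \<Rightarrow> bool" where
  "has_divergence \<A> g X f \<longleftrightarrow> (\<forall>p\<in>manifold_interior \<A>. \<exists>c\<in>\<A>.
     p \<in> fst c \<and> open (chart_image c) \<and>
     (let Y = (\<lambda>x. sqrt (det (g c (chart_inv c x))) *\<^sub>R X c (chart_inv c x))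
      in Ck_on 1 (chart_image c) Y \<and>
         (\<forall>q\<in>fst c. f q =
            (\<Sum>i\<in>UNIV. frechet_derivative Y (at (snd c q)) (axis i 1) $ i) / sqrt (det (g c q)))))"

definition perimeter_test_field ::
  "('a::topological_space, 'n::finite) chart set \<Rightarrow> ('a, 'n) metric \<Rightarrow>
   ('a, 'n) vector_field \<Rightarrow> bool" where
  "perimeter_test_field \<A> g X \<longleftrightarrow> is_vector_field \<A> X \<and>
     compact (vector_field_support \<A> X) \<and> vector_field_support \<A> X \<subseteq> manifold_interior \<A> \<and>
     (\<forall>c\<in>\<A>. \<forall>p\<in>fst c. X c p \<bullet> (g c p *v X c p) \<le> 1)"

text \<open>The perimeter of \<open>\<Omega>\<close> (Caccioppoli, De Giorgi): the total variation, with respect to \<open>g\<close>, of the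
  distributional gradient of the indicator function of \<open>\<Omega>\<close>; it is the \<open>g\<close>-area of the reduced
  boundary. Test fields are supported away from the manifold boundary, so that the part of the
  manifold boundary which lies in \<open>\<Omega>\<close> does not contribute, in accordance with taking boundaries
  in \<open>M\<close>.\<close>

definition perimeter ::
  "('a::topological_space, 'n::finite) chart set \<Rightarrow> ('a, 'n) metric \<Rightarrow> 'a set \<Rightarrow> ereal" where
  "perimeter \<A> g \<Omega> =
     Sup {ereal (LINT p:\<Omega> \<inter> manifold_interior \<A>|riemannian_volume \<A> g. f p) | X f.
            perimeter_test_field \<A> g X \<and> has_divergence \<A> g X f}"


section \<open>Isoperimetric mass\<close>

text \<open>Area of the unit sphere in \<open>real ^ 'n\<close>: the dimension times the volume of the unit ball.\<close>

definition unit_sphere_area :: "'n::finite itself \<Rightarrow> real" where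
  "unit_sphere_area _ = real CARD('n) * unit_ball_vol (real CARD('n))"

definition quasilocal_iso_mass ::
  "('a::topological_space, 'n::finite) chart set \<Rightarrow> ('a, 'n) metric \<Rightarrow> 'a set \<Rightarrow> real" where
  "quasilocal_iso_mass \<A> g \<Omega> =
     (let n = real CARD('n);
          \<omega> = unit_sphere_area TYPE('n);
          V = measure (riemannian_volume \<A> g) \<Omega>;
          P = real_of_ereal (perimeter \<A> g \<Omega>)
      in 2 / \<omega> * (\<omega> / P) powr (2 / (n - 1)) *
           (V - 1 / (n * \<omega> powr (1 / (n - 1))) * P powr (n / (n - 1))))"

text \<open>Bounded means having compact closure. Positivity of the perimeter is what makes the quasilocal
  mass well defined; it holds automatically for all but finitely many members of an exhaustion of a
  one-ended asymptotically flat manifold.\<close>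

definition exhaustion ::
  "('a::topological_space, 'n::finite) chart set \<Rightarrow> ('a, 'n) metric \<Rightarrow> (nat \<Rightarrow> 'a set) \<Rightarrow> bool" where
  "exhaustion \<A> g \<Omega> \<longleftrightarrow>
     (\<forall>i. open (\<Omega> i) \<and> compact (closure (\<Omega> i)) \<and>
          0 < perimeter \<A> g (\<Omega> i) \<and> perimeter \<A> g (\<Omega> i) < \<infinity>) \<and>
     (\<forall>i. \<Omega> i \<subseteq> \<Omega> (Suc i)) \<and>
     (\<Union>i. \<Omega> i) = UNIV"

definition iso_mass ::
  "('a::topological_space, 'n::finite) chart set \<Rightarrow> ('a, 'n) metric \<Rightarrow> ereal" where
  "iso_mass \<A> g =
     (SUP \<Omega>\<in>{\<Omega>. exhaustion \<A> g \<Omega>}. limsup (\<lambda>i. ereal (quasilocal_iso_mass \<A> g (\<Omega> i))))"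


section \<open>Asymptotically flat ends\<close>

text \<open>An end is given in its coordinates: the complement of the closed ball with centre \<open>a\<close> and
  radius \<open>r\<close>, with metric components \<open>h\<close>. The ball need not contain the origin, where the decay
  condition is void.\<close>

definition C0_asymptotically_flat_end ::
  "real ^ 'n::finite \<Rightarrow> real \<Rightarrow> (real ^ 'n \<Rightarrow> real ^ 'n ^ 'n) \<Rightarrow> bool" where
  "C0_asymptotically_flat_end a r h \<longleftrightarrow> 0 < r \<and>
     continuous_on (- cball a r) h \<and> (\<forall>x\<in>- cball a r. inner_product_matrix (h x)) \<and>
     (\<exists>C>0. \<exists>\<tau>>0. \<forall>x\<in>- cball a r. \<forall>i j. x \<noteq> 0 \<longrightarrow>
        \<bar>h x $ i $ j - mat 1 $ i $ j\<bar> \<le> C * norm x powr (- \<tau>))"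

definition one_ended_manifold_with_end ::
  "('a::{second_countable_topology, t2_space}, 'n::finite) chart set \<Rightarrow> ('a, 'n) metric \<Rightarrow>
   real ^ 'n \<Rightarrow> real \<Rightarrow> (real ^ 'n \<Rightarrow> real ^ 'n ^ 'n) \<Rightarrow> bool" where
  "one_ended_manifold_with_end \<A> g a r h \<longleftrightarrow>
     smooth_manifold \<A> \<and> C0_metric \<A> g \<and>
     (\<exists>K. compact K \<and> (\<exists>\<phi>. (- K, \<phi>) \<in> \<A> \<and> \<phi> ` (- K) = - cball a r \<and>
        (\<forall>p\<in>- K. g (- K, \<phi>) p = h (\<phi> p))))"

end

theory Submission
  imports Defs
begin

text \<open>An open set \<open>\<Omega>\<close> of bounded perimeter is enlarged by a coordinate ball of radius \<open>\<rho>\<close> lying so far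
  out in the end that, relative to \<open>\<rho>\<close>, the metric is almost Euclidean there. As \<open>\<rho>\<close> grows, the
  perimeter of \<open>\<Omega>\<close> becomes negligible against that of the ball, while the volume of \<open>\<Omega>\<close> can only
  help; since the ball nearly achieves equality in the Euclidean isoperimetric inequality, the mass of
  the union is at least \<open>- \<delta>\<close> for any prescribed \<open>\<delta> > 0\<close>. Alternating this with
  the addition of coordinate balls that cover \<open>M\<close> yields an exhaustion whose mass has nonnegative
  upper limit.

  Perimeters of finite unions of coordinate balls are estimated from above by inserting radial cutoff functions
  into the weak divergence theorem; the total variation of a cutoff is bounded by applying the
  Euclidean divergence theorem to the cutoff times the position vector. Positivity of the perimeter is tested against
  the same radial field, using that a set of finite volume has little volume far out in the end.\<close>

text \<open>The metric is only continuous, so no derivative of it may appear. Vector fields are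
  therefore handled through the densities sqrt(det g) X, which \<open>has_divergence\<close> makes
  C^1: the divergence on M becomes a Euclidean one in coordinates, and the metric enters only
  through pointwise bounds.

  The constants are chosen in a fixed order: \<rho> from \<delta> and the perimeter bound of
  \<Omega>, then the tolerance \<epsilon> from \<rho>, then the distance of the ball from
  \<epsilon>. Moving the ball out after its radius is fixed makes its errors in volume and perimeter
  at most 1 in absolute terms. An excess of order 1 in perimeter costs volume of order \<rho>, and
  the mass divides by the square of the radius, so the loss is of order 1 / \<rho> in every
  dimension.

  Nothing is assumed about compact sets being bounded in the coordinates of the end, so the ball
  cannot simply be placed off \<Omega>. The upper bounds tolerate an overlap; for positivity of the
  perimeter, finiteness of the volume of compact sets takes the place of disjointness.\<close>

section \<open>Change of variables\<close>

text \<open>The library proves the change of variables formula only for well-ordered index types.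
  A wellordered copy of the index type makes it available for every finite one.\<close>

typedef 'n ordered_index = "UNIV :: 'n set" ..

text \<open>The order is pulled back along the injection \<open>to_nat\<close>, so well-foundedness
  is inherited from the natural numbers.\<close>

instantiation ordered_index :: (finite) "{finite, wellorder}"
begin

definition "less_eq_ordered_index (x :: 'a ordered_index) (y :: 'a ordered_index) \<longleftrightarrow>
  to_nat (Rep_ordered_index x) \<le> to_nat (Rep_ordered_index y)"
definition "less_ordered_index (x :: 'a ordered_index) (y :: 'a ordered_index) \<longleftrightarrow>
  to_nat (Rep_ordered_index x) < to_nat (Rep_ordered_index y)"

instance
proof
  show "finite (UNIV :: 'a ordered_index set)"
    using type_definition.Abs_image[OF type_definition_ordered_index]
    by (metis finite finite_imageI)
next
  fix P :: "'a ordered_index \<Rightarrow> bool" and a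
  assume H: "\<And>x. (\<And>y. y < x \<Longrightarrow> P y) \<Longrightarrow> P x"
  show "P a"
    by (induction a rule: measure_induct_rule[of "\<lambda>x. to_nat (Rep_ordered_index x)"])
      (auto intro: H simp: less_ordered_index_def)
qed (auto simp: less_eq_ordered_index_def less_ordered_index_def Rep_ordered_index_inject)

end

definition reindex :: "real ^ 'n \<Rightarrow> real ^ 'n ordered_index" where
  "reindex x = (\<chi> i. x $ Rep_ordered_index i)"

definition unindex :: "real ^ 'n ordered_index \<Rightarrow> real ^ 'n" where
  "unindex x = (\<chi> i. x $ Abs_ordered_index i)"

lemma reindex_unindex [simp]: "reindex (unindex x) = x" "unindex (reindex y) = y"
  by (simp_all add: reindex_def unindex_def vec_eq_iff Rep_ordered_index_inverse
      Abs_ordered_index_inverse)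

lemma mem_reindex_image_iff: "x \<in> reindex ` A \<longleftrightarrow> unindex x \<in> A"
  by (metis image_iff reindex_unindex)

lemma bounded_linear_reindex: "bounded_linear (reindex :: real ^ 'n::finite \<Rightarrow> _)"
  unfolding reindex_def by (intro linear_conv_bounded_linear[THEN iffD1] linearI)
    (auto simp: vec_eq_iff)

lemma bounded_linear_unindex: "bounded_linear (unindex :: _ \<Rightarrow> real ^ 'n::finite)"
  unfolding unindex_def by (intro linear_conv_bounded_linear[THEN iffD1] linearI)
    (auto simp: vec_eq_iff)

text \<open>A relabelling of coordinates carries boxes to boxes and permutes their side lengths, and
  \<open>lborel\<close> is determined by its values on boxes.\<close>

lemma lborel_distr_unindex: "distr lborel borel unindex = (lborel :: (real ^ 'n::finite) measure)"
proof (rule lborel_eqI[symmetric])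
  fix l u :: "real ^ 'n"
  assume le: "\<And>b. b \<in> Basis \<Longrightarrow> l \<bullet> b \<le> u \<bullet> b"
  have le': "l $ i \<le> u $ i" for i
    using le[OF axis_in_Basis_iff[THEN iffD2], of 1 i] by (simp add: inner_axis)
  have vim: "unindex -` box l u = box (reindex l) (reindex u)"
    by (auto simp: mem_box_cart unindex_def reindex_def)
      (metis Rep_ordered_index_inverse, metis Rep_ordered_index_inverse,
       metis UNIV_I Abs_ordered_index_inverse, metis UNIV_I Abs_ordered_index_inverse)
  have "emeasure (distr lborel borel unindex) (box l u) = emeasure lborel (box (reindex l) (reindex u))"
    using bounded_linear_unindex[THEN bounded_linear.linear, THEN linear_continuous_on[OF
          linear_conv_bounded_linear[THEN iffD1], of _ UNIV]]
    by (subst emeasure_distr) (auto simp: vim intro!: borel_measurable_continuous_onI)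
  also have "\<dots> = (\<Prod>b\<in>Basis. (reindex u - reindex l) \<bullet> b)"
    by (rule emeasure_lborel_box) (auto simp: Basis_vec_def inner_axis reindex_def le')
  also have "(\<Prod>b\<in>Basis. (reindex u - reindex l) \<bullet> b) = (\<Prod>i\<in>UNIV. (u - l) $ Rep_ordered_index i)"
    unfolding Basis_vec_def
    by (subst prod.reindex_bij_betw[symmetric, where S=UNIV and h="\<lambda>i. axis i 1"])
      (auto simp: bij_betw_def inj_on_def axis_eq_axis inner_axis reindex_def)
  also have "\<dots> = (\<Prod>i\<in>UNIV. (u - l) $ i)"
    by (rule prod.reindex_bij_witness[of _ Abs_ordered_index Rep_ordered_index])
      (auto simp: Rep_ordered_index_inverse Abs_ordered_index_inverse)
  also have "\<dots> = (\<Prod>b\<in>Basis. (u - l) \<bullet> b)"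
    unfolding Basis_vec_def
    by (subst prod.reindex_bij_betw[symmetric, where S=UNIV and h="\<lambda>i. axis i 1"])
      (auto simp: bij_betw_def inj_on_def axis_eq_axis inner_axis)
  finally show "emeasure (distr lborel borel unindex) (box l u) = (\<Prod>b\<in>Basis. (u - l) \<bullet> b)" .
qed simp

text \<open>Conjugation by the relabelling is a sign-preserving bijection between the permutations
  of the two index types, so the Leibniz sums agree term by term.\<close>

lemma det_reindex:
  fixes A :: "real ^ 'n::finite ^ 'n"
  shows "det (\<chi> i j. A $ Rep_ordered_index i $ Rep_ordered_index j) = det A"
proof -
  let ?m = "map_permutation UNIV (Abs_ordered_index :: 'n \<Rightarrow> _)"
  have inj: "inj (Abs_ordered_index :: 'n \<Rightarrow> _)"
    by (auto simp: inj_def Abs_ordered_index_inject)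
  have rng: "range (Abs_ordered_index :: 'n \<Rightarrow> _) = UNIV"
    by (rule type_definition.Abs_image[OF type_definition_ordered_index])
  have inv: "inv_into UNIV Abs_ordered_index x = Rep_ordered_index x" for x :: "'n ordered_index"
    by (rule inv_f_eq[OF inj]) (simp add: Rep_ordered_index_inverse)
  have m: "?m p = Abs_ordered_index \<circ> p \<circ> Rep_ordered_index" for p
    by (auto simp: map_permutation_def rng inv fun_eq_iff restrict_id_def)
  have perm: "(Abs_ordered_index \<circ> p \<circ> Rep_ordered_index) permutes UNIV"
    if "p permutes UNIV" for p :: "'n \<Rightarrow> 'n"
    using map_permutation_permutes[OF _ that, of Abs_ordered_index UNIV] inj rng
    by (simp add: m bij_betw_def)
  have perm': "(Rep_ordered_index \<circ> q \<circ> Abs_ordered_index) permutes UNIV"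
    if "q permutes UNIV" for q :: "'n ordered_index \<Rightarrow> 'n ordered_index"
  proof -
    have "bij (Rep_ordered_index \<circ> q \<circ> (Abs_ordered_index :: 'n \<Rightarrow> _))"
      using permutes_bij[OF that] inj rng
      by (intro bij_comp) (auto simp: bij_def inj_def Rep_ordered_index_inject
          type_definition.Rep_range[OF type_definition_ordered_index])
    then show ?thesis by (rule bij_imp_permutes) simp
  qed
  show ?thesis
    unfolding det_def
  proof (rule sum.reindex_bij_witness[of _ "\<lambda>p. Abs_ordered_index \<circ> p \<circ> Rep_ordered_index"
        "\<lambda>q. Rep_ordered_index \<circ> q \<circ> Abs_ordered_index"])
    fix q :: "'n ordered_index \<Rightarrow> 'n ordered_index" assume q: "q \<in> {p. p permutes UNIV}"
    let ?p = "Rep_ordered_index \<circ> q \<circ> Abs_ordered_index"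
    show e: "Abs_ordered_index \<circ> ?p \<circ> Rep_ordered_index = q"
      by (auto simp: Rep_ordered_index_inverse)
    show "?p \<in> {p. p permutes UNIV}" using perm' q by auto
    have s: "sign q = sign ?p"
      using sign_map_permutation[OF inj, of ?p] perm' q e by (simp add: m)
    have "(\<Prod>i\<in>UNIV. A $ Rep_ordered_index i $ Rep_ordered_index (q i)) = (\<Prod>i\<in>UNIV. A $ i $ ?p i)"
      by (rule prod.reindex_bij_witness[of _ Abs_ordered_index Rep_ordered_index])
        (auto simp: Rep_ordered_index_inverse Abs_ordered_index_inverse)
    then show "of_int (sign ?p) * (\<Prod>i\<in>UNIV. A $ i $ ?p i) = of_int (sign q) *
      (\<Prod>i\<in>UNIV. (\<chi> i j. A $ Rep_ordered_index i $ Rep_ordered_index j) $ i $ q i)"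
      by (simp add: s)
  qed (use perm in \<open>auto simp: Abs_ordered_index_inverse fun_eq_iff\<close>)
qed

text \<open>A bridge between gauge integrals with a prescribed finite value, the form of the
  available change of variables theorem, and nonnegative integrals over
  \<open>lborel\<close>.\<close>

lemma absolutely_integrable_iff_set_nn_integral:
  fixes F :: "'a::euclidean_space \<Rightarrow> real"
  assumes "set_borel_measurable borel S F" "\<And>x. x \<in> S \<Longrightarrow> 0 \<le> F x" "0 \<le> b"
  shows "F absolutely_integrable_on S \<and> integral S F = b \<longleftrightarrow> (\<integral>\<^sup>+x\<in>S. F x \<partial>lborel) = ennreal b"
proof -
  have 0: "(\<integral>\<^sup>+x\<in>S. F x \<partial>lborel) = (\<integral>\<^sup>+x. ennreal (indicator S x * F x) \<partial>lborel)"
    by (intro nn_integral_cong) (auto simp: indicator_def)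
  have [measurable]: "(\<lambda>x. indicator S x * F x) \<in> borel_measurable borel"
    using assms(1) by (simp add: set_borel_measurable_def)
  have "F absolutely_integrable_on S \<and> integral S F = b \<longleftrightarrow> (F has_integral b) S"
    using assms(2) by (auto simp: has_integral_iff absolutely_integrable_on_iff_nonneg)
  also have "\<dots> \<longleftrightarrow> ((\<lambda>x. indicator S x * F x) has_integral b) UNIV"
    by (subst has_integral_restrict_UNIV[symmetric], rule arg_cong[where f="\<lambda>f. (f has_integral b) UNIV"])
       (auto simp: indicator_def fun_eq_iff)
  also have "\<dots> \<longleftrightarrow> (\<integral>\<^sup>+x\<in>S. F x \<partial>lborel) = ennreal b"
    unfolding 0 using assms(2,3)
  proof (subst has_integral_iff_nn_integral_lebesgue)
    have "(\<lambda>x. indicator S x * F x) \<in> borel_measurable lebesgue"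
      by (rule measurable_completion) measurable
    then show "((\<lambda>x. indicator S x * F x) \<in> borel_measurable lebesgue \<and>
        (\<integral>\<^sup>+x. ennreal (indicator S x * F x) \<partial>lebesgue) = ennreal b \<and> 0 \<le> b) \<longleftrightarrow>
      (\<integral>\<^sup>+x. ennreal (indicator S x * F x) \<partial>lborel) = ennreal b"
      using assms(3) by (simp only: nn_integral_completion simp_thms)
  qed (use assms(2) in \<open>auto split: split_indicator\<close>)
  finally show ?thesis .
qed

text \<open>The integrand on the domain is a separate function \<open>H\<close>, so its
  measurability is assumed directly and need not be derived from that of the Jacobian determinant.
  Either integral equals a given finite b exactly when the other does; this leaves infinity as the
  only remaining common value.\<close>

lemma set_nn_integral_change_of_variables_wellorder:
  fixes T :: "real ^ 'm::{finite,wellorder} \<Rightarrow> real ^ 'm::_" and F H :: "real ^ 'm::_ \<Rightarrow> real"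
  assumes S: "S \<in> sets borel"
    and der: "\<And>x. x \<in> S \<Longrightarrow> (T has_derivative T' x) (at x within S)" and inj: "inj_on T S"
    and F: "set_borel_measurable borel (T ` S) F" "\<And>x. x \<in> T ` S \<Longrightarrow> 0 \<le> F x"
    and H: "set_borel_measurable borel S H" "\<And>x. x \<in> S \<Longrightarrow> H x = \<bar>det (matrix (T' x))\<bar> * F (T x)"
  shows "(\<integral>\<^sup>+x\<in>T ` S. F x \<partial>lborel) = (\<integral>\<^sup>+x\<in>S. H x \<partial>lborel)"
proof -
  have Hn: "\<And>x. x \<in> S \<Longrightarrow> 0 \<le> H x" using H(2) F(2) by auto
  have "(\<integral>\<^sup>+x\<in>S. H x \<partial>lborel) = ennreal b \<longleftrightarrow> (\<integral>\<^sup>+x\<in>T ` S. F x \<partial>lborel) = ennreal b"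
    if b: "0 \<le> b" for b
  proof -
    have HS1: "H absolutely_integrable_on S \<longleftrightarrow>
        (\<lambda>x. \<bar>det (matrix (T' x))\<bar> * F (T x)) absolutely_integrable_on S"
      by (rule set_integrable_cong) (simp_all add: H(2))
    have HS2: "integral S H = integral S (\<lambda>x. \<bar>det (matrix (T' x))\<bar> * F (T x))"
      by (rule Henstock_Kurzweil_Integration.integral_cong) (simp add: H(2))
    have SL: "S \<in> sets lebesgue" using S by simp
    note cov = has_absolute_integral_change_of_variables[OF SL der inj, of "\<lambda>x. vec (F x) :: real^1" "vec b",
        unfolded absolutely_integrable_on_1_iff integral_on_1_eq]
    have "(\<lambda>x. \<bar>det (matrix (T' x))\<bar> * F (T x)) absolutely_integrable_on S \<and>
        integral S (\<lambda>x. \<bar>det (matrix (T' x))\<bar> * F (T x)) = b \<longleftrightarrow>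
      F absolutely_integrable_on T ` S \<and> integral (T ` S) F = b"
      using cov by (simp add: vec_eq_iff)
    then have "H absolutely_integrable_on S \<and> integral S H = b \<longleftrightarrow>
      F absolutely_integrable_on T ` S \<and> integral (T ` S) F = b"
      using HS1 HS2 by argo
    then show ?thesis
      using absolutely_integrable_iff_set_nn_integral[OF H(1) Hn b]
        absolutely_integrable_iff_set_nn_integral[OF F b] by blast
  qed
  note iff = this
  show ?thesis
  proof (cases "\<integral>\<^sup>+x\<in>S. H x \<partial>lborel")
    case (real b)
    then show ?thesis using iff[of b] by simp
  next
    case top
    then show ?thesis
      using iff[of "enn2real (\<integral>\<^sup>+x\<in>T ` S. F x \<partial>lborel)"]
      by (cases "\<integral>\<^sup>+x\<in>T ` S. F x \<partial>lborel") simp_all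
  qed
qed

text \<open>Conjugating \<open>T\<close> by \<open>reindex\<close> affects neither the integrals nor
  the determinant of the derivative.\<close>

theorem set_nn_integral_change_of_variables:
  fixes T :: "real ^ 'n::finite \<Rightarrow> real ^ 'n" and F H :: "real ^ 'n \<Rightarrow> real"
  assumes S: "S \<in> sets borel"
    and der: "\<And>x. x \<in> S \<Longrightarrow> (T has_derivative T' x) (at x within S)" and inj: "inj_on T S"
    and F: "set_borel_measurable borel (T ` S) F" "\<And>x. x \<in> T ` S \<Longrightarrow> 0 \<le> F x"
    and H: "set_borel_measurable borel S H" "\<And>x. x \<in> S \<Longrightarrow> H x = \<bar>det (matrix (T' x))\<bar> * F (T x)"
  shows "(\<integral>\<^sup>+x\<in>T ` S. F x \<partial>lborel) = (\<integral>\<^sup>+x\<in>S. H x \<partial>lborel)"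
proof -
  let ?R = "reindex :: real ^ 'n \<Rightarrow> _" and ?U = "unindex :: _ \<Rightarrow> real ^ 'n"
  have [measurable]: "?U \<in> borel_measurable borel"
    by (intro borel_measurable_continuous_onI linear_continuous_on bounded_linear_unindex)
  have trans: "(\<integral>\<^sup>+x\<in>A. G x \<partial>lborel) = (\<integral>\<^sup>+x\<in>?R ` A. G (?U x) \<partial>lborel)"
    and meas: "set_borel_measurable borel (?R ` A) (\<lambda>x. G (?U x))"
    if "set_borel_measurable borel A G" "\<And>x. x \<in> A \<Longrightarrow> 0 \<le> G x" for A and G :: "_ \<Rightarrow> real"
  proof -
    have ind: "indicator A (?U x) = indicator (?R ` A) x" for x
      by (simp add: indicator_def mem_reindex_image_iff)
    have [measurable]: "(\<lambda>x. indicator A x * G x) \<in> borel_measurable borel"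
      using that(1) by (simp add: set_borel_measurable_def)
    have eq: "ennreal (G x) * indicator A x = ennreal (indicator A x * G x)" for x
      by (auto simp: indicator_def)
    show "(\<integral>\<^sup>+x\<in>A. G x \<partial>lborel) = (\<integral>\<^sup>+x\<in>?R ` A. G (?U x) \<partial>lborel)"
    proof -
      have "(\<integral>\<^sup>+x\<in>A. G x \<partial>lborel) = (\<integral>\<^sup>+x. ennreal (indicator A x * G x) \<partial>distr lborel borel ?U)"
        unfolding eq by (subst lborel_distr_unindex) (rule refl)
      also have "\<dots> = (\<integral>\<^sup>+x. ennreal (indicator A (?U x) * G (?U x)) \<partial>lborel)"
        by (rule nn_integral_distr) measurable
      also have "\<dots> = (\<integral>\<^sup>+x\<in>?R ` A. G (?U x) \<partial>lborel)"
        unfolding ind by (rule nn_integral_cong) (simp split: split_indicator)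
      finally show ?thesis .
    qed
    have "(\<lambda>x. indicator A (?U x) * G (?U x)) \<in> borel_measurable borel"
      by measurable
    then show "set_borel_measurable borel (?R ` A) (\<lambda>x. G (?U x))"
      by (simp add: set_borel_measurable_def ind)
  qed
  have Hn: "\<And>x. x \<in> S \<Longrightarrow> 0 \<le> H x" using H(2) F(2) by auto
  have img: "?R ` T ` S = (?R \<circ> T \<circ> ?U) ` (?R ` S)"
    by (auto simp: image_comp comp_def)
  have inj': "inj_on (?R \<circ> T \<circ> ?U) (?R ` S)"
  proof (rule inj_onI)
    fix x y assume xy: "x \<in> ?R ` S" "y \<in> ?R ` S" and eq: "(?R \<circ> T \<circ> ?U) x = (?R \<circ> T \<circ> ?U) y"
    from eq have "?U (?R (T (?U x))) = ?U (?R (T (?U y)))"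
      unfolding comp_def by (rule arg_cong)
    then have "T (?U x) = T (?U y)"
      unfolding reindex_unindex .
    then have "?U x = ?U y"
      using inj_onD[OF inj] xy by (simp only: mem_reindex_image_iff)
    then have "?R (?U x) = ?R (?U y)"
      by (rule arg_cong)
    then show "x = y"
      unfolding reindex_unindex .
  qed
  have der': "((?R \<circ> T \<circ> ?U) has_derivative (?R \<circ> T' (?U x) \<circ> ?U)) (at x within ?R ` S)"
    if x: "x \<in> ?R ` S" for x
  proof -
    have U: "?U x \<in> S" "?U ` ?R ` S = S" using x by (auto simp: image_comp)
    then have "(T has_derivative T' (?U x)) (at (?U x) within ?U ` ?R ` S)"
      using der by simp
    then have "((T \<circ> ?U) has_derivative (T' (?U x) \<circ> ?U)) (at x within ?R ` S)"
      by (rule diff_chain_within[OF bounded_linear_imp_has_derivative[OF bounded_linear_unindex]])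
    then show ?thesis
      unfolding comp_assoc
      by (rule diff_chain_within[OF _ bounded_linear_imp_has_derivative[OF bounded_linear_reindex]])
  qed
  have det': "det (matrix (?R \<circ> T' y \<circ> ?U)) = det (matrix (T' y))" for y
  proof -
    have U: "?U (axis j 1) = axis (Rep_ordered_index j) 1" for j
      by (auto simp: unindex_def axis_def vec_eq_iff Abs_ordered_index_inverse Rep_ordered_index_inverse)
    have "matrix (?R \<circ> T' y \<circ> ?U) = (\<chi> i j. matrix (T' y) $ Rep_ordered_index i $ Rep_ordered_index j)"
      unfolding matrix_def comp_def U by (simp add: reindex_def)
    then show ?thesis by (simp add: det_reindex)
  qed
  have SR: "?R ` S \<in> sets borel"
  proof -
    have "?R ` S = ?U -` S" using mem_reindex_image_iff by blast
    then show ?thesis using measurable_sets_borel[of ?U borel S] S by simp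
  qed
  have "(\<integral>\<^sup>+x\<in>(?R \<circ> T \<circ> ?U) ` (?R ` S). F (?U x) \<partial>lborel) = (\<integral>\<^sup>+x\<in>?R ` S. H (?U x) \<partial>lborel)"
  proof (rule set_nn_integral_change_of_variables_wellorder[OF SR der' inj'])
    show "set_borel_measurable borel ((?R \<circ> T \<circ> ?U) ` ?R ` S) (\<lambda>x. F (?U x))"
      unfolding img[symmetric] using F by (rule meas)
    show "0 \<le> F (?U x)" if "x \<in> (?R \<circ> T \<circ> ?U) ` ?R ` S" for x
      using that F(2) unfolding img[symmetric] mem_reindex_image_iff by blast
    show "set_borel_measurable borel (?R ` S) (\<lambda>x. H (?U x))"
      using H(1) Hn by (rule meas)
    show "H (?U x) = \<bar>det (matrix (?R \<circ> T' (?U x) \<circ> ?U))\<bar> * F (?U ((?R \<circ> T \<circ> ?U) x))"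
      if "x \<in> ?R ` S" for x
      using that H(2)[of "?U x"] unfolding mem_reindex_image_iff det' by simp
  qed
  with trans[OF F] trans[OF H(1) Hn] show ?thesis
    by (simp only: img)
qed

section \<open>Continuously differentiable functions\<close>

lemma Ck_on_1_iff:
  "Ck_on (Suc 0) S f \<longleftrightarrow>
    (\<exists>f'. (\<forall>x\<in>S. (f has_derivative f' x) (at x)) \<and> (\<forall>v. continuous_on S (\<lambda>x. f' x v)))"
proof
  assume "Ck_on (Suc 0) S f"
  then show "\<exists>f'. (\<forall>x\<in>S. (f has_derivative f' x) (at x)) \<and> (\<forall>v. continuous_on S (\<lambda>x. f' x v))"
    by (intro exI[of _ "\<lambda>x. frechet_derivative f (at x)"]) (auto simp: frechet_derivative_works)
next
  assume "\<exists>f'. (\<forall>x\<in>S. (f has_derivative f' x) (at x)) \<and> (\<forall>v. continuous_on S (\<lambda>x. f' x v))"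
  then obtain f' where f': "\<And>x. x \<in> S \<Longrightarrow> (f has_derivative f' x) (at x)"
    and c: "\<And>v. continuous_on S (\<lambda>x. f' x v)" by blast
  have "continuous_on S (\<lambda>x. frechet_derivative f (at x) v)" for v
    using c[of v] by (rule continuous_on_eq) (simp add: frechet_derivative_at[OF f', symmetric])
  then show "Ck_on (Suc 0) S f"
    using f' by (auto simp: differentiable_def)
qed

lemma Ck_on_1I:
  "\<lbrakk>\<And>x. x \<in> S \<Longrightarrow> (f has_derivative f' x) (at x); \<And>v. continuous_on S (\<lambda>x. f' x v)\<rbrakk>
    \<Longrightarrow> Ck_on (Suc 0) S f"
  using Ck_on_1_iff by blast

lemma Ck_on_1_has_derivative:
  "Ck_on (Suc 0) S f \<Longrightarrow> x \<in> S \<Longrightarrow> (f has_derivative frechet_derivative f (at x)) (at x)"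
  by (auto simp: frechet_derivative_works)

lemma Ck_on_1_continuous_derivative:
  "Ck_on (Suc 0) S f \<Longrightarrow> continuous_on S (\<lambda>x. frechet_derivative f (at x) v)"
  by simp

lemma Ck_on_1_continuous_on: "Ck_on (Suc 0) S f \<Longrightarrow> continuous_on S f"
  by (auto intro!: continuous_at_imp_continuous_on differentiable_imp_continuous_within)

lemma Ck_on_1_subset: "Ck_on (Suc 0) S f \<Longrightarrow> T \<subseteq> S \<Longrightarrow> Ck_on (Suc 0) T f"
  by (auto intro: continuous_on_subset)

text \<open>The gluing principle for functions given by one formula inside a chart and by zero
  elsewhere.\<close>

lemma Ck_on_1_locally:
  assumes "\<And>x. x \<in> S \<Longrightarrow> \<exists>W h. open W \<and> x \<in> W \<and> Ck_on (Suc 0) W h \<and> (\<forall>y\<in>W. h y = f y)"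
  shows "Ck_on (Suc 0) S f"
proof (rule Ck_on_1I)
  have loc: "\<exists>W h. open W \<and> x \<in> W \<and> Ck_on (Suc 0) W h \<and> (\<forall>y\<in>W.
      (f has_derivative frechet_derivative h (at y)) (at y))" if x: "x \<in> S" for x
  proof -
    obtain W h where W: "open W" "x \<in> W" "Ck_on (Suc 0) W h" "\<forall>y\<in>W. h y = f y"
      using assms[OF x] by blast
    have "(f has_derivative frechet_derivative h (at y)) (at y)" if "y \<in> W" for y
      by (rule has_derivative_transform_within_open[OF Ck_on_1_has_derivative[OF W(3) that] W(1) that])
        (use W(4) in auto)
    with W show ?thesis by blast
  qed
  show der: "(f has_derivative frechet_derivative f (at x)) (at x)" if "x \<in> S" for x
    using loc[OF that] frechet_derivative_at by metis
  show "continuous_on S (\<lambda>x. frechet_derivative f (at x) v)" for v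
  proof (rule continuous_at_imp_continuous_on, rule ballI)
    fix x assume "x \<in> S"
    obtain W h where W: "open W" "x \<in> W" "Ck_on (Suc 0) W h"
      "\<And>y. y \<in> W \<Longrightarrow> (f has_derivative frechet_derivative h (at y)) (at y)"
      using loc[OF \<open>x \<in> S\<close>] by blast
    have "continuous_on W (\<lambda>x. frechet_derivative f (at x) v)"
      using Ck_on_1_continuous_derivative[OF W(3), of v]
      by (rule continuous_on_eq) (metis W(4) frechet_derivative_at)
    then show "isCont (\<lambda>x. frechet_derivative f (at x) v) x"
      using W(1,2) continuous_on_eq_continuous_at by blast
  qed
qed

lemma Ck_on_1_const: "Ck_on (Suc 0) S (\<lambda>x. c)"
  by (rule Ck_on_1I[where f'="\<lambda>x v. 0"]) auto

lemma Ck_on_1_add: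
  assumes "Ck_on (Suc 0) S f" "Ck_on (Suc 0) S g"
  shows "Ck_on (Suc 0) S (\<lambda>x. f x + g x)"
  by (rule Ck_on_1I[where f'="\<lambda>x v. frechet_derivative f (at x) v + frechet_derivative g (at x) v"])
    (use assms in \<open>auto intro!: has_derivative_add Ck_on_1_has_derivative continuous_on_add\<close>)

lemma Ck_on_1_scaleR:
  fixes f :: "_ \<Rightarrow> real"
  assumes "Ck_on (Suc 0) S f" "Ck_on (Suc 0) S g"
  shows "Ck_on (Suc 0) S (\<lambda>x. f x *\<^sub>R g x)"
  by (rule Ck_on_1I[where f'="\<lambda>x v. f x *\<^sub>R frechet_derivative g (at x) v + frechet_derivative f (at x) v *\<^sub>R g x"])
    (use assms Ck_on_1_continuous_on[OF assms(1)] Ck_on_1_continuous_on[OF assms(2)] in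
      \<open>auto intro!: has_derivative_scaleR Ck_on_1_has_derivative continuous_intros\<close>)

lemma Ck_on_1_mult:
  fixes f g :: "_ \<Rightarrow> real"
  shows "Ck_on (Suc 0) S f \<Longrightarrow> Ck_on (Suc 0) S g \<Longrightarrow> Ck_on (Suc 0) S (\<lambda>x. f x * g x)"
  using Ck_on_1_scaleR[of S f g] by simp

lemma Ck_on_1_diff:
  fixes f g :: "_ \<Rightarrow> real"
  shows "Ck_on (Suc 0) S f \<Longrightarrow> Ck_on (Suc 0) S g \<Longrightarrow> Ck_on (Suc 0) S (\<lambda>x. f x - g x)"
  using Ck_on_1_add[OF _ Ck_on_1_mult[OF Ck_on_1_const[of S "-1"]], of f g] by simp

lemma Ck_on_1_compose:
  fixes f :: "'a::euclidean_space \<Rightarrow> 'b::euclidean_space" and g :: "'b \<Rightarrow> 'c::real_normed_vector"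
  assumes f: "Ck_on (Suc 0) S f" and g: "Ck_on (Suc 0) T g" and sub: "f ` S \<subseteq> T"
  shows "Ck_on (Suc 0) S (g \<circ> f)"
proof (rule Ck_on_1I)
  let ?f' = "\<lambda>x. frechet_derivative f (at x)" and ?g' = "\<lambda>y. frechet_derivative g (at y)"
  show "((g \<circ> f) has_derivative (?g' (f x) \<circ> ?f' x)) (at x)" if "x \<in> S" for x
    using that sub by (intro diff_chain_at Ck_on_1_has_derivative[OF f] Ck_on_1_has_derivative[OF g]) auto
  show "continuous_on S (\<lambda>x. (?g' (f x) \<circ> ?f' x) v)" for v
  proof -
    \<comment> \<open>Continuity of the derivative of \<open>g\<close> is known for fixed directions
      only, while here the direction varies with x. Expanding it in the basis separates the two
      dependences.\<close>
    have "continuous_on S (\<lambda>x. \<Sum>b\<in>Basis. (?f' x v \<bullet> b) *\<^sub>R ?g' (f x) b)"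
      by (intro continuous_intros Ck_on_1_continuous_derivative[OF f]
          continuous_on_compose2[OF Ck_on_1_continuous_derivative[OF g] Ck_on_1_continuous_on[OF f] sub])
    then show ?thesis
    proof (rule continuous_on_eq)
      fix x assume "x \<in> S"
      then have "f x \<in> T" using sub by auto
      have "linear (?g' (f x))"
        using Ck_on_1_has_derivative[OF g \<open>f x \<in> T\<close>] has_derivative_linear by blast
      then have "?g' (f x) (\<Sum>b\<in>Basis. (?f' x v \<bullet> b) *\<^sub>R b) = (\<Sum>b\<in>Basis. (?f' x v \<bullet> b) *\<^sub>R ?g' (f x) b)"
        by (simp add: linear_sum linear_cmul)
      then show "(\<Sum>b\<in>Basis. (?f' x v \<bullet> b) *\<^sub>R ?g' (f x) b) = (?g' (f x) \<circ> ?f' x) v"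
        by (simp add: euclidean_representation)
    qed
  qed
qed

subsection \<open>Cutoff functions\<close>

definition smoothstep :: "real \<Rightarrow> real" where
  "smoothstep t = (max 0 (min 1 t))\<^sup>2 * (3 - 2 * max 0 (min 1 t))"

text \<open>For the junctions t = 0 and t = 1 of \<open>smoothstep\<close>, where two formulas
  meet.\<close>

lemma has_real_derivative_0_quadratic:
  fixes f :: "real \<Rightarrow> real"
  assumes "\<And>y. \<bar>f y - f x\<bar> \<le> C * (y - x)\<^sup>2"
  shows "(f has_real_derivative 0) (at x)"
  unfolding has_field_derivative_iff
proof (rule tendsto_rabs_zero_cancel, rule tendsto_sandwich[OF _ _ tendsto_const])
  show "\<forall>\<^sub>F y in at x. \<bar>(f y - f x) / (y - x)\<bar> \<le> C * \<bar>y - x\<bar>"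
    unfolding eventually_at_filter
  proof (rule always_eventually, intro allI impI)
    fix y assume "y \<noteq> x"
    have "\<bar>f y - f x\<bar> \<le> (C * \<bar>y - x\<bar>) * \<bar>y - x\<bar>"
      using assms[of y] by (simp add: power2_eq_square abs_mult_self_eq mult.assoc)
    then show "\<bar>(f y - f x) / (y - x)\<bar> \<le> C * \<bar>y - x\<bar>"
      using \<open>y \<noteq> x\<close> by (simp add: abs_divide pos_divide_le_eq)
  qed
  have "((\<lambda>y. C * \<bar>y - x\<bar>) \<longlongrightarrow> C * \<bar>x - x\<bar>) (at x)"
    by (intro tendsto_intros)
  then show "((\<lambda>y. C * \<bar>y - x\<bar>) \<longlongrightarrow> 0) (at x)" by simp
qed auto

lemma smoothstep_eq_0: "t \<le> 0 \<Longrightarrow> smoothstep t = 0"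
  by (simp add: smoothstep_def)

lemma smoothstep_eq_1: "1 \<le> t \<Longrightarrow> smoothstep t = 1"
  by (simp add: smoothstep_def)

lemma smoothstep_eq: "0 \<le> t \<Longrightarrow> t \<le> 1 \<Longrightarrow> smoothstep t = t\<^sup>2 * (3 - 2 * t)"
  by (simp add: smoothstep_def)

lemma smoothstep_bounds: "0 \<le> smoothstep t" "smoothstep t \<le> 1"
proof -
  let ?u = "max 0 (min 1 t)"
  have u: "0 \<le> ?u" "?u \<le> 1" by auto
  show "0 \<le> smoothstep t" unfolding smoothstep_def using u by (intro mult_nonneg_nonneg) auto
  have "0 \<le> (1 - ?u)\<^sup>2 * (1 + 2 * ?u)" using u by (intro mult_nonneg_nonneg) auto
  also have "\<dots> = 1 - smoothstep t" unfolding smoothstep_def by (simp only: power2_eq_square, algebra)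
  finally show "smoothstep t \<le> 1" by simp
qed

lemma smoothstep_quadratic_0: "\<bar>smoothstep t\<bar> \<le> 3 * t\<^sup>2"
proof -
  have "(max 0 (min 1 t))\<^sup>2 * (3 - 2 * max 0 (min 1 t)) \<le> t\<^sup>2 * 3"
    by (intro mult_mono) (auto simp: abs_le_square_iff[symmetric])
  then show ?thesis using smoothstep_bounds[of t] unfolding smoothstep_def by linarith
qed

lemma smoothstep_reflect: "smoothstep (1 - t) = 1 - smoothstep t"
proof -
  have reflect: "max 0 (min 1 (1 - t)) = 1 - max 0 (min 1 t)" by auto
  show ?thesis unfolding smoothstep_def reflect by (simp only: power2_eq_square, algebra)
qed

lemma smoothstep_derivative_eq_0:
  fixes t :: real
  shows "t \<le> 0 \<Longrightarrow> max 0 (6 * t * (1 - t)) = 0" "1 \<le> t \<Longrightarrow> max 0 (6 * t * (1 - t)) = 0"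
  by (simp_all add: mult_nonpos_nonneg mult_nonneg_nonpos)

lemma DERIV_smoothstep: "(smoothstep has_real_derivative max 0 (6 * t * (1 - t))) (at t)"
proof -
  consider "t < 0" | "t = 0" | "0 < t" "t < 1" | "t = 1" | "t > 1" by linarith
  then show ?thesis
  proof cases
    case 1
    then have "max 0 (6 * t * (1 - t)) = 0" by (simp add: smoothstep_derivative_eq_0)
    moreover have "(smoothstep has_real_derivative 0) (at t)"
      by (rule has_field_derivative_transform_within_open[of "\<lambda>_. 0" _ _ "{..<0}"])
        (use 1 in \<open>auto simp: smoothstep_eq_0\<close>)
    ultimately show ?thesis by simp
  next
    case 2
    then show ?thesis
      using has_real_derivative_0_quadratic[of smoothstep 0 3] smoothstep_quadratic_0
      by (simp add: smoothstep_eq_0)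
  next
    case 3
    have "((\<lambda>t. t\<^sup>2 * (3 - 2 * t)) has_real_derivative 6 * t * (1 - t)) (at t)"
      by (auto intro!: derivative_eq_intros simp: power2_eq_square algebra_simps)
    then have "(smoothstep has_real_derivative 6 * t * (1 - t)) (at t)"
      by (rule has_field_derivative_transform_within_open[of _ _ _ "{0<..<1}"])
        (use 3 in \<open>auto simp: smoothstep_eq\<close>)
    then show ?thesis using 3 by simp
  next
    case 4
    have "\<bar>smoothstep y - smoothstep 1\<bar> \<le> 3 * (y - 1)\<^sup>2" for y
      using smoothstep_quadratic_0[of "1 - y"] smoothstep_reflect[of y]
      by (simp add: smoothstep_eq_1 power2_commute abs_minus_commute)
    then show ?thesis
      using has_real_derivative_0_quadratic[of smoothstep 1 3] 4 by simp
  next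
    case 5
    then have "max 0 (6 * t * (1 - t)) = 0" by (simp add: smoothstep_derivative_eq_0)
    moreover have "(smoothstep has_real_derivative 0) (at t)"
      by (rule has_field_derivative_transform_within_open[of "\<lambda>_. 1" _ _ "{1<..}"])
        (use 5 in \<open>auto simp: smoothstep_eq_1\<close>)
    ultimately show ?thesis by simp
  qed
qed

text \<open>It is 1 on \<open>cball y a\<close> and 0 off \<open>ball y b\<close>. The squared
  distance is used because the distance itself is not differentiable at the centre.\<close>

definition cutoff :: "'a::euclidean_space \<Rightarrow> real \<Rightarrow> real \<Rightarrow> 'a \<Rightarrow> real" where
  "cutoff y a b x = smoothstep ((b\<^sup>2 - (x - y) \<bullet> (x - y)) / (b\<^sup>2 - a\<^sup>2))"

text \<open>The derivative of the cutoff in direction \<open>v\<close> is \<open>- cutoff_weight y a b x * ((x - y) \<bullet> v)\<close>.\<close>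

definition cutoff_weight :: "'a::euclidean_space \<Rightarrow> real \<Rightarrow> real \<Rightarrow> 'a \<Rightarrow> real" where
  "cutoff_weight y a b x = (let t = (b\<^sup>2 - (x - y) \<bullet> (x - y)) / (b\<^sup>2 - a\<^sup>2) in
     max 0 (6 * t * (1 - t)) * 2 / (b\<^sup>2 - a\<^sup>2))"

context
  fixes a b :: real and y :: "'a::euclidean_space"
  assumes ab: "0 < a" "a < b"
begin

lemma cutoff_den_pos: "0 < b\<^sup>2 - a\<^sup>2"
  using ab by (simp add: power_strict_mono)

lemma cutoff_has_derivative:
  "(cutoff y a b has_derivative (\<lambda>v. - cutoff_weight y a b x * ((x - y) \<bullet> v))) (at x)"
proof -
  have 0: "((\<lambda>x. b\<^sup>2 - (x - y) \<bullet> (x - y)) has_derivative (\<lambda>v. - (2 * ((x - y) \<bullet> v)))) (at x)"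
    by (auto intro!: derivative_eq_intros simp: inner_commute algebra_simps)
  have 1: "((\<lambda>x. (b\<^sup>2 - (x - y) \<bullet> (x - y)) / (b\<^sup>2 - a\<^sup>2)) has_derivative
    (\<lambda>v. - (2 * ((x - y) \<bullet> v)) / (b\<^sup>2 - a\<^sup>2))) (at x)"
    by (rule bounded_linear.has_derivative[OF bounded_linear_divide 0])
  have "((smoothstep \<circ> (\<lambda>x. (b\<^sup>2 - (x - y) \<bullet> (x - y)) / (b\<^sup>2 - a\<^sup>2))) has_derivative
    ((*) (max 0 (6 * ((b\<^sup>2 - (x - y) \<bullet> (x - y)) / (b\<^sup>2 - a\<^sup>2)) * (1 - (b\<^sup>2 - (x - y) \<bullet> (x - y)) / (b\<^sup>2 - a\<^sup>2))))
      \<circ> (\<lambda>v. - (2 * ((x - y) \<bullet> v)) / (b\<^sup>2 - a\<^sup>2)))) (at x)"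
    by (rule diff_chain_at[OF 1 DERIV_smoothstep[unfolded has_field_derivative_def]])
  moreover have "smoothstep \<circ> (\<lambda>x. (b\<^sup>2 - (x - y) \<bullet> (x - y)) / (b\<^sup>2 - a\<^sup>2)) = cutoff y a b"
    by (simp add: fun_eq_iff cutoff_def)
  moreover have "(*) (max 0 (6 * t * (1 - t))) \<circ> (\<lambda>v. - (2 * ((x - y) \<bullet> v)) / (b\<^sup>2 - a\<^sup>2)) =
    (\<lambda>v. - (max 0 (6 * t * (1 - t)) * 2 / (b\<^sup>2 - a\<^sup>2)) * ((x - y) \<bullet> v))" for t
    by (simp add: fun_eq_iff)
  ultimately show ?thesis
    unfolding cutoff_weight_def Let_def by (simp only:)
qed

lemma continuous_on_cutoff_weight: "continuous_on S (cutoff_weight y a b)"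
  unfolding cutoff_weight_def Let_def using cutoff_den_pos
  by (intro continuous_intros) auto

lemma Ck_on_1_cutoff: "Ck_on (Suc 0) S (cutoff y a b)"
  by (rule Ck_on_1I[OF cutoff_has_derivative])
    (intro continuous_intros continuous_on_cutoff_weight)

lemma cutoff_bounds: "0 \<le> cutoff y a b x" "cutoff y a b x \<le> 1"
  by (simp_all add: cutoff_def smoothstep_bounds)

lemma cutoff_eq_1: "x \<in> cball y a \<Longrightarrow> cutoff y a b x = 1"
proof -
  assume "x \<in> cball y a"
  then have "norm (x - y) \<le> a" by (simp add: dist_norm norm_minus_commute)
  then have "(norm (x - y))\<^sup>2 \<le> a\<^sup>2" by (intro power_mono) auto
  then show ?thesis unfolding cutoff_def using cutoff_den_pos
    by (intro smoothstep_eq_1) (simp add: dot_square_norm)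
qed

lemma cutoff_eq_0: "x \<notin> ball y b \<Longrightarrow> cutoff y a b x = 0"
proof -
  assume "x \<notin> ball y b"
  then have "b \<le> norm (x - y)" by (simp add: dist_norm norm_minus_commute)
  then have "b\<^sup>2 \<le> (norm (x - y))\<^sup>2" using ab by (intro power_mono) auto
  then show ?thesis unfolding cutoff_def using cutoff_den_pos
    by (intro smoothstep_eq_0) (simp add: dot_square_norm divide_le_0_iff)
qed

lemma cutoff_weight_nonneg: "0 \<le> cutoff_weight y a b x"
  using cutoff_den_pos by (simp add: cutoff_weight_def Let_def)

lemma cutoff_weight_eq_0_inside: "x \<in> ball y a \<Longrightarrow> cutoff_weight y a b x = 0"
proof -
  assume "x \<in> ball y a"
  then have "norm (x - y) \<le> a" by (simp add: dist_norm norm_minus_commute)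
  then have "(norm (x - y))\<^sup>2 \<le> a\<^sup>2" by (intro power_mono) auto
  then have t: "1 \<le> (b\<^sup>2 - (x - y) \<bullet> (x - y)) / (b\<^sup>2 - a\<^sup>2)"
    using cutoff_den_pos by (simp add: dot_square_norm)
  show ?thesis unfolding cutoff_weight_def Let_def smoothstep_derivative_eq_0(2)[OF t] by simp
qed

lemma cutoff_weight_eq_0: "x \<notin> ball y b \<Longrightarrow> cutoff_weight y a b x = 0"
proof -
  assume "x \<notin> ball y b"
  then have "b \<le> norm (x - y)" by (simp add: dist_norm norm_minus_commute)
  then have "b\<^sup>2 \<le> (norm (x - y))\<^sup>2" using ab by (intro power_mono) auto
  then have t: "(b\<^sup>2 - (x - y) \<bullet> (x - y)) / (b\<^sup>2 - a\<^sup>2) \<le> 0"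
    using cutoff_den_pos by (simp add: dot_square_norm divide_le_0_iff)
  show ?thesis unfolding cutoff_weight_def Let_def smoothstep_derivative_eq_0(1)[OF t] by simp
qed

text \<open>The weight vanishes on \<open>ball y a\<close>, and off this ball one factor
  \<open>norm (x - y)\<close> can be traded for \<open>(x - y) \<bullet> (x - y) / a\<close>. The
  result is the radial quantity whose integral \<open>cutoff_weight_integral\<close>
  controls.\<close>

lemma cutoff_derivative_bound:
  "\<bar>cutoff_weight y a b x * ((x - y) \<bullet> v)\<bar> \<le> norm v / a * (cutoff_weight y a b x * ((x - y) \<bullet> (x - y)))"
proof (cases "x \<in> ball y a")
  case True
  then show ?thesis by (simp add: cutoff_weight_eq_0_inside)
next
  case False
  then have n: "a \<le> norm (x - y)" by (simp add: dist_norm norm_minus_commute)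
  have "\<bar>(x - y) \<bullet> v\<bar> \<le> norm (x - y) * norm v" by (rule Cauchy_Schwarz_ineq2)
  also have "\<dots> \<le> (norm (x - y) * (norm (x - y) / a)) * norm v"
    using n ab by (intro mult_right_mono) (auto simp: field_simps intro: mult_mono)
  also have "\<dots> = norm v / a * ((x - y) \<bullet> (x - y))"
    by (simp add: dot_square_norm power2_eq_square)
  finally have "\<bar>(x - y) \<bullet> v\<bar> \<le> norm v / a * ((x - y) \<bullet> (x - y))" .
  from mult_left_mono[OF this cutoff_weight_nonneg[of x]] show ?thesis
    by (simp add: abs_mult cutoff_weight_nonneg mult_ac)
qed

end

subsection \<open>The divergence theorem for compactly supported fields\<close>

lemma frechet_derivative_eq_0_outside:
  assumes "closed K" "\<And>x. x \<notin> K \<Longrightarrow> f x = 0" "x \<notin> K"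
  shows "frechet_derivative f (at x) v = 0"
proof -
  have "(f has_derivative (\<lambda>_. 0)) (at x)"
    by (rule has_derivative_transform_within_open[of "\<lambda>_. 0" _ _ _ "- K"])
      (use assms in auto)
  then show ?thesis using frechet_derivative_at by metis
qed

lemma integrable_lborel_compact_support:
  fixes f :: "'a::euclidean_space \<Rightarrow> real"
  assumes "compact K" "continuous_on K f" "\<And>x. x \<notin> K \<Longrightarrow> f x = 0"
  shows "integrable lborel f"
proof -
  have "integrable lborel (\<lambda>x. indicator K x *\<^sub>R f x)"
    by (rule borel_integrable_compact[OF assms(1,2)])
  moreover have "(\<lambda>x. indicator K x *\<^sub>R f x) = f"
    using assms(3) by (auto simp: fun_eq_iff indicator_def)
  ultimately show ?thesis by simp
qed

text \<open>The difference quotients \<open>q k\<close> integrate to 0 by translation invariance of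
  \<open>lborel\<close> and converge to the derivative, so dominated convergence gives the result
  without iterated integrals.\<close>

lemma integral_directional_derivative_eq_0:
  fixes f :: "'a::euclidean_space \<Rightarrow> real"
  assumes f: "Ck_on (Suc 0) UNIV f" and supp: "\<And>x. x \<notin> cball 0 R \<Longrightarrow> f x = 0"
  shows "integrable lborel (\<lambda>x. frechet_derivative f (at x) v)"
    and "integral\<^sup>L lborel (\<lambda>x. frechet_derivative f (at x) v) = 0"
proof -
  let ?D = "\<lambda>x. frechet_derivative f (at x) v"
  have contf: "continuous_on UNIV f" and contD: "continuous_on UNIV ?D"
    using Ck_on_1_continuous_on[OF f] Ck_on_1_continuous_derivative[OF f] by auto
  have D0: "?D x = 0" if "x \<notin> cball 0 R" for x
    using frechet_derivative_eq_0_outside[OF closed_cball supp that] .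
  have intf: "integrable lborel f"
    by (rule integrable_lborel_compact_support[of "cball 0 R"])
      (use contf supp in \<open>auto intro: continuous_on_subset\<close>)
  show intD: "integrable lborel ?D"
    by (rule integrable_lborel_compact_support[of "cball 0 R"])
      (use contD D0 in \<open>auto intro: continuous_on_subset\<close>)
  have "bounded (?D ` cball 0 R)"
    by (intro compact_imp_bounded compact_continuous_image continuous_on_subset[OF contD]) auto
  then obtain M where M: "\<And>x. x \<in> cball 0 R \<Longrightarrow> \<bar>?D x\<bar> \<le> M" "0 < M"
    unfolding bounded_pos by (metis imageI real_norm_def)
  have DM: "\<bar>?D x\<bar> \<le> M" for x using M D0[of x] by (cases "x \<in> cball 0 R") auto
  define q where "q k x = (f (x + (1 / real (Suc k)) *\<^sub>R v) - f x) * real (Suc k)" for k x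
  have [measurable]: "f \<in> borel_measurable borel" "?D \<in> borel_measurable borel"
    using contf contD borel_measurable_continuous_onI by blast+
  have shift: "integrable lborel (\<lambda>x. f (x + c)) \<and> integral\<^sup>L lborel (\<lambda>x. f (x + c)) = integral\<^sup>L lborel f" for c
  proof -
    have "integrable (distr lborel borel ((+) c)) f" using intf by (simp add: lborel_distr_plus)
    then have "integrable lborel (\<lambda>x. f (c + x))" by (subst (asm) integrable_distr_eq) auto
    moreover have "integral\<^sup>L lborel (\<lambda>x. f (c + x)) = integral\<^sup>L (distr lborel borel ((+) c)) f"
      by (rule integral_distr[symmetric]) auto
    ultimately show ?thesis by (simp add: lborel_distr_plus add.commute)
  qed
  have q0: "integral\<^sup>L lborel (q k) = 0" for k
    using shift[of "(1 / real (Suc k)) *\<^sub>R v"] intf unfolding q_def by simp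
  have line: "((\<lambda>s. f (x + s *\<^sub>R v)) has_real_derivative ?D (x + t *\<^sub>R v)) (at t)" for x t
  proof -
    have "((\<lambda>s. x + s *\<^sub>R v) has_derivative (\<lambda>s. s *\<^sub>R v)) (at t)"
      by (auto intro!: derivative_eq_intros)
    from diff_chain_at[OF this Ck_on_1_has_derivative[OF f UNIV_I]]
    have "((\<lambda>s. f (x + s *\<^sub>R v)) has_derivative (\<lambda>s. frechet_derivative f (at (x + t *\<^sub>R v)) (s *\<^sub>R v))) (at t)"
      by (simp add: comp_def)
    moreover have "frechet_derivative f (at (x + t *\<^sub>R v)) (s *\<^sub>R v) = ?D (x + t *\<^sub>R v) * s" for s
      using linear_cmul[OF has_derivative_linear[OF Ck_on_1_has_derivative[OF f UNIV_I]]] by simp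
    ultimately show ?thesis by (simp add: has_field_derivative_def)
  qed
  have "(\<lambda>k. integral\<^sup>L lborel (q k)) \<longlonglongrightarrow> integral\<^sup>L lborel ?D"
  \<comment> \<open>The step lengths 1 / (k + 1) are at most 1, so every \<open>q k\<close> vanishes
    off the ball enlarged by \<open>norm v\<close>; on it the mean value theorem bounds
    \<open>q k\<close> by \<open>M\<close>.\<close>
  proof (rule integral_dominated_convergence[where w="\<lambda>x. M * indicator (cball 0 (R + norm v)) x"])
    show "?D \<in> borel_measurable lborel" "\<And>k. q k \<in> borel_measurable lborel"
      unfolding q_def by measurable
    show "integrable lborel (\<lambda>x. M * indicator (cball 0 (R + norm v)) x)"
      using emeasure_lborel_cball_finite by (intro integrable_mult_right integrable_real_indicator) auto
    show "AE x in lborel. (\<lambda>k. q k x) \<longlonglongrightarrow> ?D x"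
    proof (rule AE_I2)
      fix x
      have lim: "((\<lambda>s. (f (x + s *\<^sub>R v) - f x) / s) \<longlongrightarrow> ?D x) (at 0)"
        using line[of x 0] by (simp add: has_field_derivative_iff)
      have s0: "filterlim (\<lambda>k. 1 / real (Suc k)) (at 0) sequentially"
        unfolding filterlim_at using lim_1_over_n LIMSEQ_Suc[OF lim_1_over_n] by auto
      from filterlim_compose[OF lim s0] show "(\<lambda>k. q k x) \<longlonglongrightarrow> ?D x"
        by (simp add: q_def)
    qed
    show "AE x in lborel. norm (q k x) \<le> M * indicator (cball 0 (R + norm v)) x" for k
    proof (rule AE_I2)
      fix x
      show "norm (q k x) \<le> M * indicator (cball 0 (R + norm v)) x"
      proof (cases "x \<in> cball 0 (R + norm v)")
        case True
        obtain z where z: "f (x + (1 / real (Suc k)) *\<^sub>R v) - f (x + 0 *\<^sub>R v) = (1 / real (Suc k) - 0) * ?D (x + z *\<^sub>R v)"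
          using MVT2[of 0 "1 / real (Suc k)" "\<lambda>s. f (x + s *\<^sub>R v)" "\<lambda>t. ?D (x + t *\<^sub>R v)"] line by auto
        then have "q k x = ?D (x + z *\<^sub>R v)" by (simp add: q_def field_simps)
        then show ?thesis using DM True by simp
      next
        case False
        let ?w = "(1 / real (Suc k)) *\<^sub>R v"
        have "norm ?w \<le> norm v" by (simp add: divide_le_eq mult_le_cancel_left1)
        moreover have "norm x \<le> norm (x + ?w) + norm ?w"
          using norm_triangle_ineq4[of "x + ?w" ?w] by simp
        moreover have "R + norm v < norm x" "0 \<le> norm v" using False by auto
        ultimately have "R < norm x" "R < norm (x + ?w)" by linarith+
        then have "q k x = 0" using supp unfolding q_def by simp
        then show ?thesis using M by simp
      qed
    qed
  qed
  then show "integral\<^sup>L lborel ?D = 0"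
    unfolding q0 by (simp add: LIMSEQ_const_iff)
qed

definition divergence :: "(real ^ 'n \<Rightarrow> real ^ 'n::finite) \<Rightarrow> real ^ 'n \<Rightarrow> real" where
  "divergence Y x = (\<Sum>i\<in>UNIV. frechet_derivative Y (at x) (axis i 1) $ i)"

lemma integral_divergence_eq_0:
  fixes Y :: "real ^ 'n::finite \<Rightarrow> real ^ 'n"
  assumes Y: "Ck_on (Suc 0) UNIV Y" and supp: "\<And>x. x \<notin> cball 0 R \<Longrightarrow> Y x = 0"
  shows "integrable lborel (divergence Y)" and "integral\<^sup>L lborel (divergence Y) = 0"
proof -
  have der: "((\<lambda>x. Y x $ i) has_derivative (\<lambda>v. frechet_derivative Y (at x) v $ i)) (at x)" for i x
    by (rule bounded_linear.has_derivative[OF bounded_linear_vec_nth Ck_on_1_has_derivative[OF Y UNIV_I]])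
  have C: "Ck_on (Suc 0) UNIV (\<lambda>x. Y x $ i)" for i
    by (rule Ck_on_1I[OF der]) (intro continuous_intros Ck_on_1_continuous_derivative[OF Y])
  have eq: "divergence Y = (\<lambda>x. \<Sum>i\<in>UNIV. frechet_derivative (\<lambda>x. Y x $ i) (at x) (axis i 1))"
    unfolding divergence_def fun_eq_iff frechet_derivative_at[OF der, symmetric] by simp
  show "integrable lborel (divergence Y)"
    unfolding eq by (intro Bochner_Integration.integrable_sum integral_directional_derivative_eq_0[OF C, of R]) (use supp in auto)
  show "integral\<^sup>L lborel (divergence Y) = 0"
    unfolding eq
    by (subst Bochner_Integration.integral_sum)
      (use supp in \<open>auto intro!: sum.neutral integral_directional_derivative_eq_0[OF C, of R]\<close>)
qed

lemma divergence_scaleR: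
  fixes Y :: "real ^ 'n::finite \<Rightarrow> real ^ 'n" and \<psi> :: "real ^ 'n \<Rightarrow> real"
  assumes p: "(\<psi> has_derivative \<psi>') (at x)" and Y: "(Y has_derivative Y') (at x)"
  shows "divergence (\<lambda>x. \<psi> x *\<^sub>R Y x) x = \<psi>' (Y x) + \<psi> x * divergence Y x"
proof -
  have "((\<lambda>x. \<psi> x *\<^sub>R Y x) has_derivative (\<lambda>v. \<psi> x *\<^sub>R Y' v + \<psi>' v *\<^sub>R Y x)) (at x)"
    by (rule has_derivative_scaleR[OF p Y])
  from frechet_derivative_at[OF this]
  have "divergence (\<lambda>x. \<psi> x *\<^sub>R Y x) x = (\<Sum>i\<in>UNIV. (\<psi> x *\<^sub>R Y' (axis i 1) + \<psi>' (axis i 1) *\<^sub>R Y x) $ i)"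
    by (simp add: divergence_def fun_eq_iff)
  also have "\<dots> = (\<Sum>i\<in>UNIV. Y x $ i * \<psi>' (axis i 1)) + \<psi> x * (\<Sum>i\<in>UNIV. Y' (axis i 1) $ i)"
    by (simp add: sum.distrib sum_distrib_left mult.commute)
  also have "(\<Sum>i\<in>UNIV. Y x $ i * \<psi>' (axis i 1)) = \<psi>' (\<Sum>i\<in>UNIV. (Y x $ i) *\<^sub>R axis i 1)"
    using has_derivative_linear[OF p] by (simp add: linear_sum linear_cmul)
  also have "(\<Sum>i\<in>UNIV. (Y x $ i) *\<^sub>R axis i 1) = Y x"
    using basis_expansion[of "Y x"] by (simp add: scalar_mult_eq_scaleR)
  also have "(\<Sum>i\<in>UNIV. Y' (axis i 1) $ i) = divergence Y x"
    using frechet_derivative_at[OF Y] by (simp add: divergence_def)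
  finally show ?thesis .
qed

lemma divergence_id: "divergence (\<lambda>x. x - y) (x :: real ^ 'n::finite) = real CARD('n)"
proof -
  have "((\<lambda>x. x - y) has_derivative (\<lambda>v. v)) (at x)"
    by (auto intro!: derivative_eq_intros)
  from frechet_derivative_at[OF this, symmetric] show ?thesis by (simp add: divergence_def)
qed

text \<open>The field cutoff times (x - y) has divergence n * cutoff minus the radial quantity, so
  the latter integrates to n times the integral of the cutoff. Dividing by \<open>a\<close> and
  letting \<open>a\<close> tend to \<open>b\<close> yields the area of the sphere, without any
  surface measure.\<close>

lemma cutoff_weight_integral:
  fixes y :: "real ^ 'n::finite"
  assumes ab: "0 < a" "a < b"
  shows "integrable lborel (\<lambda>x. cutoff_weight y a b x * ((x - y) \<bullet> (x - y)))"
    and "integral\<^sup>L lborel (\<lambda>x. cutoff_weight y a b x * ((x - y) \<bullet> (x - y)))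
      \<le> real CARD('n) * measure lborel (ball y b)"
proof -
  let ?w = "\<lambda>x. cutoff_weight y a b x * ((x - y) \<bullet> (x - y))" and ?Y = "\<lambda>x. cutoff y a b x *\<^sub>R (x - y)"
  have id: "Ck_on (Suc 0) UNIV (\<lambda>x. x - y)"
    by (rule Ck_on_1I[where f'="\<lambda>x v. v"]) (auto intro!: derivative_eq_intros)
  have Y: "Ck_on (Suc 0) UNIV ?Y"
    by (intro Ck_on_1_scaleR Ck_on_1_cutoff ab id)
  have far: "x \<notin> ball y b" if "x \<notin> cball 0 (norm y + b)" for x
    using that norm_triangle_ineq2[of x y] by (auto simp: dist_norm norm_minus_commute)
  have supp: "?Y x = 0" if "x \<notin> cball 0 (norm y + b)" for x
    using cutoff_eq_0[OF ab far[OF that]] by simp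
  have div: "divergence ?Y x = - ?w x + real CARD('n) * cutoff y a b x" for x
    using divergence_scaleR[OF cutoff_has_derivative[OF ab, of y x] Ck_on_1_has_derivative[OF id UNIV_I]]
    by (simp add: divergence_id mult.commute)
  note Y0 = integral_divergence_eq_0[OF Y supp, unfolded div[abs_def]]
  have intc: "integrable lborel (cutoff y a b)"
    by (rule integrable_lborel_compact_support[of "cball y b"])
      (use Ck_on_1_continuous_on[OF Ck_on_1_cutoff[OF ab]] cutoff_eq_0[OF ab, of _ y] ball_subset_cball[of y b] in auto)
  show int: "integrable lborel ?w"
    by (rule integrable_lborel_compact_support[of "cball y b"])
      (use cutoff_weight_eq_0[OF ab, of _ y] ball_subset_cball[of y b]
        in \<open>auto intro!: continuous_intros continuous_on_cutoff_weight[OF ab]\<close>)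
  have "0 = integral\<^sup>L lborel (\<lambda>x. - ?w x + real CARD('n) * cutoff y a b x)"
    using Y0(2) by simp
  also have "\<dots> = - integral\<^sup>L lborel ?w + real CARD('n) * integral\<^sup>L lborel (cutoff y a b)"
    using int intc by simp
  finally have "integral\<^sup>L lborel ?w = real CARD('n) * integral\<^sup>L lborel (cutoff y a b)" by simp
  also have "integral\<^sup>L lborel (cutoff y a b) \<le> integral\<^sup>L lborel (indicator (ball y b))"
  proof (rule integral_mono[OF intc])
    show "cutoff y a b x \<le> indicator (ball y b) x" for x
      using cutoff_bounds[OF ab, of y x] cutoff_eq_0[OF ab, of x y] by (auto simp: indicator_def)
  qed (use emeasure_lborel_ball_finite in \<open>auto intro!: integrable_real_indicator\<close>)
  finally show "integral\<^sup>L lborel ?w \<le> real CARD('n) * measure lborel (ball y b)"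
    by (simp add: mult_left_mono)
qed

section \<open>Positive definite matrices\<close>

lemma inner_product_matrix_det_nonzero:
  assumes "inner_product_matrix (G :: real ^ 'n::finite ^ 'n)"
  shows "det G \<noteq> 0"
proof -
  have "inj ((*v) G)"
  proof (rule injI)
    fix x y assume "G *v x = G *v y"
    then have "(x - y) \<bullet> (G *v (x - y)) = 0" by (simp add: matrix_vector_mult_diff_distrib)
    then show "x = y" using assms unfolding inner_product_matrix_def by (metis less_irrefl right_minus_eq)
  qed
  then show ?thesis
    using invertible_det_nz invertible_left_inverse matrix_left_invertible_injective by blast
qed

lemma continuous_on_det:
  fixes G :: "'a::topological_space \<Rightarrow> real ^ 'n::finite ^ 'n"
  assumes "continuous_on S G"
  shows "continuous_on S (\<lambda>x. det (G x))"
  unfolding det_def by (intro continuous_intros assms)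

text \<open>The determinant does not vanish on the segment from the identity to \<open>G\<close>.\<close>

lemma inner_product_matrix_det_pos:
  assumes G: "inner_product_matrix (G :: real ^ 'n::finite ^ 'n)"
  shows "0 < det G"
proof (rule ccontr)
  assume "\<not> 0 < det G"
  let ?H = "\<lambda>t::real. (1 - t) *\<^sub>R (mat 1 :: real ^ 'n ^ 'n) + t *\<^sub>R G"
  have pos: "inner_product_matrix (?H t)" if t: "0 \<le> t" "t \<le> 1" for t
    unfolding inner_product_matrix_def
  proof (intro conjI allI impI)
    have "transpose G = G" using G by (simp add: inner_product_matrix_def)
    then show "transpose (?H t) = ?H t"
      by (simp add: vec_eq_iff transpose_def mat_def)
    fix v :: "real ^ 'n" assume "v \<noteq> 0"
    then have "0 < v \<bullet> v" "0 < v \<bullet> (G *v v)" using G by (auto simp: inner_product_matrix_def)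
    moreover have "v \<bullet> (?H t *v v) = (1 - t) * (v \<bullet> v) + t * (v \<bullet> (G *v v))"
      by (simp add: matrix_vector_mult_add_rdistrib scaleR_matrix_vector_assoc[symmetric] inner_add_right)
    ultimately show "0 < v \<bullet> (?H t *v v)"
      using t by (cases "t = 0") (auto intro!: add_nonneg_pos)
  qed
  have "\<exists>t\<ge>0. t \<le> 1 \<and> det (?H t) = 0"
    using \<open>\<not> 0 < det G\<close> by (intro IVT2' continuous_on_det continuous_intros) auto
  then show False using pos inner_product_matrix_det_nonzero by blast
qed

section \<open>The Riemannian volume measure\<close>

locale c0_manifold =
  fixes \<A> :: "('a::{second_countable_topology, t2_space}, 'n::finite) chart set"
    and g :: "('a, 'n) metric"
  assumes smooth_manifold: "smooth_manifold \<A>" and C0_metric: "C0_metric \<A> g"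
begin

lemma charts_cover: "\<exists>c\<in>\<A>. p \<in> fst c"
  using smooth_manifold unfolding smooth_manifold_def by blast

context
  fixes c assumes c: "c \<in> \<A>"
begin

lemma chart_is_chart: "is_chart c"
  using smooth_manifold c unfolding smooth_manifold_def by blast

lemma chart_open: "open (fst c)"
  using chart_is_chart by (simp add: is_chart_def)

lemma chart_homeomorphism: "homeomorphism (fst c) (chart_image c) (snd c) (chart_inv c)"
  using chart_is_chart by (simp add: is_chart_def)

lemma chart_inv_chart [simp]: "p \<in> fst c \<Longrightarrow> chart_inv c (snd c p) = p"
  using chart_homeomorphism by (auto simp: homeomorphism_def)

lemma chart_chart_inv [simp]: "x \<in> chart_image c \<Longrightarrow> snd c (chart_inv c x) = x"
  by (rule f_inv_into_f)

lemma chart_inv_in: "x \<in> chart_image c \<Longrightarrow> chart_inv c x \<in> fst c"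
  by (rule inv_into_into)

lemma chart_continuous: "continuous_on (fst c) (snd c)"
  using chart_homeomorphism by (auto simp: homeomorphism_def)

lemma chart_inv_continuous: "continuous_on (chart_image c) (chart_inv c)"
  using chart_homeomorphism by (auto simp: homeomorphism_def)

lemma chart_image_openin:
  assumes "open U" shows "openin (top_of_set (chart_image c)) (snd c ` (fst c \<inter> U))"
  using homeomorphism_imp_open_map[OF chart_homeomorphism, of "fst c \<inter> U"] assms by blast

lemma chart_image_borel: "chart_image c \<in> sets borel"
proof -
  consider "open (chart_image c)" | k where "openin (top_of_set {x. 0 \<le> x $ k}) (chart_image c)"
    using chart_is_chart unfolding is_chart_def by blast
  then show ?thesis
  proof cases
    case 2
    have "closed {x :: real ^ 'n. 0 \<le> x $ k}"
      by (rule closed_halfspace_component_ge_cart)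
    then show ?thesis using 2 by (auto simp: openin_open)
  qed auto
qed

lemma chart_image_of_borel:
  assumes "B \<in> sets borel" "B \<subseteq> fst c" shows "snd c ` B \<in> sets borel"
proof -
  have "chart_inv c -` B \<inter> space (restrict_space borel (chart_image c)) \<in>
      sets (restrict_space borel (chart_image c))"
    using borel_measurable_continuous_on_restrict[OF chart_inv_continuous] assms(1) by (rule measurable_sets)
  then have "chart_inv c -` B \<inter> chart_image c \<in> sets borel"
    using chart_image_borel by (simp add: sets_restrict_space_iff space_restrict_space)
  moreover have "chart_inv c -` B \<inter> chart_image c = snd c ` B"
    using assms(2) by (force simp: image_iff)
  ultimately show ?thesis by simp
qed

lemma metric_inner_product: "p \<in> fst c \<Longrightarrow> inner_product_matrix (g c p)"
  using C0_metric c unfolding C0_metric_def by blast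

lemma metric_continuous: "continuous_on (fst c) (g c)"
  using C0_metric c unfolding C0_metric_def by blast

end

definition vol_density :: "('a, 'n) chart \<Rightarrow> real ^ 'n \<Rightarrow> real" where
  "vol_density c x = sqrt (det (g c (chart_inv c x)))"

lemma vol_density_continuous: "c \<in> \<A> \<Longrightarrow> continuous_on (chart_image c) (vol_density c)"
  unfolding vol_density_def
  by (intro continuous_intros continuous_on_det continuous_on_compose2[OF metric_continuous chart_inv_continuous])
    (auto intro: chart_inv_in)

lemma vol_density_pos: "c \<in> \<A> \<Longrightarrow> x \<in> chart_image c \<Longrightarrow> 0 < vol_density c x"
  unfolding vol_density_def
  using inner_product_matrix_det_pos[OF metric_inner_product[OF _ chart_inv_in]] by simp

lemma vol_density_measurable:
  assumes "c \<in> \<A>" "S \<in> sets borel" "S \<subseteq> chart_image c"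
  shows "set_borel_measurable borel S (vol_density c)"
  unfolding set_borel_measurable_def
  using borel_measurable_continuous_on_indicator[OF assms(2)
      continuous_on_subset[OF vol_density_continuous[OF assms(1)] assms(3)]] .

text \<open>\<open>transition_jacobian\<close> picks some derivative within the overlap, if there is
  one. A smooth local extension shows that there is, also at boundary points.\<close>

lemma transition_has_derivative:
  assumes cd: "c \<in> \<A>" "d \<in> \<A>" and x: "x \<in> snd c ` (fst c \<inter> fst d)"
  shows "((snd d \<circ> chart_inv c) has_derivative
      (\<lambda>v. transition_jacobian c d (chart_inv c x) *v v)) (at x within snd c ` (fst c \<inter> fst d))"
proof -
  let ?S = "snd c ` (fst c \<inter> fst d)" and ?T = "snd d \<circ> chart_inv c"
  have xi: "x \<in> chart_image c" using x by auto
  have "smooth_on ?S ?T"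
    using smooth_manifold cd unfolding smooth_manifold_def smoothly_compatible_def by blast
  from bspec[OF this[unfolded smooth_on_def] x]
  obtain W h where W: "open W" "x \<in> W" "\<forall>k. Ck_on k W h" "\<forall>y\<in>?S \<inter> W. h y = ?T y"
    by (elim exE conjE)
  have "(h has_derivative frechet_derivative h (at x)) (at x within ?S)"
    using Ck_on_1_has_derivative[OF W(3)[rule_format] W(2)] by (rule has_derivative_at_withinI)
  then have "(?T has_derivative frechet_derivative h (at x)) (at x within ?S)"
  proof (rule has_derivative_transform_eventually)
    show "\<forall>\<^sub>F y in at x within ?S. h y = ?T y"
      unfolding eventually_at_topological using W by (intro exI[of _ W]) blast
    show "h x = ?T x" using W(2,4) x by blast
  qed (rule x)
  then have "(?T has_derivative frechet_derivative ?T (at x within ?S)) (at x within ?S)"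
    unfolding frechet_derivative_works[symmetric] differentiable_def by blast
  moreover have "frechet_derivative ?T (at x within ?S) = (\<lambda>v. transition_jacobian c d (chart_inv c x) *v v)"
    unfolding transition_jacobian_def chart_chart_inv[OF cd(1) xi]
    using has_derivative_linear[OF calculation] by (simp add: matrix_works)
  ultimately show ?thesis by simp
qed

text \<open>The square of this identity is the determinant of the transformation law of the
  metric.\<close>

lemma vol_density_transition:
  assumes cd: "c \<in> \<A>" "d \<in> \<A>" and x: "x \<in> snd c ` (fst c \<inter> fst d)"
  shows "vol_density c x = \<bar>det (transition_jacobian c d (chart_inv c x))\<bar> * vol_density d (snd d (chart_inv c x))"
proof -
  let ?p = "chart_inv c x"
  have p: "?p \<in> fst c \<inter> fst d" using x cd by auto
  have "g c ?p = transpose (transition_jacobian c d ?p) ** g d ?p ** transition_jacobian c d ?p"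
    using C0_metric cd p unfolding C0_metric_def by blast
  then have "det (g c ?p) = (det (transition_jacobian c d ?p))\<^sup>2 * det (g d ?p)"
    by (simp add: det_mul power2_eq_square)
  moreover have "chart_inv d (snd d ?p) = ?p" using p cd by simp
  ultimately show ?thesis by (simp add: vol_density_def real_sqrt_mult)
qed

section \<open>Independence of the chart, existence and uniqueness of the volume measure\<close>

definition chart_volume :: "('a, 'n) chart \<Rightarrow> 'a set \<Rightarrow> ennreal" where
  "chart_volume c B = (\<integral>\<^sup>+x\<in>snd c ` B. ennreal (vol_density c x) \<partial>lborel)"

text \<open>The Jacobian factor in the change of variables is exactly the ratio of the two volume
  densities.\<close>

lemma chart_volume_eq:
  assumes cd: "c \<in> \<A>" "d \<in> \<A>" and B: "B \<in> sets borel" "B \<subseteq> fst c" "B \<subseteq> fst d"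
  shows "chart_volume c B = chart_volume d B"
proof -
  let ?T = "snd d \<circ> chart_inv c"
  have img: "?T ` snd c ` B = snd d ` B"
    using B cd by (force simp: image_image intro!: image_cong)
  have sub: "snd c ` B \<subseteq> snd c ` (fst c \<inter> fst d)" using B by auto
  have "(\<integral>\<^sup>+x\<in>?T ` snd c ` B. ennreal (vol_density d x) \<partial>lborel) = (\<integral>\<^sup>+x\<in>snd c ` B. ennreal (vol_density c x) \<partial>lborel)"
  proof (rule set_nn_integral_change_of_variables)
    show "snd c ` B \<in> sets borel" using chart_image_of_borel cd B by blast
    show "(?T has_derivative (\<lambda>v. transition_jacobian c d (chart_inv c x) *v v)) (at x within snd c ` B)"
      if "x \<in> snd c ` B" for x
      by (rule has_derivative_subset[OF transition_has_derivative[OF cd] sub]) (use that sub in blast)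
    show "inj_on ?T (snd c ` B)"
      using B cd by (auto simp: inj_on_def subset_iff) (metis chart_inv_chart)
    show "set_borel_measurable borel (?T ` snd c ` B) (vol_density d)"
      unfolding img using B cd by (intro vol_density_measurable chart_image_of_borel) auto
    show "0 \<le> vol_density d x" if "x \<in> ?T ` snd c ` B" for x
      using that B cd unfolding img by (intro less_imp_le vol_density_pos) auto
    show "set_borel_measurable borel (snd c ` B) (vol_density c)"
      using B cd by (intro vol_density_measurable chart_image_of_borel) auto
    show "vol_density c x = \<bar>det (matrix (\<lambda>v. transition_jacobian c d (chart_inv c x) *v v))\<bar> * vol_density d (?T x)"
      if "x \<in> snd c ` B" for x
      using vol_density_transition[OF cd] that sub by auto
  qed
  then show ?thesis unfolding chart_volume_def img by simp
qed

text \<open>A Borel function on all of the coordinate space, so that a chart measure can be written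
  as a pushforward. The value off the chart image carries no mass in
  \<open>chart_measure\<close>.\<close>

definition chart_param :: "('a, 'n) chart \<Rightarrow> real ^ 'n \<Rightarrow> 'a" where
  "chart_param c x = (if x \<in> chart_image c then chart_inv c x else undefined)"

definition chart_measure :: "('a, 'n) chart \<Rightarrow> 'a measure" where
  "chart_measure c = distr (density lborel (\<lambda>x. ennreal (indicator (chart_image c) x * vol_density c x)))
     borel (chart_param c)"

lemma chart_param_measurable: "c \<in> \<A> \<Longrightarrow> chart_param c \<in> borel_measurable borel"
  unfolding chart_param_def[abs_def]
  by (intro borel_measurable_continuous_on_if chart_image_borel chart_inv_continuous continuous_on_const)

lemma chart_weight_measurable:
  "c \<in> \<A> \<Longrightarrow> (\<lambda>x. indicator (chart_image c) x * vol_density c x) \<in> borel_measurable borel"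
  using vol_density_measurable[of c "chart_image c"] chart_image_borel[of c]
  by (simp add: set_borel_measurable_def)

lemma emeasure_chart_measure:
  assumes c: "c \<in> \<A>" and B: "B \<in> sets borel"
  shows "emeasure (chart_measure c) B = chart_volume c (B \<inter> fst c)"
proof -
  note [measurable] = chart_param_measurable[OF c] chart_weight_measurable[OF c]
  have [measurable]: "chart_param c -` B \<in> sets borel"
    using measurable_sets_borel[OF chart_param_measurable[OF c] B] .
  have "emeasure (chart_measure c) B =
    (\<integral>\<^sup>+x. ennreal (indicator (chart_image c) x * vol_density c x) * indicator (chart_param c -` B) x \<partial>lborel)"
    unfolding chart_measure_def using B by (simp add: emeasure_distr emeasure_density)
  also have "\<dots> = (\<integral>\<^sup>+x\<in>snd c ` (B \<inter> fst c). ennreal (vol_density c x) \<partial>lborel)"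
  proof (rule nn_integral_cong)
    fix x
    have "x \<in> snd c ` (B \<inter> fst c) \<longleftrightarrow> x \<in> chart_image c \<and> chart_param c x \<in> B"
    proof
      assume "x \<in> chart_image c \<and> chart_param c x \<in> B"
      then have x: "x \<in> chart_image c" "chart_inv c x \<in> B" by (auto simp: chart_param_def)
      show "x \<in> snd c ` (B \<inter> fst c)"
        using chart_chart_inv[OF c x(1), symmetric] chart_inv_in[OF c x(1)] x(2) by blast
    next
      assume "x \<in> snd c ` (B \<inter> fst c)"
      then obtain p where "p \<in> B" "p \<in> fst c" "x = snd c p" by blast
      then show "x \<in> chart_image c \<and> chart_param c x \<in> B"
        using c by (simp add: chart_param_def)
    qed
    then show "ennreal (indicator (chart_image c) x * vol_density c x) * indicator (chart_param c -` B) x =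
      ennreal (vol_density c x) * indicator (snd c ` (B \<inter> fst c)) x"
      by (auto simp: indicator_def)
  qed
  finally show ?thesis by (simp add: chart_volume_def)
qed

definition is_volume :: "'a measure \<Rightarrow> bool" where
  "is_volume \<mu> \<longleftrightarrow> sets \<mu> = sets borel \<and>
     (\<forall>c\<in>\<A>. \<forall>B\<in>sets borel. B \<subseteq> fst c \<longrightarrow> emeasure \<mu> B = chart_volume c B)"

text \<open>Second countability enters here, by way of the Lindelof property.\<close>

lemma countable_atlas: "\<exists>e :: nat \<Rightarrow> ('a, 'n) chart. range e \<subseteq> \<A> \<and> (\<Union>i. fst (e i)) = UNIV"
proof -
  have "\<And>S. S \<in> fst ` \<A> \<Longrightarrow> openin (top_of_set UNIV) S"
    using chart_open by auto
  then obtain F where F: "F \<subseteq> fst ` \<A>" "countable F" "\<Union>F = \<Union>(fst ` \<A>)"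
    using Lindelof_openin[of "fst ` \<A>" UNIV] by metis
  from countable_subset_image[THEN iffD1, OF conjI[OF F(2,1)]]
  obtain C where C: "countable C" "C \<subseteq> \<A>" "F = fst ` C"
    by (elim exE conjE)
  have U: "(\<Union>c\<in>C. fst c) = UNIV" 
  proof -
    have "(\<Union>c\<in>C. fst c) = (\<Union>c\<in>\<A>. fst c)" using F(3) C(3) by simp
    also have "\<dots> = UNIV" using charts_cover by auto
    finally show ?thesis .
  qed
  then have "C \<noteq> {}" by auto
  then have "range (from_nat_into C) = C" using C(1) by (rule range_from_nat_into)
  then have "range (from_nat_into C) \<subseteq> \<A>" "(\<Union>i. fst (from_nat_into C i)) = UNIV"
    using C(2) U by (simp_all add: image_image[symmetric])
  then show ?thesis by blast
qed

text \<open>\<open>riemannian_volume\<close> is a definite description, so both halves are required.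
  The manifold is cut into countably many disjoint Borel pieces \<open>D i\<close>, each inside one
  chart, and the chart measures of the pieces are added. On an overlap the choice of chart is
  immaterial by \<open>chart_volume_eq\<close>; any other candidate has the same values on subsets
  of the pieces, hence everywhere.\<close>

lemma volume_exists_unique: "\<exists>!\<mu>. is_volume \<mu>"
proof -
  from countable_atlas obtain e :: "nat \<Rightarrow> ('a, 'n) chart"
    where e: "range e \<subseteq> \<A>" "(\<Union>i. fst (e i)) = UNIV" by (elim exE conjE)
  have eA: "e i \<in> \<A>" for i using e(1) by auto
  define D where "D = disjointed (\<lambda>i. fst (e i))"
  have D: "D i \<in> sets borel" "D i \<subseteq> fst (e i)" for i
  proof -
    have "range (\<lambda>i. fst (e i)) \<subseteq> sets borel" using chart_open[OF eA] by auto
    from sets.range_disjointed_sets[OF this] show "D i \<in> sets borel" unfolding D_def by blast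
    show "D i \<subseteq> fst (e i)" unfolding D_def by (rule disjointed_subset)
  qed
  have Ddisj: "disjoint_family D" and DU: "(\<Union>i. D i) = UNIV"
    unfolding D_def by (simp_all add: disjoint_family_disjointed UN_disjointed_eq e)
  have split: "emeasure \<nu> B = (\<Sum>i. emeasure \<nu> (B \<inter> D i))" if "sets \<nu> = sets borel" "B \<in> sets borel" for \<nu> B
  proof -
    have "(\<Sum>i. emeasure \<nu> (B \<inter> D i)) = emeasure \<nu> (\<Union>i. B \<inter> D i)"
      using Ddisj D(1) that by (intro suminf_emeasure) (auto simp: disjoint_family_on_def)
    also have "(\<Union>i. B \<inter> D i) = B" using DU by blast
    finally show ?thesis ..
  qed
  let ?m = "\<lambda>B. \<Sum>i. emeasure (chart_measure (e i)) (B \<inter> D i)"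
  define \<mu> where "\<mu> = measure_of UNIV (sets borel) ?m"
  have sets_\<mu>: "sets \<mu> = sets borel"
    unfolding \<mu>_def using sets.sigma_sets_eq[of "borel :: 'a measure"] by (simp add: sets_measure_of)
  have cm: "sets (chart_measure d) = sets borel" for d by (simp add: chart_measure_def)
  have em: "emeasure \<mu> B = ?m B" if "B \<in> sets borel" for B
  proof (rule emeasure_measure_of[OF \<mu>_def])
    show "positive (sets \<mu>) ?m" by (simp add: positive_def)
    show "B \<in> sets \<mu>" using that sets_\<mu> by simp
    show "countably_additive (sets \<mu>) ?m"
    proof (rule countably_additiveI)
      fix B :: "nat \<Rightarrow> 'a set" assume B: "range B \<subseteq> sets \<mu>" "disjoint_family B"
      \<comment> \<open>The sum over pieces is read as an integral over counting measure, so that it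
        can be interchanged with the sum over k.\<close>
      have "(\<Sum>k. ?m (B k)) = (\<Sum>k. \<integral>\<^sup>+i. emeasure (chart_measure (e i)) (B k \<inter> D i) \<partial>count_space UNIV)"
        by (simp add: nn_integral_count_space_nat)
      also have "\<dots> = (\<integral>\<^sup>+i. (\<Sum>k. emeasure (chart_measure (e i)) (B k \<inter> D i)) \<partial>count_space UNIV)"
        by (rule nn_integral_suminf[symmetric]) simp
      also have "\<dots> = (\<integral>\<^sup>+i. emeasure (chart_measure (e i)) (\<Union>k. B k \<inter> D i) \<partial>count_space UNIV)"
        using B D(1) by (intro nn_integral_cong suminf_emeasure) (auto simp: cm sets_\<mu> disjoint_family_on_def)
      also have "\<dots> = ?m (\<Union>k. B k)" by (simp add: nn_integral_count_space_nat)
      finally show "(\<Sum>k. ?m (B k)) = ?m (\<Union>k. B k)" .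
    qed
  qed auto
  have on_D: "chart_volume (e i) (B \<inter> D i) = chart_volume c (B \<inter> D i)"
    if "c \<in> \<A>" "B \<in> sets borel" "B \<subseteq> fst c" for c B i
    using that D(1)[of i] D(2)[of i] by (intro chart_volume_eq eA) auto
  have mD: "emeasure (chart_measure (e i)) (B \<inter> D i) = chart_volume (e i) (B \<inter> D i)"
    if "B \<in> sets borel" for B i
    using emeasure_chart_measure[OF eA, of "B \<inter> D i" i] D(1)[of i] D(2)[of i] that
    by (simp add: Int_absorb2 le_infI2)
  have "is_volume \<mu>"
    unfolding is_volume_def
  proof (intro conjI ballI impI sets_\<mu>)
    fix c B assume c: "c \<in> \<A>" and B: "B \<in> sets borel" "B \<subseteq> fst c"
    have "emeasure (chart_measure c) (B \<inter> D i) = chart_volume (e i) (B \<inter> D i)" for i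
      using emeasure_chart_measure[OF c, of "B \<inter> D i"] on_D[OF c B] B D by (simp add: Int_absorb2 le_infI1)
    then have "emeasure \<mu> B = (\<Sum>i. emeasure (chart_measure c) (B \<inter> D i))"
      by (simp add: em[OF B(1)] mD[OF B(1)])
    also have "\<dots> = chart_volume c B"
      using split[OF cm B(1), of c] emeasure_chart_measure[OF c B(1)] B(2) by (simp add: Int_absorb2)
    finally show "emeasure \<mu> B = chart_volume c B" .
  qed
  moreover have "\<nu> = \<mu>" if \<nu>: "is_volume \<nu>" for \<nu>
  proof (rule measure_eqI)
    have s: "sets \<nu> = sets borel" using \<nu> by (simp add: is_volume_def)
    then show "sets \<nu> = sets \<mu>" by (simp add: sets_\<mu>)
    fix B assume "B \<in> sets \<nu>"
    then have B: "B \<in> sets borel" using s by simp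
    have "emeasure \<nu> (B \<inter> D i) = emeasure \<mu> (B \<inter> D i)" for i
      using \<nu> \<open>is_volume \<mu>\<close> eA[of i] B D[of i] unfolding is_volume_def by (simp add: le_infI2)
    then show "emeasure \<nu> B = emeasure \<mu> B"
      using split[OF s B] split[OF sets_\<mu> B] by simp
  qed
  ultimately show ?thesis by blast
qed

abbreviation vol :: "'a measure" where "vol \<equiv> riemannian_volume \<A> g"

lemma is_volume_vol: "is_volume vol"
proof -
  have "vol = (THE \<mu>. is_volume \<mu>)"
    unfolding riemannian_volume_def is_volume_def chart_volume_def vol_density_def ..
  then show ?thesis using theI'[OF volume_exists_unique] by simp
qed

lemma sets_vol [measurable_cong, simp]: "sets vol = sets borel"
  using is_volume_vol by (simp add: is_volume_def)

lemma space_vol [simp]: "space vol = UNIV"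
  using sets_eq_imp_space_eq[OF sets_vol] by simp

lemma emeasure_vol:
  assumes "c \<in> \<A>" "B \<in> sets borel" "B \<subseteq> fst c"
  shows "emeasure vol B = (\<integral>\<^sup>+x\<in>snd c ` B. ennreal (vol_density c x) \<partial>lborel)"
  using is_volume_vol assms unfolding is_volume_def chart_volume_def by blast

section \<open>Integration in coordinates\<close>

lemma chart_measure_eq: 
  assumes c: "c \<in> \<A>" shows "density vol (indicator (fst c)) = chart_measure c"
proof (rule measure_eqI)
  fix B assume "B \<in> sets (density vol (indicator (fst c)))"
  then have B: "B \<in> sets borel" by simp
  have o: "fst c \<in> sets borel" using chart_open[OF c] by simp
  have "emeasure (density vol (indicator (fst c))) B = emeasure vol (B \<inter> fst c)"
    using B o by (simp add: emeasure_density indicator_inter_arith[symmetric] Int_commute)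
  also have "\<dots> = chart_volume c (B \<inter> fst c)"
    using is_volume_vol c B o by (auto simp: is_volume_def)
  finally show "emeasure (density vol (indicator (fst c))) B = emeasure (chart_measure c) B"
    using emeasure_chart_measure[OF c B] by simp
qed (simp add: chart_measure_def)

lemma nn_integral_chart:
  assumes c: "c \<in> \<A>" and f: "f \<in> borel_measurable borel"
  shows "(\<integral>\<^sup>+p\<in>fst c. f p \<partial>vol) =
    (\<integral>\<^sup>+x. ennreal (indicator (chart_image c) x * vol_density c x) * f (chart_inv c x) \<partial>lborel)"
proof -
  note [measurable] = chart_param_measurable[OF c] chart_weight_measurable[OF c] f
  have [measurable]: "fst c \<in> sets borel" using chart_open[OF c] by simp
  have "(\<integral>\<^sup>+p\<in>fst c. f p \<partial>vol) = integral\<^sup>N (density vol (indicator (fst c))) f"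
    by (subst nn_integral_density) (auto simp: mult.commute)
  also have "\<dots> = (\<integral>\<^sup>+x. ennreal (indicator (chart_image c) x * vol_density c x) * f (chart_param c x) \<partial>lborel)"
    unfolding chart_measure_eq[OF c] chart_measure_def
    by (simp add: nn_integral_distr nn_integral_density)
  also have "\<dots> = (\<integral>\<^sup>+x. ennreal (indicator (chart_image c) x * vol_density c x) * f (chart_inv c x) \<partial>lborel)"
    by (rule nn_integral_cong) (simp add: chart_param_def indicator_def)
  finally show ?thesis .
qed

lemma integral_chart:
  fixes f :: "'a \<Rightarrow> real"
  assumes c: "c \<in> \<A>" and f: "f \<in> borel_measurable borel"
  shows "(LINT p:fst c|vol. f p) = (LINT x:chart_image c|lborel. vol_density c x * f (chart_inv c x))"
proof -
  note [measurable] = chart_param_measurable[OF c] chart_weight_measurable[OF c] f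
  have [measurable]: "fst c \<in> sets borel" using chart_open[OF c] by simp
  have nn: "0 \<le> indicator (chart_image c) x * vol_density c x" for x
    using vol_density_pos[OF c, of x] by (auto simp: indicator_def less_imp_le)
  have d: "density vol (indicator (fst c)) = density vol (\<lambda>p. ennreal (indicator (fst c) p))"
    by (simp add: ennreal_indicator)
  have eq: "(\<lambda>x. (indicator (chart_image c) x * vol_density c x) *\<^sub>R f (chart_param c x)) =
    (\<lambda>x. indicator (chart_image c) x *\<^sub>R (vol_density c x * f (chart_inv c x)))"
    by (auto simp: chart_param_def indicator_def)
  have "(LINT p:fst c|vol. f p) = integral\<^sup>L (density vol (indicator (fst c))) f"
    unfolding d set_lebesgue_integral_def by (subst integral_density) auto
  also have "\<dots> = integral\<^sup>L lborel (\<lambda>x. (indicator (chart_image c) x * vol_density c x) *\<^sub>R f (chart_param c x))"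
    unfolding chart_measure_eq[OF c] chart_measure_def
    using nn by (subst integral_distr) (auto simp: integral_density)
  finally show "(LINT p:fst c|vol. f p) = (LINT x:chart_image c|lborel. vol_density c x * f (chart_inv c x))"
    unfolding eq set_lebesgue_integral_def .
qed

end

section \<open>Differentiable functions and vector fields on the manifold\<close>

lemma smooth_on_subset:
  assumes "smooth_on S f" "T \<subseteq> S" "\<And>x. x \<in> T \<Longrightarrow> f' x = f x"
  shows "smooth_on T f'"
  unfolding smooth_on_def
proof
  fix x assume x: "x \<in> T"
  with assms(2) have "x \<in> S" by blast
  from bspec[OF assms(1)[unfolded smooth_on_def] this]
  obtain W h where "open W" "x \<in> W" "\<forall>k. Ck_on k W h" "\<forall>y\<in>S \<inter> W. h y = f y"
    by (elim exE conjE)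
  then show "\<exists>W h. open W \<and> x \<in> W \<and> (\<forall>k. Ck_on k W h) \<and> (\<forall>y\<in>T \<inter> W. h y = f' y)"
    using assms(2,3) by (intro exI[of _ W] exI[of _ h]) auto
qed

context c0_manifold
begin

text \<open>This rests on maximality of the atlas. It is used to shrink charts into the interior and
  away from the support of a field.\<close>

lemma chart_restrict:
  assumes c: "c \<in> \<A>" and U: "open U"
  shows "(fst c \<inter> U, snd c) \<in> \<A>"
proof -
  let ?c = "(fst c \<inter> U, snd c)"
  have oi: "openin (top_of_set (chart_image c)) (snd c ` (fst c \<inter> U))"
    by (rule chart_image_openin[OF c U])
  have inj: "inj_on (snd c) (fst c)"
    using chart_inv_chart[OF c] by (metis inj_onI)
  have inv: "chart_inv ?c x = chart_inv c x" if "x \<in> snd c ` (fst c \<inter> U)" for x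
    using that inj by (auto simp: inv_into_f_f inj_on_Int)
  have "is_chart ?c"
    unfolding is_chart_def
  proof (intro conjI)
    show "open (fst ?c)" using chart_open[OF c] U by auto
    show "open (chart_image ?c) \<or> (\<exists>k. openin (top_of_set {x. 0 \<le> x $ k}) (chart_image ?c))"
      using chart_is_chart[OF c] oi unfolding is_chart_def
      by (auto intro: openin_trans simp: openin_open_eq)
    have "homeomorphism (fst c \<inter> U) (snd c ` (fst c \<inter> U)) (snd c) (chart_inv c)"
      by (rule homeomorphism_of_subsets[OF chart_homeomorphism[OF c]]) auto
    then show "homeomorphism (fst ?c) (chart_image ?c) (snd ?c) (chart_inv ?c)"
      using inv by (auto intro: homeomorphism_cong)
  qed
  moreover have "smoothly_compatible ?c d" if d: "d \<in> \<A>" for d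
  proof -
    have cd: "smoothly_compatible c d"
      using smooth_manifold c d unfolding smooth_manifold_def by blast
    have "smooth_on (snd c ` (fst c \<inter> U \<inter> fst d)) (snd d \<circ> chart_inv ?c)"
      by (rule smooth_on_subset[of "snd c ` (fst c \<inter> fst d)" "snd d \<circ> chart_inv c"])
        (use cd inv in \<open>auto simp: smoothly_compatible_def simp del: fst_conv snd_conv\<close>)
    moreover have "smooth_on (snd d ` (fst c \<inter> U \<inter> fst d)) (snd c \<circ> chart_inv d)"
      by (rule smooth_on_subset[of "snd d ` (fst c \<inter> fst d)" "snd c \<circ> chart_inv d"])
        (use cd in \<open>auto simp: smoothly_compatible_def\<close>)
    ultimately show ?thesis by (simp add: smoothly_compatible_def)
  qed
  ultimately show ?thesis
    using smooth_manifold unfolding smooth_manifold_def by blast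
qed

text \<open>Charts with open image cover the interior, and in them derivatives are ordinary
  two-sided ones, hence unique.\<close>

definition icharts :: "('a, 'n) chart set" where
  "icharts = {c \<in> \<A>. open (chart_image c)}"

abbreviation "\<I> \<equiv> manifold_interior \<A>"

lemma icharts_D: "c \<in> icharts \<Longrightarrow> c \<in> \<A>" "c \<in> icharts \<Longrightarrow> open (chart_image c)"
  by (auto simp: icharts_def)

lemma icharts_subset_interior: "c \<in> icharts \<Longrightarrow> fst c \<subseteq> \<I>"
  unfolding manifold_interior_def icharts_def by (auto simp: interior_open)

lemma ichart_exists:
  assumes "p \<in> \<I>" shows "\<exists>c\<in>icharts. p \<in> fst c"
proof -
  from assms obtain c where c: "c \<in> \<A>" and p: "p \<in> fst c" "snd c p \<in> interior (chart_image c)"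
    unfolding manifold_interior_def by auto
  have "open (fst c \<inter> snd c -` interior (chart_image c))"
    by (rule continuous_open_preimage[OF chart_continuous[OF c] chart_open[OF c] open_interior])
  from chart_restrict[OF c this] have "(fst c \<inter> snd c -` interior (chart_image c), snd c) \<in> \<A>"
    by (simp add: Int_absorb1)
  moreover have "snd c ` (fst c \<inter> snd c -` interior (chart_image c)) = interior (chart_image c)"
    using interior_subset[of "chart_image c"] by blast
  ultimately show ?thesis
    using p by (intro bexI[of _ "(fst c \<inter> snd c -` interior (chart_image c), snd c)"])
      (auto simp: icharts_def)
qed

lemma interior_open: "open \<I>"
proof -
  have "\<I> = (\<Union>c\<in>icharts. fst c)"
    using ichart_exists icharts_subset_interior by blast
  then show ?thesis using chart_open[OF icharts_D(1)] by (simp add: open_UN)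
qed

lemma interior_borel [measurable]: "\<I> \<in> sets borel"
  using interior_open by simp

lemma overlap_open:
  assumes "c \<in> icharts" "open U" shows "open (snd c ` (fst c \<inter> U))"
  using chart_image_openin[OF icharts_D(1)[OF assms(1)] assms(2)] icharts_D(2)[OF assms(1)]
  by (simp add: openin_open_eq)

lemma transition_C1:
  assumes c: "c \<in> icharts" and d: "d \<in> \<A>"
  shows "Ck_on (Suc 0) (snd c ` (fst c \<inter> fst d)) (snd d \<circ> chart_inv c)"
proof (rule Ck_on_1_locally)
  let ?S = "snd c ` (fst c \<inter> fst d)"
  fix x assume x: "x \<in> ?S"
  have "smooth_on ?S (snd d \<circ> chart_inv c)"
    using smooth_manifold icharts_D(1)[OF c] d unfolding smooth_manifold_def smoothly_compatible_def by blast
  from bspec[OF this[unfolded smooth_on_def] x]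
  obtain W h where W: "open W" "x \<in> W" "\<forall>k. Ck_on k W h" "\<forall>y\<in>?S \<inter> W. h y = (snd d \<circ> chart_inv c) y"
    by (elim exE conjE)
  have "Ck_on (Suc 0) (?S \<inter> W) h"
    by (rule Ck_on_1_subset[OF W(3)[rule_format, of "Suc 0"]]) simp
  then show "\<exists>W h. open W \<and> x \<in> W \<and> Ck_on (Suc 0) W h \<and> (\<forall>y\<in>W. h y = (snd d \<circ> chart_inv c) y)"
    using x W overlap_open[OF c chart_open[OF d]]
    by (intro exI[of _ "?S \<inter> W"] exI[of _ h]) auto
qed

lemma transition_derivative:
  assumes c: "c \<in> icharts" and d: "d \<in> \<A>" and p: "p \<in> fst c" "p \<in> fst d"
  shows "((snd d \<circ> chart_inv c) has_derivative (\<lambda>v. transition_jacobian c d p *v v)) (at (snd c p))"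
proof -
  have "snd c p \<in> snd c ` (fst c \<inter> fst d)" using p by blast
  from transition_has_derivative[OF icharts_D(1)[OF c] d this] at_within_open[OF this overlap_open[OF c chart_open[OF d]]]
  show ?thesis using p icharts_D(1)[OF c] by simp
qed

section \<open>C^1 functions and their derivatives along vector fields\<close>

definition C1_fun :: "('a \<Rightarrow> real) \<Rightarrow> bool" where
  "C1_fun \<psi> \<longleftrightarrow> (\<forall>c\<in>icharts. Ck_on (Suc 0) (chart_image c) (\<psi> \<circ> chart_inv c))"

definition dir_deriv :: "('a \<Rightarrow> real) \<Rightarrow> ('a, 'n) vector_field \<Rightarrow> 'a \<Rightarrow> real" where
  "dir_deriv \<psi> X p = (let c = (SOME c. c \<in> icharts \<and> p \<in> fst c) in
     frechet_derivative (\<psi> \<circ> chart_inv c) (at (snd c p)) (X c p))"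

lemma C1_funD: "C1_fun \<psi> \<Longrightarrow> c \<in> icharts \<Longrightarrow> Ck_on (Suc 0) (chart_image c) (\<psi> \<circ> chart_inv c)"
  by (simp add: C1_fun_def)

lemma C1_fun_has_derivative:
  "C1_fun \<psi> \<Longrightarrow> c \<in> icharts \<Longrightarrow> p \<in> fst c \<Longrightarrow>
    ((\<psi> \<circ> chart_inv c) has_derivative frechet_derivative (\<psi> \<circ> chart_inv c) (at (snd c p))) (at (snd c p))"
  by (rule Ck_on_1_has_derivative[OF C1_funD]) auto

text \<open>The arbitrary chart in the definition is harmless: the Jacobian from the chain rule is
  the one by which the components of the field transform.\<close>

lemma dir_deriv_eq:
  assumes \<psi>: "C1_fun \<psi>" and X: "is_vector_field \<A> X" and c: "c \<in> icharts" and p: "p \<in> fst c"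
  shows "dir_deriv \<psi> X p = frechet_derivative (\<psi> \<circ> chart_inv c) (at (snd c p)) (X c p)"
proof -
  define d where "d = (SOME c. c \<in> icharts \<and> p \<in> fst c)"
  have d: "d \<in> icharts" "p \<in> fst d"
    using someI[of "\<lambda>c. c \<in> icharts \<and> p \<in> fst c" c] c p unfolding d_def by auto
  note cA = icharts_D(1)[OF c] and dA = icharts_D(1)[OF d(1)]
  let ?D = "frechet_derivative (\<psi> \<circ> chart_inv d) (at (snd d p))"
  have eq: "(snd d \<circ> chart_inv c) (snd c p) = snd d p" using p cA by simp
  have "(((\<psi> \<circ> chart_inv d) \<circ> (snd d \<circ> chart_inv c)) has_derivative
      (?D \<circ> (\<lambda>v. transition_jacobian c d p *v v))) (at (snd c p))"
    by (rule diff_chain_at[OF transition_derivative[OF c dA p d(2)]])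
      (use C1_fun_has_derivative[OF \<psi> d] eq in simp)
  then have "((\<psi> \<circ> chart_inv c) has_derivative (?D \<circ> (\<lambda>v. transition_jacobian c d p *v v))) (at (snd c p))"
  proof (rule has_derivative_transform_within_open)
    show "open (snd c ` (fst c \<inter> fst d))" by (rule overlap_open[OF c chart_open[OF dA]])
    show "snd c p \<in> snd c ` (fst c \<inter> fst d)" using p d by blast
    show "((\<psi> \<circ> chart_inv d) \<circ> (snd d \<circ> chart_inv c)) x = (\<psi> \<circ> chart_inv c) x"
      if "x \<in> snd c ` (fst c \<inter> fst d)" for x
      using that cA dA by auto
  qed
  then have "frechet_derivative (\<psi> \<circ> chart_inv c) (at (snd c p)) = ?D \<circ> (\<lambda>v. transition_jacobian c d p *v v)"
    by (rule frechet_derivative_at[symmetric])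
  moreover have "X d p = transition_jacobian c d p *v X c p"
    using X cA dA p d(2) unfolding is_vector_field_def by blast
  ultimately show ?thesis by (simp add: dir_deriv_def d_def[symmetric])
qed

lemma C1_fun_const: "C1_fun (\<lambda>_. k)"
  by (simp add: C1_fun_def comp_def Ck_on_1_const del: Ck_on.simps)

lemma C1_fun_mult: "C1_fun \<psi> \<Longrightarrow> C1_fun \<phi> \<Longrightarrow> C1_fun (\<lambda>p. \<psi> p * \<phi> p)"
  using Ck_on_1_mult unfolding C1_fun_def comp_def by blast

lemma C1_fun_diff: "C1_fun \<psi> \<Longrightarrow> C1_fun \<phi> \<Longrightarrow> C1_fun (\<lambda>p. \<psi> p - \<phi> p)"
  using Ck_on_1_diff unfolding C1_fun_def comp_def by blast

lemma C1_fun_prod: "finite P \<Longrightarrow> (\<And>i. i \<in> P \<Longrightarrow> C1_fun (\<eta> i)) \<Longrightarrow> C1_fun (\<lambda>p. \<Prod>i\<in>P. \<eta> i p)"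
  by (induction P rule: finite_induct) (auto intro: C1_fun_const C1_fun_mult)

lemma C1_fun_continuous:
  assumes \<psi>: "C1_fun \<psi>" shows "continuous_on \<I> \<psi>"
proof (rule continuous_at_imp_continuous_on, rule ballI)
  fix p assume "p \<in> \<I>"
  then obtain c where c: "c \<in> icharts" "p \<in> fst c" using ichart_exists by blast
  note cA = icharts_D(1)[OF c(1)]
  have "continuous_on (fst c) ((\<psi> \<circ> chart_inv c) \<circ> snd c)"
    by (rule continuous_on_compose[OF chart_continuous[OF cA]])
      (rule Ck_on_1_continuous_on[OF C1_funD[OF \<psi> c(1)]])
  then have "continuous_on (fst c) \<psi>"
    by (rule continuous_on_eq) (simp add: cA)
  then show "isCont \<psi> p"
    using c(2) chart_open[OF cA] continuous_on_eq_continuous_at by blast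
qed

lemma dir_deriv_mult:
  assumes "C1_fun \<psi>" "C1_fun \<phi>" and X: "is_vector_field \<A> X" and p: "p \<in> \<I>"
  shows "dir_deriv (\<lambda>p. \<psi> p * \<phi> p) X p = \<psi> p * dir_deriv \<phi> X p + dir_deriv \<psi> X p * \<phi> p"
proof -
  obtain c where c: "c \<in> icharts" "p \<in> fst c" using p ichart_exists by blast
  have "((\<lambda>x. (\<psi> \<circ> chart_inv c) x * (\<phi> \<circ> chart_inv c) x) has_derivative
    (\<lambda>v. (\<psi> \<circ> chart_inv c) (snd c p) * frechet_derivative (\<phi> \<circ> chart_inv c) (at (snd c p)) v +
      frechet_derivative (\<psi> \<circ> chart_inv c) (at (snd c p)) v * (\<phi> \<circ> chart_inv c) (snd c p))) (at (snd c p))"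
    by (rule has_derivative_mult[OF C1_fun_has_derivative[OF assms(1) c] C1_fun_has_derivative[OF assms(2) c]])
  from frechet_derivative_at[OF this, symmetric] show ?thesis
    using c icharts_D(1)[OF c(1)]
    by (simp add: dir_deriv_eq[OF _ X c] assms C1_fun_mult comp_def)
qed

lemma dir_deriv_diff:
  assumes "C1_fun \<psi>" "C1_fun \<phi>" and X: "is_vector_field \<A> X" and p: "p \<in> \<I>"
  shows "dir_deriv (\<lambda>p. \<psi> p - \<phi> p) X p = dir_deriv \<psi> X p - dir_deriv \<phi> X p"
proof -
  obtain c where c: "c \<in> icharts" "p \<in> fst c" using p ichart_exists by blast
  have "((\<lambda>x. (\<psi> \<circ> chart_inv c) x - (\<phi> \<circ> chart_inv c) x) has_derivative
    (\<lambda>v. frechet_derivative (\<psi> \<circ> chart_inv c) (at (snd c p)) v -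
      frechet_derivative (\<phi> \<circ> chart_inv c) (at (snd c p)) v)) (at (snd c p))"
    by (rule has_derivative_diff[OF C1_fun_has_derivative[OF assms(1) c] C1_fun_has_derivative[OF assms(2) c]])
  from frechet_derivative_at[OF this, symmetric] show ?thesis
    by (simp add: dir_deriv_eq[OF _ X c] assms C1_fun_diff comp_def)
qed

lemma dir_deriv_locally_const:
  assumes \<psi>: "C1_fun \<psi>" and X: "is_vector_field \<A> X" and p: "p \<in> \<I>"
    and U: "open U" "p \<in> U" "\<And>q. q \<in> U \<Longrightarrow> \<psi> q = k"
  shows "dir_deriv \<psi> X p = 0"
proof -
  obtain c where c: "c \<in> icharts" "p \<in> fst c" using p ichart_exists by blast
  have "((\<psi> \<circ> chart_inv c) has_derivative (\<lambda>_. 0)) (at (snd c p))"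
    by (rule has_derivative_transform_within_open[of "\<lambda>_. k" _ _ _ "snd c ` (fst c \<inter> U)"])
      (use overlap_open[OF c(1) U(1)] U c icharts_D(1)[OF c(1)] in auto)
  from frechet_derivative_at[OF this, symmetric] show ?thesis
    by (simp add: dir_deriv_eq[OF \<psi> X c])
qed

subsection \<open>Coordinate balls\<close>

definition chart_ball :: "('a, 'n) chart \<Rightarrow> real ^ 'n \<Rightarrow> real \<Rightarrow> 'a set" where
  "chart_ball c x r = fst c \<inter> snd c -` ball x r"

definition chart_cball :: "('a, 'n) chart \<Rightarrow> real ^ 'n \<Rightarrow> real \<Rightarrow> 'a set" where
  "chart_cball c x r = fst c \<inter> snd c -` cball x r"

text \<open>Compactness is required of the part of the closed ball inside the chart image, not
  containment of the ball. This admits half-balls at the manifold boundary and still keeps the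
  coordinate ball from leaking out of the chart.\<close>

definition admissible :: "('a, 'n) chart \<Rightarrow> real ^ 'n \<Rightarrow> real \<Rightarrow> bool" where
  "admissible c x r \<longleftrightarrow> c \<in> \<A> \<and> 0 < r \<and> compact (chart_image c \<inter> cball x r)"

lemma chart_ball_open: "c \<in> \<A> \<Longrightarrow> open (chart_ball c x r)"
  unfolding chart_ball_def
  by (rule continuous_open_preimage[OF chart_continuous chart_open open_ball])

lemma chart_ball_subset: "chart_ball c x r \<subseteq> chart_cball c x r"
  using ball_subset_cball[of x r] by (auto simp: chart_ball_def chart_cball_def)

lemma chart_image_chart_ball: "snd c ` chart_ball c x r = chart_image c \<inter> ball x r"
  by (auto simp: chart_ball_def)

lemma chart_cball_compact:
  assumes "admissible c x r" shows "compact (chart_cball c x r)"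
proof -
  have c: "c \<in> \<A>" using assms by (simp add: admissible_def)
  have "chart_cball c x r = chart_inv c ` (chart_image c \<inter> cball x r)"
  proof (intro equalityI subsetI)
    fix p assume p: "p \<in> chart_cball c x r"
    then have "p = chart_inv c (snd c p)" "snd c p \<in> chart_image c \<inter> cball x r"
      using c by (auto simp: chart_cball_def)
    then show "p \<in> chart_inv c ` (chart_image c \<inter> cball x r)" by blast
  qed (use c in \<open>auto simp: chart_cball_def\<close>)
  then show ?thesis
    using assms unfolding admissible_def
    by (metis compact_continuous_image continuous_on_subset[OF chart_inv_continuous[OF c]] inf_le1)
qed

lemma admissible_mono: "admissible c x r \<Longrightarrow> 0 < s \<Longrightarrow> s \<le> r \<Longrightarrow> admissible c x s"
  unfolding admissible_def
  by (metis (no_types, lifting) compact_Int_closed closed_cball inf.assoc inf.absorb_iff2 subset_cball)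

lemma admissible_exists:
  assumes c: "c \<in> \<A>" and p: "p \<in> fst c"
  shows "\<exists>r. admissible c (snd c p) r"
proof -
  consider "open (chart_image c)" | k where "openin (top_of_set {x. 0 \<le> x $ k}) (chart_image c)"
    using chart_is_chart[OF c] unfolding is_chart_def by blast
  then show ?thesis
  proof cases
    case 1
    then obtain r where "0 < r" "cball (snd c p) r \<subseteq> chart_image c"
      using p open_contains_cball by blast
    then show ?thesis using c by (intro exI[of _ r]) (simp add: admissible_def Int_absorb1)
  next
    case 2
    then obtain T where T: "open T" "chart_image c = {x. 0 \<le> x $ k} \<inter> T"
      by (auto simp: openin_open)
    then obtain r where r: "0 < r" "cball (snd c p) r \<subseteq> T"
      using p open_contains_cball by blast
    then have "chart_image c \<inter> cball (snd c p) r = {x. 0 \<le> x $ k} \<inter> cball (snd c p) r"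
      using T by blast
    moreover have "compact ({x. 0 \<le> x $ k} \<inter> cball (snd c p) r)"
      using closed_Int_compact[OF closed_halfspace_component_ge_cart compact_cball] .
    ultimately show ?thesis using c r by (intro exI[of _ r]) (simp add: admissible_def)
  qed
qed

lemma emeasure_chart_ball_finite:
  assumes "admissible c x r" shows "emeasure vol (chart_ball c x r) < \<infinity>"
proof -
  have c: "c \<in> \<A>" and K: "compact (chart_image c \<inter> cball x r)"
    using assms by (auto simp: admissible_def)
  have "compact (vol_density c ` (chart_image c \<inter> cball x r))"
    by (intro compact_continuous_image K continuous_on_subset[OF vol_density_continuous[OF c]]) auto
  from compact_imp_bounded[OF this, unfolded bounded_pos]
  obtain M where M: "0 < M" "\<forall>z\<in>vol_density c ` (chart_image c \<inter> cball x r). norm z \<le> M"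
    by (elim exE conjE)
  have "emeasure vol (chart_ball c x r) = (\<integral>\<^sup>+z\<in>chart_image c \<inter> ball x r. ennreal (vol_density c z) \<partial>lborel)"
    unfolding chart_image_chart_ball[symmetric]
    by (rule emeasure_vol[OF c]) (use chart_ball_open[OF c] in \<open>auto simp: chart_ball_def\<close>)
  also have "\<dots> \<le> (\<integral>\<^sup>+z. ennreal M * indicator (ball x r) z \<partial>lborel)"
  proof (rule nn_integral_mono)
    fix z
    have "vol_density c z \<le> M" if "z \<in> chart_image c \<inter> ball x r"
    proof -
      have "z \<in> chart_image c \<inter> cball x r" using that ball_subset_cball[of x r] by blast
      then have "norm (vol_density c z) \<le> M" using M(2) by blast
      then show ?thesis by simp
    qed
    then show "ennreal (vol_density c z) * indicator (chart_image c \<inter> ball x r) z \<le> ennreal M * indicator (ball x r) z"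
      by (cases "z \<in> chart_image c \<inter> ball x r") (auto simp: ennreal_leI)
  qed
  also have "\<dots> = ennreal M * emeasure lborel (ball x r)"
    by (rule nn_integral_cmult_indicator) simp
  also have "\<dots> < \<infinity>" using emeasure_lborel_ball_finite[of x r] by (simp add: ennreal_mult_less_top)
  finally show ?thesis .
qed

lemma emeasure_compact_finite:
  assumes K: "compact K" shows "emeasure vol K < \<infinity>"
proof -
  have "\<exists>c r. p \<in> fst c \<and> admissible c (snd c p) r" for p
    using charts_cover[of p] admissible_exists by blast
  then obtain c r where cr: "\<And>p. p \<in> fst (c p)" "\<And>p. admissible (c p) (snd (c p) p) (r p)"
    by metis
  let ?U = "\<lambda>p. chart_ball (c p) (snd (c p) p) (r p)"
  have o: "open (?U p)" for p using chart_ball_open cr(2) by (simp add: admissible_def)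
  have "p \<in> ?U p" for p using cr[of p] by (simp add: chart_ball_def admissible_def)
  then have cover: "K \<subseteq> (\<Union>p\<in>K. ?U p)" by blast
  obtain P where P: "P \<subseteq> K" "finite P" "K \<subseteq> (\<Union>p\<in>P. ?U p)"
    by (rule compactE_image[OF K o cover])
  have "emeasure vol K \<le> emeasure vol (\<Union>p\<in>P. ?U p)"
    using P(3) open_UN[of P ?U] o by (intro emeasure_mono) simp_all
  also have "\<dots> \<le> (\<Sum>p\<in>P. emeasure vol (?U p))"
    using P o by (intro emeasure_subadditive_finite) auto
  also have "\<dots> < \<infinity>" 
    using emeasure_chart_ball_finite[OF cr(2)] ennreal_sum_less_top[OF P(2)] by simp
  finally show ?thesis .
qed

lemma set_integrable_interior:
  fixes F :: "'a \<Rightarrow> real"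
  assumes F: "continuous_on \<I> F" and K: "compact K" "K \<subseteq> \<I>" and F0: "\<And>p. p \<in> \<I> \<Longrightarrow> p \<notin> K \<Longrightarrow> F p = 0"
  shows "set_integrable vol \<I> F"
proof -
  have "compact (F ` K)" by (intro compact_continuous_image K continuous_on_subset[OF F])
  from compact_imp_bounded[OF this, unfolded bounded_pos]
  obtain M where M: "0 < M" "\<forall>z\<in>F ` K. norm z \<le> M"
    by (elim exE conjE)
  have Kb: "K \<in> sets borel" using K(1) by (simp add: borel_compact)
  have "integrable vol (\<lambda>p. indicator \<I> p *\<^sub>R F p)"
  proof (rule Bochner_Integration.integrable_bound[of _ "\<lambda>p. M * indicator K p"])
    show "integrable vol (\<lambda>p. M * indicator K p)"
      using emeasure_compact_finite[OF K(1)] Kb by (intro integrable_mult_right integrable_real_indicator) auto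
    show "(\<lambda>p. indicator \<I> p *\<^sub>R F p) \<in> borel_measurable vol"
      using borel_measurable_continuous_on_indicator[OF interior_borel F] by simp
    show "AE p in vol. norm (indicator \<I> p *\<^sub>R F p) \<le> norm (M * indicator K p)"
      using M F0 by (intro AE_I2) (auto simp: indicator_def)
  qed
  then show ?thesis by (simp add: set_integrable_def)
qed

section \<open>Cutoff functions transplanted to the manifold\<close>

definition bump :: "('a, 'n) chart \<Rightarrow> real ^ 'n \<Rightarrow> real \<Rightarrow> real \<Rightarrow> 'a \<Rightarrow> real" where
  "bump c x a b p = (if p \<in> fst c then cutoff x a b (snd c p) else 0)"

context
  fixes c x a b
  assumes adm: "admissible c x b" and ab: "0 < a" "a < b"
begin

lemma bump_bounds: "0 \<le> bump c x a b p" "bump c x a b p \<le> 1"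
  using cutoff_bounds[OF ab, of x] by (auto simp: bump_def)

lemma bump_eq_1: "p \<in> chart_cball c x a \<Longrightarrow> bump c x a b p = 1"
  using cutoff_eq_1[OF ab, of "snd c p" x] by (auto simp: bump_def chart_cball_def)

lemma bump_eq_0: "p \<notin> chart_ball c x b \<Longrightarrow> bump c x a b p = 0"
  using cutoff_eq_0[OF ab, of "snd c p" x] by (auto simp: bump_def chart_ball_def)

text \<open>Two open sets suffice: the domain of \<open>c\<close>, where the bump is a cutoff
  composed with a transition map, and the complement of \<open>chart_cball c x b\<close>, where it
  is 0. The latter set is open because compact sets are closed in a Hausdorff space. A boundary
  chart \<open>c\<close> causes no trouble, as the cutoff is C^1 on the whole coordinate
  space.\<close>

lemma bump_C1: "C1_fun (bump c x a b)"
  unfolding C1_fun_def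
proof (intro ballI Ck_on_1_locally)
  fix d z assume d: "d \<in> icharts" and z: "z \<in> chart_image d"
  have cA: "c \<in> \<A>" using adm by (simp add: admissible_def)
  note dA = icharts_D(1)[OF d]
  let ?q = "chart_inv d z" and ?K = "chart_cball c x b"
  have q: "?q \<in> fst d" "z = snd d ?q" using z dA by (simp_all add: chart_inv_in)
  show "\<exists>W h. open W \<and> z \<in> W \<and> Ck_on (Suc 0) W h \<and> (\<forall>y\<in>W. h y = (bump c x a b \<circ> chart_inv d) y)"
  proof (cases "?q \<in> fst c")
    case True
    let ?W = "snd d ` (fst d \<inter> fst c)"
    have "Ck_on (Suc 0) ?W (cutoff x a b \<circ> (snd c \<circ> chart_inv d))"
      by (rule Ck_on_1_compose[OF transition_C1[OF d cA] Ck_on_1_cutoff[OF ab] subset_UNIV])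
    moreover have "z \<in> ?W" using True q by blast
    moreover have "open ?W" by (rule overlap_open[OF d chart_open[OF cA]])
    moreover have "\<forall>y\<in>?W. (cutoff x a b \<circ> (snd c \<circ> chart_inv d)) y = (bump c x a b \<circ> chart_inv d) y"
      using dA by (auto simp: bump_def)
    ultimately show ?thesis by blast
  next
    case False
    let ?W = "snd d ` (fst d \<inter> - ?K)"
    have "closed ?K" using chart_cball_compact[OF adm] compact_imp_closed by blast
    then have "open ?W" by (intro overlap_open[OF d]) auto
    moreover have "z \<in> ?W" using False q by (auto simp: chart_cball_def)
    moreover have "\<forall>y\<in>?W. 0 = (bump c x a b \<circ> chart_inv d) y"
      using dA bump_eq_0 chart_ball_subset[of c x b] by (auto simp: subset_iff)
    ultimately show ?thesis using Ck_on_1_const[of ?W "0::real"] by blast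
  qed
qed

end

end

section \<open>The weak divergence theorem\<close>

context c0_manifold
begin

text \<open>The field as a vector density: the object that is C^1 for fields with a divergence, and
  to which the Euclidean divergence theorem applies.\<close>

definition field_density :: "('a, 'n) vector_field \<Rightarrow> ('a, 'n) chart \<Rightarrow> real ^ 'n \<Rightarrow> real ^ 'n" where
  "field_density X c x = vol_density c x *\<^sub>R X c (chart_inv c x)"

definition div_chart :: "('a, 'n) vector_field \<Rightarrow> ('a \<Rightarrow> real) \<Rightarrow> ('a, 'n) chart \<Rightarrow> bool" where
  "div_chart X f c \<longleftrightarrow> c \<in> icharts \<and> Ck_on (Suc 0) (chart_image c) (field_density X c) \<and>
    (\<forall>q\<in>fst c. f q = divergence (field_density X c) (snd c q) / vol_density c (snd c q))"

lemma has_divergence_iff: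
  "has_divergence \<A> g X f \<longleftrightarrow> (\<forall>p\<in>\<I>. \<exists>c. p \<in> fst c \<and> div_chart X f c)"
proof -
  have sq: "sqrt (det (g c q)) = vol_density c (snd c q)" if "c \<in> \<A>" "q \<in> fst c" for c q
    using that by (simp add: vol_density_def)
  have Y: "(\<lambda>x. sqrt (det (g c (chart_inv c x))) *\<^sub>R X c (chart_inv c x)) = field_density X c" for c
    by (simp add: field_density_def vol_density_def fun_eq_iff)
  have "(c \<in> \<A> \<and> p \<in> fst c \<and> open (chart_image c) \<and> Ck_on 1 (chart_image c) (field_density X c) \<and>
      (\<forall>q\<in>fst c. f q = divergence (field_density X c) (snd c q) / sqrt (det (g c q)))) \<longleftrightarrow>
    p \<in> fst c \<and> div_chart X f c" for c p
    unfolding div_chart_def icharts_def One_nat_def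
    by (cases "c \<in> \<A>") (auto simp: sq simp del: Ck_on.simps)
  then show ?thesis unfolding has_divergence_def Let_def Y divergence_def[symmetric] by (simp only: Bex_def)
qed

context
  fixes X f
  assumes test: "perimeter_test_field \<A> g X" and div: "has_divergence \<A> g X f"
begin

abbreviation (input) "supp \<equiv> vector_field_support \<A> X"

lemma field: "is_vector_field \<A> X" and supp_compact: "compact supp" and supp_interior: "supp \<subseteq> \<I>"
  using test by (auto simp: perimeter_test_field_def)

lemma supp_closed: "closed supp"
  using supp_compact compact_imp_closed by blast

lemma field_eq_0: "c \<in> \<A> \<Longrightarrow> p \<in> fst c \<Longrightarrow> p \<notin> supp \<Longrightarrow> X c p = 0"
  using subsetD[OF closure_subset, of p "{p. \<exists>c\<in>\<A>. p \<in> fst c \<and> X c p \<noteq> 0}"]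
  unfolding vector_field_support_def mem_Collect_eq by metis

lemma div_chart_exists: "p \<in> \<I> \<Longrightarrow> \<exists>c. p \<in> fst c \<and> div_chart X f c"
  using div unfolding has_divergence_iff by blast

lemma field_density_eq_0:
  assumes "c \<in> \<A>" "x \<in> chart_image c" "chart_inv c x \<notin> supp"
  shows "field_density X c x = 0"
  using field_eq_0[OF assms(1) chart_inv_in[OF assms(1,2)] assms(3)] by (simp add: field_density_def)

text \<open>\<open>f\<close> and \<open>X\<close> are quotients of continuous quantities by the
  positive volume density. That density is merely continuous, so nothing beyond continuity follows
  for \<open>X\<close>.\<close>

lemma div_chart_continuous:
  assumes "div_chart X f c"
  shows "continuous_on (fst c) f" "continuous_on (fst c) (X c)"
proof -
  have c: "c \<in> icharts" and Y: "Ck_on (Suc 0) (chart_image c) (field_density X c)"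
    and f: "\<And>q. q \<in> fst c \<Longrightarrow> f q = divergence (field_density X c) (snd c q) / vol_density c (snd c q)"
    using assms by (auto simp: div_chart_def)
  note cA = icharts_D(1)[OF c]
  have comp: "continuous_on (fst c) (\<lambda>p. h (snd c p))" if "continuous_on (chart_image c) h" for h :: "_ \<Rightarrow> 'z::topological_space"
    by (rule continuous_on_compose2[OF that chart_continuous[OF cA]]) simp
  have vd: "continuous_on (fst c) (\<lambda>p. vol_density c (snd c p))"
    by (rule comp[OF vol_density_continuous[OF cA]])
  have nz: "vol_density c (snd c p) \<noteq> 0" if "p \<in> fst c" for p
    using vol_density_pos[OF cA, of "snd c p"] that by simp
  have "continuous_on (chart_image c) (divergence (field_density X c))"
    unfolding divergence_def by (intro continuous_intros Ck_on_1_continuous_derivative[OF Y])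
  then have "continuous_on (fst c) (\<lambda>p. divergence (field_density X c) (snd c p) / vol_density c (snd c p))"
    using nz by (intro continuous_on_divide comp vd) auto
  then show "continuous_on (fst c) f"
    by (rule continuous_on_eq) (simp add: f)
  have "continuous_on (fst c) (\<lambda>p. (1 / vol_density c (snd c p)) *\<^sub>R field_density X c (snd c p))"
    using nz by (intro continuous_intros vd comp Ck_on_1_continuous_on[OF Y]) auto
  then show "continuous_on (fst c) (X c)"
    by (rule continuous_on_eq) (use nz cA in \<open>simp add: field_density_def\<close>)
qed

text \<open>The regularity of \<open>X\<close> and \<open>f\<close> is given only in the charts
  supplied by \<open>has_divergence\<close>, one around each interior point, so continuity is
  checked in those.\<close>

lemma continuous_on_interiorI:
  assumes "\<And>c. div_chart X f c \<Longrightarrow> continuous_on (fst c) h"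
  shows "continuous_on \<I> h"
proof (rule continuous_at_imp_continuous_on, rule ballI)
  fix p assume "p \<in> \<I>"
  then obtain c where c: "p \<in> fst c" "div_chart X f c" using div_chart_exists by blast
  then have "open (fst c)" using chart_open icharts_D(1) unfolding div_chart_def by blast
  then show "isCont h p" using assms[OF c(2)] c(1) continuous_on_eq_continuous_at by blast
qed

lemma divergence_continuous: "continuous_on \<I> f"
  by (rule continuous_on_interiorI) (rule div_chart_continuous(1))

lemma dir_deriv_continuous:
  assumes \<psi>: "C1_fun \<psi>" shows "continuous_on \<I> (dir_deriv \<psi> X)"
proof (rule continuous_on_interiorI)
  fix c assume dc: "div_chart X f c"
  then have c: "c \<in> icharts" by (simp add: div_chart_def)
  note cA = icharts_D(1)[OF c]
  let ?D = "\<lambda>p. frechet_derivative (\<psi> \<circ> chart_inv c) (at (snd c p))"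
  have "continuous_on (fst c) (\<lambda>p. \<Sum>b\<in>Basis. (X c p \<bullet> b) * ?D p b)"
    by (intro continuous_intros div_chart_continuous(2)[OF dc]
        continuous_on_compose2[OF Ck_on_1_continuous_derivative[OF C1_funD[OF \<psi> c]] chart_continuous[OF cA]]) simp
  then show "continuous_on (fst c) (dir_deriv \<psi> X)"
  proof (rule continuous_on_eq)
    fix p assume p: "p \<in> fst c"
    have "?D p (\<Sum>b\<in>Basis. (X c p \<bullet> b) *\<^sub>R b) = (\<Sum>b\<in>Basis. (X c p \<bullet> b) * ?D p b)"
      using has_derivative_linear[OF C1_fun_has_derivative[OF \<psi> c p]] by (simp add: linear_sum linear_cmul)
    then show "(\<Sum>b\<in>Basis. (X c p \<bullet> b) * ?D p b) = dir_deriv \<psi> X p"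
      unfolding dir_deriv_eq[OF \<psi> field c p] by (simp add: euclidean_representation)
  qed
qed

lemma divergence_eq_0:
  assumes p: "p \<in> \<I>" "p \<notin> supp" shows "f p = 0"
proof -
  obtain c where pc: "p \<in> fst c" and dc: "div_chart X f c" using div_chart_exists[OF p(1)] by blast
  then have c: "c \<in> icharts" by (simp add: div_chart_def)
  note cA = icharts_D(1)[OF c]
  have "open (- supp)" using supp_closed by auto
  have "(field_density X c has_derivative (\<lambda>_. 0)) (at (snd c p))"
  proof (rule has_derivative_transform_within_open[of "\<lambda>_. 0" _ _ _ "snd c ` (fst c \<inter> - supp)"])
    show "open (snd c ` (fst c \<inter> - supp))" by (rule overlap_open[OF c \<open>open (- supp)\<close>])
    show "snd c p \<in> snd c ` (fst c \<inter> - supp)" using p(2) pc by blast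
    show "0 = field_density X c x" if "x \<in> snd c ` (fst c \<inter> - supp)" for x
      using that cA by (auto simp: field_density_eq_0)
  qed simp
  from frechet_derivative_at[OF this, symmetric] have "divergence (field_density X c) (snd c p) = 0"
    by (simp add: divergence_def)
  then show ?thesis using dc pc by (simp add: div_chart_def)
qed

lemma dir_deriv_eq_0:
  assumes \<psi>: "C1_fun \<psi>" and p: "p \<in> \<I>" "p \<notin> supp" shows "dir_deriv \<psi> X p = 0"
proof -
  obtain c where c: "c \<in> icharts" "p \<in> fst c" using ichart_exists[OF p(1)] by blast
  show ?thesis
    unfolding dir_deriv_eq[OF \<psi> field c] field_eq_0[OF icharts_D(1)[OF c(1)] c(2) p(2)]
    by (rule linear_0[OF has_derivative_linear[OF C1_fun_has_derivative[OF \<psi> c]]])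
qed

text \<open>Formally the divergence of the product of \<psi> and \<open>X\<close>.\<close>

definition weak_div :: "('a \<Rightarrow> real) \<Rightarrow> 'a \<Rightarrow> real" where
  "weak_div \<psi> p = \<psi> p * f p + dir_deriv \<psi> X p"

lemma weak_div_continuous: "C1_fun \<psi> \<Longrightarrow> continuous_on \<I> (weak_div \<psi>)"
  unfolding weak_div_def[abs_def]
  by (intro continuous_intros C1_fun_continuous divergence_continuous dir_deriv_continuous)

lemma set_integrable_test:
  fixes F :: "'a \<Rightarrow> real"
  assumes "continuous_on \<I> F" "\<And>p. p \<in> \<I> \<Longrightarrow> p \<notin> supp \<Longrightarrow> F p = 0"
  shows "set_integrable vol \<I> F"
  using set_integrable_interior[OF assms(1) supp_compact supp_interior assms(2)] .

lemma weak_div_integrable: "C1_fun \<psi> \<Longrightarrow> set_integrable vol \<I> (weak_div \<psi>)"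
  by (rule set_integrable_test[OF weak_div_continuous])
    (auto simp: weak_div_def divergence_eq_0 dir_deriv_eq_0)

text \<open>In the coordinates of \<open>c\<close>, the volume density times the integrand is the
  Euclidean divergence of \<psi> times the field density. Because \<psi> vanishes off a compact
  subset of the chart, this product extends by zero to a C^1 field on the whole space, whose
  divergence integrates to 0.\<close>

lemma weak_div_chart_support:
  assumes dc: "div_chart X f c" and \<psi>: "C1_fun \<psi>" and S: "compact S" "S \<subseteq> fst c"
    and \<psi>0: "\<And>p. p \<notin> S \<Longrightarrow> \<psi> p = 0"
  shows "(LINT p:\<I>|vol. weak_div \<psi> p) = 0"
proof -
  have c: "c \<in> icharts" and Y: "Ck_on (Suc 0) (chart_image c) (field_density X c)"
    and f: "\<And>q. q \<in> fst c \<Longrightarrow> f q = divergence (field_density X c) (snd c q) / vol_density c (snd c q)"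
    using dc by (auto simp: div_chart_def)
  note cA = icharts_D(1)[OF c]
  have "open (- S)" using S(1) compact_imp_closed by blast
  let ?F = "\<lambda>p. indicator \<I> p *\<^sub>R weak_div \<psi> p"
  have F0: "weak_div \<psi> p = 0" if "p \<in> \<I>" "p \<notin> S" for p
    using that \<psi>0 dir_deriv_locally_const[OF \<psi> field that(1) \<open>open (- S)\<close>, of 0]
    by (simp add: weak_div_def)
  have F: "?F \<in> borel_measurable borel"
    by (rule borel_measurable_continuous_on_indicator[OF interior_borel weak_div_continuous[OF \<psi>]])
  let ?Z = "\<lambda>x. if x \<in> chart_image c then (\<psi> \<circ> chart_inv c) x *\<^sub>R field_density X c x else 0"
  let ?K = "snd c ` S"
  have K: "compact ?K" by (rule compact_continuous_image[OF continuous_on_subset[OF chart_continuous[OF cA] S(2)] S(1)])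
  have Z0: "?Z x = 0" if "x \<notin> ?K" for x
  proof (cases "x \<in> chart_image c")
    case True
    then have "x = snd c (chart_inv c x)" using cA by simp
    then have "chart_inv c x \<notin> S" using that by blast
    then show ?thesis using \<psi>0 by simp
  qed simp
  have Zin: "Ck_on (Suc 0) (chart_image c) (\<lambda>x. (\<psi> \<circ> chart_inv c) x *\<^sub>R field_density X c x)"
    by (rule Ck_on_1_scaleR[OF C1_funD[OF \<psi> c] Y])
  have Z: "Ck_on (Suc 0) UNIV ?Z"
  proof (rule Ck_on_1_locally)
    fix x
    show "\<exists>W h. open W \<and> x \<in> W \<and> Ck_on (Suc 0) W h \<and> (\<forall>y\<in>W. h y = ?Z y)"
    proof (cases "x \<in> chart_image c")
      case True
      then show ?thesis using Zin icharts_D(2)[OF c]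
        by (intro exI[of _ "chart_image c"] exI[of _ "\<lambda>x. (\<psi> \<circ> chart_inv c) x *\<^sub>R field_density X c x"])
          (simp del: Ck_on.simps)
    next
      case False
      then have "x \<notin> ?K" using S(2) by blast
      moreover have "open (- ?K)" using K compact_imp_closed by blast
      ultimately show ?thesis using Z0 Ck_on_1_const[of "- ?K" "0 :: real ^ 'n"]
        by (intro exI[of _ "- ?K"] exI[of _ "\<lambda>_. 0"]) (simp del: Ck_on.simps)
    qed
  qed
  from compact_imp_bounded[OF K, unfolded bounded_pos]
  obtain R where R: "0 < R" "\<forall>x\<in>?K. norm x \<le> R" by (elim exE conjE)
  have supp: "?Z x = 0" if "x \<notin> cball 0 R" for x
    using Z0[of x] R(2) that by (metis mem_cball_0)
  have point: "indicator (chart_image c) x *\<^sub>R (vol_density c x * ?F (chart_inv c x)) = divergence ?Z x" for x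
  proof (cases "x \<in> chart_image c")
    case False
    then have "x \<notin> ?K" using S(2) by blast
    then have "divergence ?Z x = 0"
      using frechet_derivative_eq_0_outside[OF compact_imp_closed[OF K] Z0] by (simp add: divergence_def)
    then show ?thesis using False by simp
  next
    case True
    let ?p = "chart_inv c x"
    have p: "?p \<in> fst c" "snd c ?p = x" using True cA by (simp_all add: chart_inv_in)
    have pI: "?p \<in> \<I>" using p icharts_subset_interior[OF c] by blast
    have "frechet_derivative ?Z (at x) =
      frechet_derivative (\<lambda>x. (\<psi> \<circ> chart_inv c) x *\<^sub>R field_density X c x) (at x)"
      by (rule frechet_derivative_at[symmetric],
          rule has_derivative_transform_within_open[OF Ck_on_1_has_derivative[OF Zin True] icharts_D(2)[OF c] True])
        simp
    then have "divergence ?Z x = divergence (\<lambda>x. (\<psi> \<circ> chart_inv c) x *\<^sub>R field_density X c x) x"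
      by (simp add: divergence_def)
    also have "\<dots> = frechet_derivative (\<psi> \<circ> chart_inv c) (at x) (field_density X c x) + \<psi> ?p * divergence (field_density X c) x"
      using divergence_scaleR[OF Ck_on_1_has_derivative[OF C1_funD[OF \<psi> c] True] Ck_on_1_has_derivative[OF Y True]]
      by simp
    also have "frechet_derivative (\<psi> \<circ> chart_inv c) (at x) (field_density X c x) = vol_density c x * dir_deriv \<psi> X ?p"
      unfolding dir_deriv_eq[OF \<psi> field c p(1)] p(2) field_density_def
      using linear_cmul[OF has_derivative_linear[OF Ck_on_1_has_derivative[OF C1_funD[OF \<psi> c] True]]] by simp
    also have "divergence (field_density X c) x = vol_density c x * f ?p"
      using f[OF p(1)] vol_density_pos[OF cA True] p(2) by simp
    finally show ?thesis using True pI by (simp add: weak_div_def algebra_simps)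
  qed
  have "(LINT p:\<I>|vol. weak_div \<psi> p) = (LINT p:fst c|vol. ?F p)"
    unfolding set_lebesgue_integral_def
    using F0 S(2) icharts_subset_interior[OF c] by (intro Bochner_Integration.integral_cong) (auto simp: indicator_def)
  also have "\<dots> = integral\<^sup>L lborel (divergence ?Z)"
    using integral_chart[OF cA F] by (simp only: set_lebesgue_integral_def point)
  also have "\<dots> = 0" by (rule integral_divergence_eq_0(2)[OF Z supp])
  finally show ?thesis .
qed

text \<open>Localisation: after multiplication by a bump supported in a chart where the field
  density is C^1, the theorem holds for every \<psi>.\<close>

lemma weak_div_bump:
  assumes p: "p \<in> supp"
  shows "\<exists>U \<eta>. open U \<and> p \<in> U \<and> C1_fun \<eta> \<and> (\<forall>q\<in>U. \<eta> q = 1) \<and>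
    (\<forall>\<psi>. C1_fun \<psi> \<longrightarrow> (LINT q:\<I>|vol. weak_div (\<lambda>q. \<psi> q * \<eta> q) q) = 0)"
proof -
  obtain c where pc: "p \<in> fst c" and dc: "div_chart X f c"
    using div_chart_exists p supp_interior by blast
  then have cA: "c \<in> \<A>" using icharts_D(1) by (simp add: div_chart_def)
  obtain r where adm: "admissible c (snd c p) r" using admissible_exists[OF cA pc] by blast
  then have r: "0 < r / 2" "r / 2 < r" by (auto simp: admissible_def)
  let ?\<eta> = "bump c (snd c p) (r / 2) r"
  have "(LINT q:\<I>|vol. weak_div (\<lambda>q. \<psi> q * ?\<eta> q) q) = 0" if "C1_fun \<psi>" for \<psi>
  proof (rule weak_div_chart_support[OF dc C1_fun_mult[OF that bump_C1[OF adm r]] chart_cball_compact[OF adm]])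
    show "chart_cball c (snd c p) r \<subseteq> fst c" by (auto simp: chart_cball_def)
    show "\<psi> q * ?\<eta> q = 0" if "q \<notin> chart_cball c (snd c p) r" for q
      using bump_eq_0[OF adm r] that chart_ball_subset by (metis mult_zero_right subsetD)
  qed
  moreover have "p \<in> chart_ball c (snd c p) (r / 2)" using r pc by (simp add: chart_ball_def)
  moreover have "\<forall>q\<in>chart_ball c (snd c p) (r / 2). ?\<eta> q = 1"
    using bump_eq_1[OF adm r] chart_ball_subset by blast
  ultimately show ?thesis
    using chart_ball_open[OF cA, of "snd c p" "r / 2"] bump_C1[OF adm r]
    by (intro exI[of _ "chart_ball c (snd c p) (r / 2)"] exI[of _ ?\<eta>] conjI allI impI)
qed

text \<open>No partition of unity is formed. Passing from a function \<phi> to \<phi> (1 - \<eta>)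
  subtracts \<phi> \<eta>, whose integral is 0 by localisation, so the integral never changes. Once
  all finitely many bumps have been used, the product vanishes near the support of the field, and
  the integrand is zero everywhere.\<close>

theorem weak_divergence_theorem:
  assumes \<psi>: "C1_fun \<psi>"
  shows "(LINT p:\<I>|vol. weak_div \<psi> p) = 0"
proof -
  let ?L = "\<lambda>\<psi>. LINT p:\<I>|vol. weak_div \<psi> p"
  have "\<forall>p\<in>supp. \<exists>U \<eta>. open U \<and> p \<in> U \<and> C1_fun \<eta> \<and> (\<forall>q\<in>U. \<eta> q = 1) \<and>
    (\<forall>\<psi>. C1_fun \<psi> \<longrightarrow> ?L (\<lambda>q. \<psi> q * \<eta> q) = 0)"
    by (intro ballI weak_div_bump)
  from bchoice[OF this]
  obtain U where "\<forall>p\<in>supp. \<exists>\<eta>. open (U p) \<and> p \<in> U p \<and> C1_fun \<eta> \<and> (\<forall>q\<in>U p. \<eta> q = 1) \<and>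
    (\<forall>\<psi>. C1_fun \<psi> \<longrightarrow> ?L (\<lambda>q. \<psi> q * \<eta> q) = 0)"
    by (elim exE)
  from bchoice[OF this]
  obtain \<eta> where U\<eta>: "\<forall>p\<in>supp. open (U p) \<and> p \<in> U p \<and> C1_fun (\<eta> p) \<and> (\<forall>q\<in>U p. \<eta> p q = 1) \<and>
    (\<forall>\<psi>. C1_fun \<psi> \<longrightarrow> ?L (\<lambda>q. \<psi> q * \<eta> p q) = 0)"
    by (elim exE)
  have U: "\<And>p. p \<in> supp \<Longrightarrow> open (U p)" "\<And>p. p \<in> supp \<Longrightarrow> p \<in> U p"
    and \<eta>: "\<And>p. p \<in> supp \<Longrightarrow> C1_fun (\<eta> p)" "\<And>p q. p \<in> supp \<Longrightarrow> q \<in> U p \<Longrightarrow> \<eta> p q = 1"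
    and L0: "\<And>p \<psi>. p \<in> supp \<Longrightarrow> C1_fun \<psi> \<Longrightarrow> ?L (\<lambda>q. \<psi> q * \<eta> p q) = 0"
    using U\<eta> by simp_all
  have "supp \<subseteq> (\<Union>p\<in>supp. U p)" using U(2) by blast
  note cover = this
  obtain P where P: "P \<subseteq> supp" "finite P" and cover: "supp \<subseteq> (\<Union>p\<in>P. U p)"
    by (rule compactE_image[OF supp_compact U(1) cover])
  let ?\<phi> = "\<lambda>P q. \<psi> q * (\<Prod>p\<in>P. 1 - \<eta> p q)"
  have \<phi>: "C1_fun (?\<phi> P)" if "finite P" "P \<subseteq> supp" for P
    using that \<eta>(1) by (intro C1_fun_mult \<psi> C1_fun_prod C1_fun_diff C1_fun_const) auto
  have "?L \<psi> = ?L (?\<phi> P)"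
    using P(2,1)
  proof (induction P rule: finite_induct)
    case (insert p P)
    then have p: "p \<in> supp" and P: "P \<subseteq> supp" by auto
    note C = \<phi>[OF insert.hyps(1) P]
    have C': "C1_fun (\<lambda>q. ?\<phi> P q * \<eta> p q)" by (rule C1_fun_mult[OF C \<eta>(1)[OF p]])
    have eq: "?\<phi> (insert p P) = (\<lambda>q. ?\<phi> P q - ?\<phi> P q * \<eta> p q)"
      using insert.hyps by (auto simp: algebra_simps)
    have "?L (?\<phi> (insert p P)) = (LINT q:\<I>|vol. weak_div (?\<phi> P) q - weak_div (\<lambda>q. ?\<phi> P q * \<eta> p q) q)"
      unfolding eq
    proof (rule set_lebesgue_integral_cong)
      show "\<forall>q. q \<in> \<I> \<longrightarrow> weak_div (\<lambda>q. ?\<phi> P q - ?\<phi> P q * \<eta> p q) q =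
          weak_div (?\<phi> P) q - weak_div (\<lambda>q. ?\<phi> P q * \<eta> p q) q"
      proof (intro allI impI)
        fix q assume "q \<in> \<I>"
        from dir_deriv_diff[OF C C' field this] show "weak_div (\<lambda>q. ?\<phi> P q - ?\<phi> P q * \<eta> p q) q =
          weak_div (?\<phi> P) q - weak_div (\<lambda>q. ?\<phi> P q * \<eta> p q) q"
          unfolding weak_div_def left_diff_distrib by linarith
      qed
    qed simp
    also have "\<dots> = ?L (?\<phi> P) - ?L (\<lambda>q. ?\<phi> P q * \<eta> p q)"
      by (rule set_integral_diff(2)[OF weak_div_integrable[OF C] weak_div_integrable[OF C']])
    finally show ?case using L0[OF p C] insert.IH[OF P] by simp
  qed simp
  also have "\<dots> = (LINT p:\<I>|vol. 0)"
  proof (rule set_lebesgue_integral_cong)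
    show "\<forall>q. q \<in> \<I> \<longrightarrow> weak_div (?\<phi> P) q = 0"
    proof (intro allI impI)
      fix q assume q: "q \<in> \<I>"
      show "weak_div (?\<phi> P) q = 0"
      proof (cases "q \<in> supp")
        case True
        then obtain p where p: "p \<in> P" "q \<in> U p" using cover by blast
        have z: "?\<phi> P y = 0" if "y \<in> U p" for y
        proof -
          have "\<eta> p y = 1" using \<eta>(2)[of p y] p P that by blast
          then have "(\<Prod>p\<in>P. 1 - \<eta> p y) = 0" using p(1) P(2) by (intro prod_zero) auto
          then show ?thesis by simp
        qed
        have "dir_deriv (?\<phi> P) X q = 0"
          using dir_deriv_locally_const[OF \<phi>[OF P(2,1)] field q U(1) p(2), of 0] z p P by blast
        then show ?thesis using z[OF p(2)] by (simp add: weak_div_def)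
      next
        case False
        then show ?thesis using q
          by (simp add: weak_div_def divergence_eq_0 dir_deriv_eq_0[OF \<phi>[OF P(2,1)]])
      qed
    qed
  qed simp
  finally show ?thesis by simp
qed

text \<open>Integration by parts. With \<psi> close to the indicator of \<Omega>, the left side
  approaches the quantity whose supremum is the perimeter.\<close>

lemma integral_divergence_approx:
  assumes \<psi>: "C1_fun \<psi>" "\<And>p. \<bar>\<psi> p\<bar> \<le> 1"
  shows "ennreal (LINT p:\<I>|vol. \<psi> p * f p) \<le> (\<integral>\<^sup>+p\<in>\<I>. ennreal \<bar>dir_deriv \<psi> X p\<bar> \<partial>vol)"
proof -
  have i1: "set_integrable vol \<I> (\<lambda>p. \<psi> p * f p)"
    by (rule set_integrable_test[OF continuous_on_mult[OF C1_fun_continuous[OF \<psi>(1)] divergence_continuous]])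
      (simp add: divergence_eq_0)
  have i2: "set_integrable vol \<I> (dir_deriv \<psi> X)"
    by (rule set_integrable_test) (auto intro!: dir_deriv_continuous \<psi> simp: dir_deriv_eq_0 \<psi>)
  have "0 = (LINT p:\<I>|vol. \<psi> p * f p) + (LINT p:\<I>|vol. dir_deriv \<psi> X p)"
    using weak_divergence_theorem[OF \<psi>(1)] set_integral_add(2)[OF i1 i2] by (simp add: weak_div_def)
  then have "(LINT p:\<I>|vol. \<psi> p * f p) \<le> \<bar>LINT p:\<I>|vol. dir_deriv \<psi> X p\<bar>" by linarith
  also have "\<dots> = norm (integral\<^sup>L vol (\<lambda>p. indicator \<I> p *\<^sub>R dir_deriv \<psi> X p))"
    by (simp add: set_lebesgue_integral_def)
  finally have "ennreal (LINT p:\<I>|vol. \<psi> p * f p) \<le> ennreal (norm (integral\<^sup>L vol (\<lambda>p. indicator \<I> p *\<^sub>R dir_deriv \<psi> X p)))"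
    by (rule ennreal_leI)
  also have "\<dots> \<le> (\<integral>\<^sup>+p. norm (indicator \<I> p *\<^sub>R dir_deriv \<psi> X p) \<partial>vol)"
    using i2 by (intro integral_norm_bound_ennreal) (simp add: set_integrable_def)
  also have "\<dots> = (\<integral>\<^sup>+p\<in>\<I>. ennreal \<bar>dir_deriv \<psi> X p\<bar> \<partial>vol)"
    by (intro nn_integral_cong) (simp add: indicator_def)
  finally show ?thesis .
qed

end

section \<open>Upper bounds for the perimeter\<close>

text \<open>A sufficient condition for the perimeter to be at most \<open>b\<close> that is easily seen to be
  subadditive under unions.\<close>

definition perimeter_approx :: "'a set \<Rightarrow> real \<Rightarrow> bool" where
  "perimeter_approx \<Omega> b \<longleftrightarrow> (\<exists>\<psi> e. (\<forall>k::nat. C1_fun (\<psi> k) \<and> (\<forall>p. 0 \<le> \<psi> k p \<and> \<psi> k p \<le> 1) \<and> 0 \<le> e k) \<and>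
    (\<forall>p. (\<lambda>k. \<psi> k p) \<longlonglongrightarrow> indicator \<Omega> p) \<and> e \<longlonglongrightarrow> b \<and>
    (\<forall>k X f. perimeter_test_field \<A> g X \<longrightarrow> has_divergence \<A> g X f \<longrightarrow>
      (\<integral>\<^sup>+p\<in>\<I>. ennreal \<bar>dir_deriv (\<psi> k) X p\<bar> \<partial>vol) \<le> ennreal (e k)))"

text \<open>The integral of \<open>f\<close> over \<Omega> is the limit of the integrals weighted by
  \<psi>, with the absolute value of \<open>f\<close> as majorant, and each weighted integral is at
  most \<open>e k\<close>.\<close>

lemma perimeter_approx_bound:
  assumes "perimeter_approx \<Omega> b" and \<Omega>: "\<Omega> \<in> sets borel"
  shows "perimeter \<A> g \<Omega> \<le> ereal b"
  unfolding perimeter_def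
proof (rule Sup_least, safe)
  fix X f assume X: "perimeter_test_field \<A> g X" and f: "has_divergence \<A> g X f"
  obtain \<psi> e where \<psi>: "\<And>k::nat. C1_fun (\<psi> k)" "\<And>k p. 0 \<le> \<psi> k p \<and> \<psi> k p \<le> 1" "\<And>k. 0 \<le> e k"
    and lim: "\<And>p. (\<lambda>k. \<psi> k p) \<longlonglongrightarrow> indicator \<Omega> p" "e \<longlonglongrightarrow> b"
    and bound: "\<And>k. (\<integral>\<^sup>+p\<in>\<I>. ennreal \<bar>dir_deriv (\<psi> k) X p\<bar> \<partial>vol) \<le> ennreal (e k)"
    using assms(1) X f unfolding perimeter_approx_def by blast
  have fi: "set_integrable vol \<I> f"
    by (rule set_integrable_test[OF X f divergence_continuous[OF X f] divergence_eq_0[OF X f]])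
  have \<psi>f: "(\<lambda>p. indicator \<I> p *\<^sub>R (\<psi> k p * f p)) \<in> borel_measurable borel" for k
    by (intro borel_measurable_continuous_on_indicator interior_borel continuous_intros
        C1_fun_continuous \<psi> divergence_continuous[OF X f])
  have fm: "(\<lambda>p. indicator \<I> p *\<^sub>R f p) \<in> borel_measurable borel"
    by (intro borel_measurable_continuous_on_indicator interior_borel divergence_continuous[OF X f])
  have "(\<lambda>k. LINT p:\<I>|vol. \<psi> k p * f p) \<longlonglongrightarrow> (LINT p:\<Omega> \<inter> \<I>|vol. f p)"
    unfolding set_lebesgue_integral_def
  proof (rule integral_dominated_convergence[where w="\<lambda>p. \<bar>indicator \<I> p *\<^sub>R f p\<bar>"])
    have "(\<lambda>p. indicator \<Omega> p * (indicator \<I> p *\<^sub>R f p)) \<in> borel_measurable borel"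
      using fm \<Omega> by measurable
    then show "(\<lambda>p. indicator (\<Omega> \<inter> \<I>) p *\<^sub>R f p) \<in> borel_measurable vol"
      by (simp add: indicator_inter_arith mult_ac)
    show "(\<lambda>p. indicator \<I> p *\<^sub>R (\<psi> k p * f p)) \<in> borel_measurable vol" for k
      using \<psi>f by simp
    show "integrable vol (\<lambda>p. \<bar>indicator \<I> p *\<^sub>R f p\<bar>)"
      using fi by (intro integrable_abs) (simp add: set_integrable_def)
    show "AE p in vol. (\<lambda>k. indicator \<I> p *\<^sub>R (\<psi> k p * f p)) \<longlonglongrightarrow> indicator (\<Omega> \<inter> \<I>) p *\<^sub>R f p"
    proof (rule AE_I2)
      fix p
      have "(\<lambda>k. indicator \<I> p *\<^sub>R (\<psi> k p * f p)) \<longlonglongrightarrow> indicator \<I> p *\<^sub>R (indicator \<Omega> p * f p)"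
        by (intro tendsto_intros lim)
      then show "(\<lambda>k. indicator \<I> p *\<^sub>R (\<psi> k p * f p)) \<longlonglongrightarrow> indicator (\<Omega> \<inter> \<I>) p *\<^sub>R f p"
        by (simp add: indicator_inter_arith mult_ac)
    qed
    show "AE p in vol. norm (indicator \<I> p *\<^sub>R (\<psi> k p * f p)) \<le> \<bar>indicator \<I> p *\<^sub>R f p\<bar>" for k
    proof (rule AE_I2)
      fix p
      have "\<bar>\<psi> k p\<bar> * \<bar>f p\<bar> \<le> 1 * \<bar>f p\<bar>" using \<psi>(2)[of k p] by (intro mult_right_mono) auto
      then show "norm (indicator \<I> p *\<^sub>R (\<psi> k p * f p)) \<le> \<bar>indicator \<I> p *\<^sub>R f p\<bar>"
        by (simp add: indicator_def abs_mult)
    qed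
  qed
  moreover have "(LINT p:\<I>|vol. \<psi> k p * f p) \<le> e k" for k
  proof -
    have "ennreal (LINT p:\<I>|vol. \<psi> k p * f p) \<le> ennreal (e k)"
      using integral_divergence_approx[OF X f \<psi>(1)[of k]] \<psi>(2) bound[of k] by (force intro: order_trans)
    \<comment> \<open>\<open>ennreal\<close> sends negative numbers to 0, so
      \<open>0 \<le> e k\<close> is what settles the case of a negative integral.\<close>
    then show ?thesis using \<psi>(3)[of k] by (simp add: ennreal_le_iff2) (metis le_cases order_trans)
  qed
  ultimately have "(LINT p:\<Omega> \<inter> \<I>|vol. f p) \<le> b"
    using lim(2) by (meson LIMSEQ_le)
  then show "ereal (LINT p:\<Omega> \<inter> \<I>|vol. f p) \<le> ereal b" by simp
qed

lemma perimeter_approx_empty: "perimeter_approx {} 0"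
proof -
  have "(\<integral>\<^sup>+p\<in>\<I>. ennreal \<bar>dir_deriv (\<lambda>_. 0) X p\<bar> \<partial>vol) \<le> ennreal 0"
    if "perimeter_test_field \<A> g X" for X
  proof -
    have "dir_deriv (\<lambda>_. 0) X p = 0" if "p \<in> \<I>" for p
      using dir_deriv_locally_const[OF C1_fun_const _ that open_UNIV UNIV_I refl]
        \<open>perimeter_test_field \<A> g X\<close> by (simp add: perimeter_test_field_def)
    then have "(\<integral>\<^sup>+p\<in>\<I>. ennreal \<bar>dir_deriv (\<lambda>_. 0) X p\<bar> \<partial>vol) = (\<integral>\<^sup>+p. 0 \<partial>vol)"
      by (intro nn_integral_cong) (auto simp: indicator_def)
    then show ?thesis by simp
  qed
  then show ?thesis
    unfolding perimeter_approx_def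
    by (intro exI[of _ "\<lambda>_ _. 0"] exI[of _ "\<lambda>_. 0"]) (simp add: C1_fun_const)
qed

text \<open>The function 1 - (1 - \<psi>) (1 - \<psi>') approximates the indicator of the union, and
  its derivative is the sum of the two derivatives weighted by factors in [0, 1].\<close>

lemma perimeter_approx_union:
  assumes "perimeter_approx \<Omega>\<^sub>1 b\<^sub>1" "perimeter_approx \<Omega>\<^sub>2 b\<^sub>2"
  shows "perimeter_approx (\<Omega>\<^sub>1 \<union> \<Omega>\<^sub>2) (b\<^sub>1 + b\<^sub>2)"
proof -
  obtain \<psi> e where \<psi>: "\<And>k::nat. C1_fun (\<psi> k)" "\<And>k p. 0 \<le> \<psi> k p \<and> \<psi> k p \<le> 1" "\<And>k. 0 \<le> e k"
    and lim: "\<And>p. (\<lambda>k. \<psi> k p) \<longlonglongrightarrow> indicator \<Omega>\<^sub>1 p" "e \<longlonglongrightarrow> b\<^sub>1"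
    and bound: "\<And>k X f. perimeter_test_field \<A> g X \<Longrightarrow> has_divergence \<A> g X f \<Longrightarrow>
      (\<integral>\<^sup>+p\<in>\<I>. ennreal \<bar>dir_deriv (\<psi> k) X p\<bar> \<partial>vol) \<le> ennreal (e k)"
    using assms(1) unfolding perimeter_approx_def by blast
  obtain \<psi>' e' where \<psi>': "\<And>k::nat. C1_fun (\<psi>' k)" "\<And>k p. 0 \<le> \<psi>' k p \<and> \<psi>' k p \<le> 1" "\<And>k. 0 \<le> e' k"
    and lim': "\<And>p. (\<lambda>k. \<psi>' k p) \<longlonglongrightarrow> indicator \<Omega>\<^sub>2 p" "e' \<longlonglongrightarrow> b\<^sub>2"
    and bound': "\<And>k X f. perimeter_test_field \<A> g X \<Longrightarrow> has_divergence \<A> g X f \<Longrightarrow>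
      (\<integral>\<^sup>+p\<in>\<I>. ennreal \<bar>dir_deriv (\<psi>' k) X p\<bar> \<partial>vol) \<le> ennreal (e' k)"
    using assms(2) unfolding perimeter_approx_def by blast
  let ?\<phi> = "\<lambda>k p. 1 - (1 - \<psi> k p) * (1 - \<psi>' k p)"
  have C1: "C1_fun (\<lambda>p. 1 - \<psi> k p)" "C1_fun (\<lambda>p. 1 - \<psi>' k p)" for k
    by (intro C1_fun_diff C1_fun_const \<psi> \<psi>')+
  have C2: "C1_fun (\<lambda>p. (1 - \<psi> k p) * (1 - \<psi>' k p))" for k by (rule C1_fun_mult[OF C1])
  have "(\<integral>\<^sup>+p\<in>\<I>. ennreal \<bar>dir_deriv (?\<phi> k) X p\<bar> \<partial>vol) \<le> ennreal (e k + e' k)"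
    if X: "perimeter_test_field \<A> g X" and f: "has_divergence \<A> g X f" for k X f
  proof -
    note field = field[OF X f]
    have const: "dir_deriv (\<lambda>_. 1) X p = 0" if "p \<in> \<I>" for p
      using dir_deriv_locally_const[OF C1_fun_const field that open_UNIV UNIV_I refl] .
    have le: "\<bar>dir_deriv (?\<phi> k) X p\<bar> \<le> \<bar>dir_deriv (\<psi> k) X p\<bar> + \<bar>dir_deriv (\<psi>' k) X p\<bar>" if p: "p \<in> \<I>" for p
    proof -
      have "dir_deriv (?\<phi> k) X p = (1 - \<psi> k p) * dir_deriv (\<psi>' k) X p + dir_deriv (\<psi> k) X p * (1 - \<psi>' k p)"
        by (simp add: dir_deriv_diff[OF C1_fun_const C2 field p] dir_deriv_mult[OF C1 field p]
            dir_deriv_diff[OF C1_fun_const \<psi>(1) field p] dir_deriv_diff[OF C1_fun_const \<psi>'(1) field p] const[OF p])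
      also have "\<bar>\<dots>\<bar> \<le> \<bar>(1 - \<psi> k p) * dir_deriv (\<psi>' k) X p\<bar> + \<bar>dir_deriv (\<psi> k) X p * (1 - \<psi>' k p)\<bar>"
        by (rule abs_triangle_ineq)
      also have "\<dots> \<le> 1 * \<bar>dir_deriv (\<psi>' k) X p\<bar> + \<bar>dir_deriv (\<psi> k) X p\<bar> * 1"
        unfolding abs_mult using \<psi>(2)[of k p] \<psi>'(2)[of k p] by (intro add_mono mult_mono) auto
      finally show ?thesis by simp
    qed
    have m: "(\<lambda>p. ennreal \<bar>dir_deriv \<psi> X p\<bar> * indicator \<I> p) \<in> borel_measurable vol" if "C1_fun \<psi>" for \<psi>
    proof -
      have "(\<lambda>p. ennreal (norm (indicator \<I> p *\<^sub>R dir_deriv \<psi> X p))) \<in> borel_measurable borel"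
        using borel_measurable_continuous_on_indicator[OF interior_borel dir_deriv_continuous[OF X f that]] by measurable
      moreover have "ennreal (norm (indicator \<I> p *\<^sub>R dir_deriv \<psi> X p)) = ennreal \<bar>dir_deriv \<psi> X p\<bar> * indicator \<I> p" for p
        by (simp add: indicator_def)
      ultimately show ?thesis by (simp only: measurable_cong_sets[OF sets_vol refl])
    qed
    have "(\<integral>\<^sup>+p\<in>\<I>. ennreal \<bar>dir_deriv (?\<phi> k) X p\<bar> \<partial>vol) \<le>
      (\<integral>\<^sup>+p. ennreal \<bar>dir_deriv (\<psi> k) X p\<bar> * indicator \<I> p + ennreal \<bar>dir_deriv (\<psi>' k) X p\<bar> * indicator \<I> p \<partial>vol)"
      using le by (intro nn_integral_mono) (auto simp: indicator_def ennreal_plus[symmetric] intro!: ennreal_leI simp del: ennreal_plus)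
    also have "\<dots> = (\<integral>\<^sup>+p\<in>\<I>. ennreal \<bar>dir_deriv (\<psi> k) X p\<bar> \<partial>vol) + (\<integral>\<^sup>+p\<in>\<I>. ennreal \<bar>dir_deriv (\<psi>' k) X p\<bar> \<partial>vol)"
      by (rule nn_integral_add[OF m[OF \<psi>(1)] m[OF \<psi>'(1)]])
    also have "\<dots> \<le> ennreal (e k) + ennreal (e' k)"
      by (intro add_mono bound[OF X f] bound'[OF X f])
    finally show ?thesis using \<psi>(3)[of k] \<psi>'(3)[of k] by simp
  qed
  moreover have "C1_fun (?\<phi> k)" for k by (intro C1_fun_diff C1_fun_const C2)
  moreover have "0 \<le> ?\<phi> k p \<and> ?\<phi> k p \<le> 1" for k p
  proof -
    have "0 \<le> (1 - \<psi> k p) * (1 - \<psi>' k p)" "(1 - \<psi> k p) * (1 - \<psi>' k p) \<le> 1 * 1"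
      using \<psi>(2)[of k p] \<psi>'(2)[of k p] by (intro mult_nonneg_nonneg mult_mono; simp)+
    then show ?thesis by simp
  qed
  moreover have "(\<lambda>k. ?\<phi> k p) \<longlonglongrightarrow> indicator (\<Omega>\<^sub>1 \<union> \<Omega>\<^sub>2) p" for p
  proof -
    have "(\<lambda>k. ?\<phi> k p) \<longlonglongrightarrow> 1 - (1 - indicator \<Omega>\<^sub>1 p) * (1 - indicator \<Omega>\<^sub>2 p)"
      by (intro tendsto_intros lim lim')
    moreover have "1 - (1 - indicator \<Omega>\<^sub>1 p) * (1 - indicator \<Omega>\<^sub>2 p) = (indicator (\<Omega>\<^sub>1 \<union> \<Omega>\<^sub>2) p :: real)"
      by (auto simp: indicator_def)
    ultimately show ?thesis by simp
  qed
  moreover have "(\<lambda>k. e k + e' k) \<longlonglongrightarrow> b\<^sub>1 + b\<^sub>2" by (intro tendsto_intros lim lim')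
  moreover have "0 \<le> e k + e' k" for k using \<psi>(3)[of k] \<psi>'(3)[of k] by simp
  ultimately show ?thesis
    unfolding perimeter_approx_def
    by (intro exI[of _ ?\<phi>] exI[of _ "\<lambda>k. e k + e' k"] conjI allI impI) auto
qed

text \<open>The constants \<open>\<Lambda>\<close> and \<open>m\<close> compare the metric with the Euclidean one on the coordinate ball.\<close>

lemma perimeter_approx_chart_ball:
  assumes adm: "admissible c x r" and L: "0 \<le> \<Lambda>" "0 \<le> m"
    and vec: "\<And>p v. p \<in> chart_ball c x r \<Longrightarrow> v \<bullet> (g c p *v v) \<le> 1 \<Longrightarrow> norm v \<le> \<Lambda>"
    and dens: "\<And>z. z \<in> chart_image c \<inter> ball x r \<Longrightarrow> vol_density c z \<le> m"
  shows "perimeter_approx (chart_ball c x r) (\<Lambda> * m * (real CARD('n) * measure lborel (ball x r)) / r)"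
proof -
  \<comment> \<open>Inner radii of the cutoffs, increasing to r. With \<open>Suc k\<close> in place
    of \<open>Suc (Suc k)\<close> the first radius would be 0.\<close>
  define s where "s k = r * (1 - 1 / real (Suc (Suc k)))" for k
  have r: "0 < r" and cA: "c \<in> \<A>" using adm by (auto simp: admissible_def)
  have s: "0 < s k" "s k < r" for k
    using r by (auto simp: s_def zero_less_mult_iff divide_less_eq)
  have "(\<lambda>k. 1 / real (Suc (Suc k))) \<longlonglongrightarrow> 0"
    using LIMSEQ_Suc[OF LIMSEQ_Suc[OF lim_1_over_n]] .
  then have "(\<lambda>k. r * (1 - 1 / real (Suc (Suc k)))) \<longlonglongrightarrow> r * (1 - 0)" by (intro tendsto_intros)
  then have slim: "s \<longlonglongrightarrow> r" by (simp add: s_def[abs_def])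
  let ?\<psi> = "\<lambda>k. bump c x (s k) r"
  let ?e = "\<lambda>k. \<Lambda> * m * (real CARD('n) * measure lborel (ball x r)) / s k"
  have "(\<integral>\<^sup>+p\<in>\<I>. ennreal \<bar>dir_deriv (?\<psi> k) X p\<bar> \<partial>vol) \<le> ennreal (?e k)"
    if X: "perimeter_test_field \<A> g X" and f: "has_divergence \<A> g X f" for k X f
  proof -
    note field = field[OF X f] and C = bump_C1[OF adm s(1)[of k] s(2)[of k]]
    let ?w = "\<lambda>z. cutoff_weight x (s k) r z * ((z - x) \<bullet> (z - x))"
    have wn: "0 \<le> ?w z" for z
      using cutoff_weight_nonneg[OF s(1)[of k] s(2)[of k]] by (intro mult_nonneg_nonneg) auto
    \<comment> \<open>A majorant that does not depend on the test field. The indicator confines it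
      to the ball, where \<Lambda> bounds the coordinate length of the field.\<close>
    define G where "G p = indicator (chart_ball c x r \<inter> \<I>) p * (\<Lambda> / s k * ?w (snd c p))" for p
    have le: "\<bar>dir_deriv (?\<psi> k) X p\<bar> \<le> G p" if p: "p \<in> \<I>" for p
    proof (cases "p \<in> fst c")
      case False
      then have "p \<in> - chart_cball c x r" by (simp add: chart_cball_def)
      moreover have "open (- chart_cball c x r)"
        using chart_cball_compact[OF adm] compact_imp_closed by blast
      moreover have "?\<psi> k q = 0" if "q \<in> - chart_cball c x r" for q
        using bump_eq_0[OF adm s(1)[of k] s(2)[of k]] that chart_ball_subset by (metis ComplD subsetD)
      ultimately have "dir_deriv (?\<psi> k) X p = 0"
        using dir_deriv_locally_const[OF C field p] by blast
      moreover have "0 \<le> \<Lambda> / s k * ?w (snd c p)"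
        by (rule mult_nonneg_nonneg[OF divide_nonneg_pos[OF L(1) s(1)] wn])
      ultimately show ?thesis by (simp add: G_def indicator_def)
    next
      case True
      \<comment> \<open>As \<open>c\<close> may be a boundary chart, the derivative is computed in
        an interior chart \<open>d\<close>, and the Jacobian carries the components of
        \<open>X\<close> over to \<open>c\<close>.\<close>
      obtain d where d: "d \<in> icharts" "p \<in> fst d" using p ichart_exists by blast
      note dA = icharts_D(1)[OF d(1)]
      have eq: "(snd c \<circ> chart_inv d) (snd d p) = snd c p" using d dA by simp
      have "((cutoff x (s k) r \<circ> (snd c \<circ> chart_inv d)) has_derivative
        ((\<lambda>v. - cutoff_weight x (s k) r (snd c p) * ((snd c p - x) \<bullet> v)) \<circ> (\<lambda>v. transition_jacobian d c p *v v))) (at (snd d p))"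
        by (rule diff_chain_at[OF transition_derivative[OF d(1) cA d(2) True]])
          (unfold eq, rule cutoff_has_derivative[OF s(1)[of k] s(2)[of k]])
      then have "((?\<psi> k \<circ> chart_inv d) has_derivative
        ((\<lambda>v. - cutoff_weight x (s k) r (snd c p) * ((snd c p - x) \<bullet> v)) \<circ> (\<lambda>v. transition_jacobian d c p *v v))) (at (snd d p))"
        by (rule has_derivative_transform_within_open[OF _ overlap_open[OF d(1) chart_open[OF cA]]])
          (use True d dA in \<open>auto simp: bump_def\<close>)
      moreover have "X c p = transition_jacobian d c p *v X d p"
        using field dA cA d(2) True unfolding is_vector_field_def by blast
      ultimately have "dir_deriv (?\<psi> k) X p = - (cutoff_weight x (s k) r (snd c p) * ((snd c p - x) \<bullet> X c p))"
        unfolding dir_deriv_eq[OF C field d] by (simp add: frechet_derivative_at[symmetric])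
      then have "\<bar>dir_deriv (?\<psi> k) X p\<bar> \<le> norm (X c p) / s k * ?w (snd c p)"
        using cutoff_derivative_bound[OF s(1)[of k] s(2)[of k], of x "snd c p" "X c p"] by simp
      also have "\<dots> \<le> G p"
      proof (cases "p \<in> chart_ball c x r")
        case True
        then have "norm (X c p) \<le> \<Lambda>"
          using X \<open>p \<in> fst c\<close> cA by (intro vec) (auto simp: perimeter_test_field_def)
        then have "norm (X c p) / s k * ?w (snd c p) \<le> \<Lambda> / s k * ?w (snd c p)"
          using s(1)[of k] wn by (intro mult_right_mono divide_right_mono) auto
        then show ?thesis using True p by (simp add: G_def)
      next
        case False
        then have "snd c p \<notin> ball x r" using True by (simp add: chart_ball_def)
        from cutoff_weight_eq_0[OF s(1)[of k] s(2)[of k] this] show ?thesis by (simp add: G_def)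
      qed
      finally show ?thesis .
    qed
    have cw: "continuous_on UNIV ?w"
      by (intro continuous_intros continuous_on_cutoff_weight s)
    have Gm: "G \<in> borel_measurable borel"
    proof -
      have "continuous_on (fst c) (\<lambda>p. \<Lambda> / s k * ?w (snd c p))"
        by (intro continuous_on_mult_left continuous_on_compose2[OF cw chart_continuous[OF cA]]) simp
      then have "continuous_on (chart_ball c x r \<inter> \<I>) (\<lambda>p. \<Lambda> / s k * ?w (snd c p))"
        by (rule continuous_on_subset) (auto simp: chart_ball_def)
      moreover have "chart_ball c x r \<inter> \<I> \<in> sets borel"
        using chart_ball_open[OF cA, of x r] interior_open by auto
      ultimately have "(\<lambda>p. indicator (chart_ball c x r \<inter> \<I>) p *\<^sub>R (\<Lambda> / s k * ?w (snd c p))) \<in> borel_measurable borel"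
        by (intro borel_measurable_continuous_on_indicator)
      then show ?thesis by (simp add: G_def[abs_def])
    qed
    have "(\<integral>\<^sup>+p\<in>\<I>. ennreal \<bar>dir_deriv (?\<psi> k) X p\<bar> \<partial>vol) \<le> (\<integral>\<^sup>+p\<in>fst c. ennreal (G p) \<partial>vol)"
    proof (rule nn_integral_mono)
      fix p
      have "G p = 0" if "p \<notin> fst c" using that by (simp add: G_def chart_ball_def)
      then show "ennreal \<bar>dir_deriv (?\<psi> k) X p\<bar> * indicator \<I> p \<le> ennreal (G p) * indicator (fst c) p"
        using le[of p] by (auto simp: indicator_def ennreal_leI)
    qed
    also have "\<dots> = (\<integral>\<^sup>+z. ennreal (indicator (chart_image c) z * vol_density c z) * ennreal (G (chart_inv c z)) \<partial>lborel)"
      using Gm by (intro nn_integral_chart[OF cA]) simp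
    also have "\<dots> \<le> (\<integral>\<^sup>+z. ennreal (\<Lambda> * m / s k * ?w z) \<partial>lborel)"
    proof (rule nn_integral_mono)
      fix z
      show "ennreal (indicator (chart_image c) z * vol_density c z) * ennreal (G (chart_inv c z)) \<le> ennreal (\<Lambda> * m / s k * ?w z)"
      proof (cases "z \<in> chart_image c \<inter> ball x r")
        case True
        then have z: "snd c (chart_inv c z) = z" "0 \<le> vol_density c z" "vol_density c z \<le> m"
          using cA dens[OF True] vol_density_pos[OF cA, of z] by (auto simp: less_imp_le)
        have nn: "0 \<le> \<Lambda> / s k * ?w z"
          by (rule mult_nonneg_nonneg[OF divide_nonneg_pos[OF L(1) s(1)] wn])
        then have "G (chart_inv c z) \<le> \<Lambda> / s k * ?w z" unfolding G_def z(1) by (simp add: indicator_def)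
        moreover have "0 \<le> G (chart_inv c z)" using nn unfolding G_def z(1) by (simp add: indicator_def)
        ultimately have "vol_density c z * G (chart_inv c z) \<le> m * (\<Lambda> / s k * ?w z)"
          using z nn by (intro mult_mono) auto
        then show ?thesis using True z \<open>0 \<le> G (chart_inv c z)\<close>
          by (simp add: ennreal_mult[symmetric] ennreal_leI mult_ac)
      next
        case False
        then have "z \<notin> chart_image c \<or> chart_inv c z \<notin> chart_ball c x r"
          using chart_chart_inv[OF cA, of z] unfolding chart_ball_def by fastforce
        then show ?thesis by (auto simp: G_def)
      qed
    qed
    also have "\<dots> = ennreal (integral\<^sup>L lborel (\<lambda>z. \<Lambda> * m / s k * ?w z))"
    proof (rule nn_integral_eq_integral)
      show "integrable lborel (\<lambda>z. \<Lambda> * m / s k * ?w z)"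
        by (rule integrable_mult_right[OF cutoff_weight_integral(1)[OF s(1)[of k] s(2)[of k]]])
      show "AE z in lborel. 0 \<le> \<Lambda> * m / s k * ?w z"
        by (rule AE_I2, rule mult_nonneg_nonneg[OF divide_nonneg_pos[OF mult_nonneg_nonneg[OF L] s(1)] wn])
    qed
    also have "\<dots> \<le> ennreal (?e k)"
    proof (rule ennreal_leI)
      have "integral\<^sup>L lborel (\<lambda>z. \<Lambda> * m / s k * ?w z) = \<Lambda> * m / s k * integral\<^sup>L lborel ?w" by simp
      also have "\<dots> \<le> \<Lambda> * m / s k * (real CARD('n) * measure lborel (ball x r))"
        using cutoff_weight_integral(2)[OF s(1)[of k] s(2)[of k]] L s(1)[of k]
        by (intro mult_left_mono divide_nonneg_pos mult_nonneg_nonneg) auto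
      finally show "integral\<^sup>L lborel (\<lambda>z. \<Lambda> * m / s k * ?w z) \<le> ?e k" by simp
    qed
    finally show ?thesis .
  qed
  moreover have "(\<lambda>k. ?\<psi> k p) \<longlonglongrightarrow> indicator (chart_ball c x r) p" for p
  proof (cases "p \<in> chart_ball c x r")
    case True
    then have "dist x (snd c p) < r" by (simp add: chart_ball_def)
    then have "\<forall>\<^sub>F k in sequentially. dist x (snd c p) < s k"
      using slim by (rule order_tendstoD(1)[rotated])
    then have "\<forall>\<^sub>F k in sequentially. ?\<psi> k p = indicator (chart_ball c x r) p"
    proof eventually_elim
      case (elim k)
      then have "p \<in> chart_cball c x (s k)" using True by (simp add: chart_cball_def chart_ball_def)
      then show ?case using bump_eq_1[OF adm s(1)[of k] s(2)[of k]] True by simp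
    qed
    then show ?thesis by (rule tendsto_eventually)
  next
    case False
    then show ?thesis using bump_eq_0[OF adm s False] by simp
  qed
  moreover have "?e \<longlonglongrightarrow> \<Lambda> * m * (real CARD('n) * measure lborel (ball x r)) / r"
    using r by (intro tendsto_intros slim) simp
  moreover have "0 \<le> ?e k" for k using L s(1)[of k] by (intro divide_nonneg_pos mult_nonneg_nonneg) auto
  ultimately show ?thesis
    unfolding perimeter_approx_def
    by (intro exI[of _ ?\<psi>] exI[of _ ?e] conjI allI impI) (use bump_C1[OF adm s] bump_bounds[OF adm s] in auto)
qed

end

section \<open>The quasilocal mass in terms of the area radius\<close>

text \<open>Here \<open>\<kappa>\<close> is the volume of the unit ball, and \<open>\<sigma>\<close> the radius of the Euclidean sphere of
  area \<open>P\<close>.\<close>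

lemma iso_mass_area_radius:
  fixes P V \<omega> \<kappa> \<sigma> :: real and n :: nat
  assumes n: "3 \<le> n" and \<kappa>: "0 < \<kappa>" and \<omega>: "\<omega> = n * \<kappa>" and P: "0 < P"
    and \<sigma>: "\<sigma> = (P / \<omega>) powr (1 / (real n - 1))"
  shows "2 / \<omega> * (\<omega> / P) powr (2 / (real n - 1)) *
      (V - 1 / (n * \<omega> powr (1 / (real n - 1))) * P powr (real n / (real n - 1))) =
    2 / \<omega> * (V - \<kappa> * \<sigma> ^ n) / \<sigma>\<^sup>2"
    and "0 < \<sigma>" and "\<omega> * \<sigma> ^ (n - 1) = P"
proof -
  have \<omega>0: "0 < \<omega>" using n \<kappa> \<omega> by simp
  have n1: "real n - 1 > 0" using n by simp
  show \<sigma>0: "0 < \<sigma>" using P \<omega>0 by (simp add: \<sigma>)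
  have pw: "\<sigma> powr (real n - 1) = P / \<omega>"
    unfolding \<sigma> powr_powr using n1 P \<omega>0 by simp
  then have Peq: "P = \<omega> * \<sigma> powr (real n - 1)" using \<omega>0 by simp
  have "\<sigma> powr (real n - 1) = \<sigma> ^ (n - 1)"
    using powr_realpow[OF \<sigma>0, of "n - 1"] n by (simp add: of_nat_diff)
  then show "\<omega> * \<sigma> ^ (n - 1) = P" using Peq by simp
  have "(\<omega> / P) powr (2 / (real n - 1)) = (\<sigma> powr (- (real n - 1))) powr (2 / (real n - 1))"
    using \<omega>0 \<sigma>0 by (simp add: Peq powr_minus_divide del: minus_diff_eq)
  also have "\<dots> = \<sigma> powr (-2)" 
  proof -
    have "- a * (2 / a) = - 2" if "0 < a" for a :: real using that by simp
    from this[OF n1] show ?thesis unfolding powr_powr by (rule arg_cong)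
  qed
  also have "\<dots> = 1 / \<sigma>\<^sup>2" using \<sigma>0 by (simp add: powr_minus_divide powr_numeral)
  finally have 1: "(\<omega> / P) powr (2 / (real n - 1)) = 1 / \<sigma>\<^sup>2" .
  have "P powr (real n / (real n - 1)) = \<omega> powr (real n / (real n - 1)) * (\<sigma> powr (real n - 1)) powr (real n / (real n - 1))"
    using \<omega>0 \<sigma>0 by (subst Peq) (simp add: powr_mult)
  also have "(\<sigma> powr (real n - 1)) powr (real n / (real n - 1)) = \<sigma> powr real n"
    unfolding powr_powr using n1 by simp
  also have "\<sigma> powr real n = \<sigma> ^ n" using \<sigma>0 by (rule powr_realpow)
  also have "\<omega> powr (real n / (real n - 1)) = \<omega> * \<omega> powr (1 / (real n - 1))"
  proof -
    have "real n / (real n - 1) = 1 + 1 / (real n - 1)" using n1 by (simp add: field_simps)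
    then show ?thesis using \<omega>0 by (simp add: powr_add)
  qed
  finally have "1 / (n * \<omega> powr (1 / (real n - 1))) * P powr (real n / (real n - 1)) = \<omega> / n * \<sigma> ^ n"
    using \<omega>0 by (simp add: field_simps)
  also have "\<omega> / n = \<kappa>" using n \<omega> by simp
  finally show "2 / \<omega> * (\<omega> / P) powr (2 / (real n - 1)) *
      (V - 1 / (n * \<omega> powr (1 / (real n - 1))) * P powr (real n / (real n - 1))) =
    2 / \<omega> * (V - \<kappa> * \<sigma> ^ n) / \<sigma>\<^sup>2"
    by (simp add: 1)
qed

text \<open>With t = \<beta> / \<rho>^(n - 2) one has \<rho>^(n - 1) + \<beta> = \<rho>^(n - 1) (1 +
  t / \<rho>) \<le> (\<rho> + t)^(n - 1), hence \<sigma> \<le> \<rho> + t. Multiplying this by the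
  hypothesis leaves an error linear in \<rho>, which division by the square of the radius makes
  small.\<close>

lemma area_radius_bound:
  fixes \<sigma> \<rho> \<beta> :: real
  assumes n: "3 \<le> n" and \<rho>: "1 \<le> \<rho>" and \<beta>: "0 \<le> \<beta>" and \<sigma>: "0 < \<sigma>"
    and le: "\<sigma> ^ (n - 1) \<le> \<rho> ^ (n - 1) + \<beta>"
  shows "\<sigma> ^ n \<le> \<rho> ^ n + 2 * \<beta> * \<rho> + \<beta>\<^sup>2"
proof -
  obtain k where k: "n = k + 3" using n by (metis add.commute le_Suc_ex)
  let ?t = "\<beta> / \<rho> ^ (k + 1)"
  have \<rho>k: "1 \<le> \<rho> ^ (k + 1)" using \<rho> by (rule one_le_power)
  have t: "0 \<le> ?t" using \<rho> \<beta> by simp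
  have "\<rho> ^ (k + 2) + \<beta> = \<rho> ^ (k + 2) * (1 + ?t / \<rho>)"
    using \<rho> by (simp add: field_simps)
  also have "\<dots> \<le> \<rho> ^ (k + 2) * (1 + ?t / \<rho>) ^ (k + 2)"
    using \<rho> divide_nonneg_nonneg[OF t, of \<rho>] by (intro mult_left_mono self_le_power) (simp_all del: divide_divide_eq_left)
  also have "\<dots> = (\<rho> * (1 + ?t / \<rho>)) ^ (k + 2)" by (rule power_mult_distrib[symmetric])
  also have "\<rho> * (1 + ?t / \<rho>) = \<rho> + ?t" using \<rho> by (simp add: field_simps)
  finally have "\<sigma> ^ (k + 2) \<le> (\<rho> + ?t) ^ (k + 2)" using le k by simp
  then have \<sigma>t: "\<sigma> \<le> \<rho> + ?t" using power_le_imp_le_base[of \<sigma> "k + 1" "\<rho> + ?t"] \<rho> t by simp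
  have "\<sigma> ^ n = \<sigma> ^ (n - 1) * \<sigma>" using n by (simp add: power_eq_if)
  also have "\<dots> \<le> (\<rho> ^ (n - 1) + \<beta>) * (\<rho> + ?t)"
    using le \<sigma>t \<sigma> \<rho> \<beta> by (intro mult_mono) auto
  also have "\<dots> = \<rho> ^ n + 2 * \<beta> * \<rho> + \<beta> * ?t"
    using \<rho> k by (simp add: field_simps power_add power2_eq_square power3_eq_cube)
  also have "\<beta> * ?t \<le> \<beta> * \<beta>"
    using \<beta> \<rho>k by (intro mult_left_mono) (auto simp: divide_le_eq mult_le_cancel_left1)
  finally show ?thesis by (simp add: power2_eq_square)
qed

text \<open>Only an upper bound for \<open>P\<close> is given, so the area radius \<sigma> may be
  far below \<rho>, where dividing an error of size 1 by \<sigma>^2 would be ruinous. In that case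
  the comparison is scaled by the factor \<sigma>^2 / \<rho>^2 \<le> 1, which V \<ge> 0 and n \<ge>
  3 permit, and the error becomes 1 / \<rho>^2. If \<sigma> exceeds \<rho>,
  \<open>area_radius_bound\<close> gives a deficit of order \<rho>, divided by at least
  \<rho>^2.\<close>

lemma iso_mass_lower_bound:
  fixes P V \<omega> \<kappa> \<rho> \<beta> :: real and n :: nat
  assumes n: "3 \<le> n" and \<kappa>: "0 < \<kappa>" and \<omega>: "\<omega> = n * \<kappa>" and P: "0 < P" "P \<le> \<omega> * (\<rho> ^ (n - 1) + \<beta>)"
    and \<beta>: "0 \<le> \<beta>" and \<rho>: "1 \<le> \<rho>" and V: "\<kappa> * \<rho> ^ n - 1 \<le> V" "0 \<le> V"
  shows "- (2 / \<omega> * (1 + \<kappa> * (2 * \<beta> + \<beta>\<^sup>2))) / \<rho> \<le>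
    2 / \<omega> * (\<omega> / P) powr (2 / (real n - 1)) *
      (V - 1 / (n * \<omega> powr (1 / (real n - 1))) * P powr (real n / (real n - 1)))"
proof -
  define \<sigma> where "\<sigma> = (P / \<omega>) powr (1 / (real n - 1))"
  note ar = iso_mass_area_radius[OF n \<kappa> \<omega> P(1) \<sigma>_def]
  have \<omega>0: "0 < \<omega>" using n \<kappa> \<omega> by simp
  let ?C = "1 + \<kappa> * (2 * \<beta> + \<beta>\<^sup>2)"
  have sq: "z ^ n = z ^ (n - 2) * z\<^sup>2" for z :: real
  proof -
    have "n = n - 2 + 2" using n by simp
    then show ?thesis by (metis power_add)
  qed
  have C: "1 \<le> ?C" using \<kappa> \<beta> by simp
  have "- (?C / \<rho>) \<le> (V - \<kappa> * \<sigma> ^ n) / \<sigma>\<^sup>2"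
  proof (cases "\<sigma> \<le> \<rho>")
    case True
    have "V - \<kappa> * \<sigma> ^ n \<ge> - 1 * (\<sigma>\<^sup>2 / \<rho>\<^sup>2)"
    proof -
      have s1: "\<sigma>\<^sup>2 / \<rho>\<^sup>2 \<le> 1" "0 \<le> \<sigma>\<^sup>2 / \<rho>\<^sup>2"
        using True ar(2) \<rho> by (auto simp: divide_le_eq_1 power_mono)
      have "\<kappa> * \<sigma> ^ n = \<kappa> * \<sigma> ^ (n - 2) * \<sigma>\<^sup>2"
        by (simp add: sq[of \<sigma>])
      also have "\<dots> \<le> \<kappa> * \<rho> ^ (n - 2) * \<sigma>\<^sup>2"
        using True ar(2) \<kappa> by (intro mult_right_mono mult_left_mono power_mono) auto
      also have "\<dots> = \<kappa> * \<rho> ^ n * (\<sigma>\<^sup>2 / \<rho>\<^sup>2)"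
        using \<rho> by (simp add: sq[of \<rho>])
      finally have a: "\<kappa> * \<sigma> ^ n \<le> \<kappa> * \<rho> ^ n * (\<sigma>\<^sup>2 / \<rho>\<^sup>2)" .
      have b: "V * (\<sigma>\<^sup>2 / \<rho>\<^sup>2) \<le> V" by (rule mult_left_le[OF s1(1) V(2)])
      have "(\<kappa> * \<rho> ^ n - 1) * (\<sigma>\<^sup>2 / \<rho>\<^sup>2) \<le> V * (\<sigma>\<^sup>2 / \<rho>\<^sup>2)"
        using V(1) s1(2) by (rule mult_right_mono)
      then show ?thesis using a b unfolding left_diff_distrib by linarith
    qed
    then have "- 1 / \<rho>\<^sup>2 \<le> (V - \<kappa> * \<sigma> ^ n) / \<sigma>\<^sup>2"
      using ar(2) \<rho> by (simp add: field_simps)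
    moreover have "1 / \<rho>\<^sup>2 \<le> ?C / \<rho>"
    proof -
      have "1 / \<rho>\<^sup>2 \<le> 1 / \<rho>" using \<rho> by (simp add: field_simps power2_eq_square)
      also have "\<dots> \<le> ?C / \<rho>" using C \<rho> by (intro divide_right_mono) auto
      finally show ?thesis .
    qed
    ultimately show ?thesis by simp
  next
    case False
    have "\<sigma> ^ (n - 1) \<le> \<rho> ^ (n - 1) + \<beta>"
      using ar(3) P(2) \<omega>0 by (metis mult_le_cancel_left_pos)
    from area_radius_bound[OF n \<rho> \<beta> ar(2) this]
    have "\<kappa> * \<sigma> ^ n \<le> \<kappa> * (\<rho> ^ n + 2 * \<beta> * \<rho> + \<beta>\<^sup>2)"
      using \<kappa> by (simp add: mult_left_mono)
    then have "V - \<kappa> * \<sigma> ^ n \<ge> - (1 + \<kappa> * (2 * \<beta> * \<rho> + \<beta>\<^sup>2))"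
      using V(1) by (simp add: algebra_simps)
    moreover have "1 + \<kappa> * (2 * \<beta> * \<rho> + \<beta>\<^sup>2) \<le> ?C * \<rho>"
    proof -
      have "\<kappa> * \<beta>\<^sup>2 * 1 \<le> \<kappa> * \<beta>\<^sup>2 * \<rho>" using \<rho> \<kappa> by (intro mult_left_mono) auto
      then show ?thesis using \<rho> by (simp add: algebra_simps)
    qed
    ultimately have ge: "- (?C * \<rho>) \<le> V - \<kappa> * \<sigma> ^ n" by linarith
    have "- (?C / \<rho>) = - (?C * \<rho>) / \<rho>\<^sup>2" using \<rho> by (simp add: power2_eq_square)
    also have "\<dots> \<le> - (?C * \<rho>) / \<sigma>\<^sup>2"
    proof -
      have "\<rho>\<^sup>2 \<le> \<sigma>\<^sup>2" using False \<rho> by (intro power_mono) auto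
      then have "(?C * \<rho>) / \<sigma>\<^sup>2 \<le> (?C * \<rho>) / \<rho>\<^sup>2" using C \<rho> ar(2) by (intro divide_left_mono) auto
      then show ?thesis by simp
    qed
    also have "\<dots> \<le> (V - \<kappa> * \<sigma> ^ n) / \<sigma>\<^sup>2" using ge by (rule divide_right_mono) simp
    finally show ?thesis .
  qed
  from mult_left_mono[OF this, of "2 / \<omega>"] \<omega>0 show ?thesis
    unfolding ar(1) by simp
qed

section \<open>Matrices close to the identity\<close>

lemma norm_matrix_vector_bound:
  fixes M :: "real ^ 'n::finite ^ 'n"
  assumes "\<And>i j. \<bar>M $ i $ j\<bar> \<le> d"
  shows "norm (M *v v) \<le> (real CARD('n))\<^sup>2 * d * norm v"
proof -
  have "norm (M *v v) \<le> (\<Sum>i\<in>UNIV. \<bar>(M *v v) $ i\<bar>)" by (rule norm_le_l1_cart)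
  also have "\<dots> \<le> (\<Sum>i::'n\<in>UNIV. \<Sum>j::'n\<in>UNIV. d * norm v)"
  proof (rule sum_mono)
    fix i :: 'n
    have "\<bar>(M *v v) $ i\<bar> \<le> (\<Sum>j\<in>UNIV. \<bar>M $ i $ j * v $ j\<bar>)"
      unfolding matrix_vector_mult_def by simp
    also have "\<dots> \<le> (\<Sum>j::'n\<in>UNIV. d * norm v)"
      unfolding abs_mult using order_trans[OF abs_ge_zero assms]
      by (intro sum_mono mult_mono assms component_le_norm_cart) auto
    finally show "\<bar>(M *v v) $ i\<bar> \<le> (\<Sum>j::'n\<in>UNIV. d * norm v)" .
  qed
  also have "\<dots> = (real CARD('n))\<^sup>2 * d * norm v" by (simp add: power2_eq_square)
  finally show ?thesis .
qed

lemma near_identity: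
  fixes \<epsilon> :: real
  assumes \<epsilon>: "0 < \<epsilon>"
  shows "\<exists>d>0. \<forall>G :: real ^ 'n::finite ^ 'n. (\<forall>i j. \<bar>G $ i $ j - mat 1 $ i $ j\<bar> \<le> d) \<longrightarrow>
    \<bar>sqrt (det G) - 1\<bar> \<le> \<epsilon> \<and> (\<forall>v. v \<bullet> (G *v v) \<le> 1 \<longrightarrow> norm v \<le> 1 + \<epsilon>)"
proof -
  let ?N = "(real CARD('n))\<^sup>2"
  have N: "1 \<le> ?N" by (simp add: one_le_power)
  have "continuous_on UNIV (\<lambda>G :: real ^ 'n ^ 'n. sqrt (det G))"
    by (intro continuous_intros continuous_on_det)
  then have "isCont (\<lambda>G :: real ^ 'n ^ 'n. sqrt (det G)) (mat 1)"
    by (simp add: continuous_on_eq_continuous_at)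
  then obtain d where d: "0 < d" "\<And>G :: real ^ 'n ^ 'n. dist G (mat 1) < d \<Longrightarrow> \<bar>sqrt (det G) - 1\<bar> < \<epsilon>"
    using \<epsilon> unfolding continuous_at_eps_delta by (force simp: dist_real_def)
  \<comment> \<open>The entry d / 2 puts \<open>G\<close> within d of the identity. The other one
    gives v \<bullet> (G v) \<ge> (1 - \<epsilon> / (1 + \<epsilon>)) |v|^2 = |v|^2 / (1 +
    \<epsilon>). Division by n^2 passes from matrix entries to norms.\<close>
  define \<delta> where "\<delta> = min (d / 2) (\<epsilon> / (1 + \<epsilon>)) / ?N"
  have \<delta>: "0 < \<delta>" "?N * \<delta> < d" "?N * \<delta> \<le> \<epsilon> / (1 + \<epsilon>)"
  proof -
    have eq: "?N * \<delta> = min (d / 2) (\<epsilon> / (1 + \<epsilon>))" using N by (simp add: \<delta>_def)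
    have pos: "0 < min (d / 2) (\<epsilon> / (1 + \<epsilon>))" using d \<epsilon> by simp
    show "0 < \<delta>" unfolding \<delta>_def using pos N by (intro divide_pos_pos) auto
    show "?N * \<delta> < d" "?N * \<delta> \<le> \<epsilon> / (1 + \<epsilon>)" unfolding eq using d by linarith+
  qed
  show ?thesis
  proof (intro exI conjI allI impI)
    show "0 < \<delta>" by (rule \<delta>)
    fix G :: "real ^ 'n ^ 'n" assume G: "\<forall>i j. \<bar>G $ i $ j - mat 1 $ i $ j\<bar> \<le> \<delta>"
    have "norm (G - mat 1) \<le> (\<Sum>i\<in>UNIV. norm ((G - mat 1) $ i))"
      unfolding norm_vec_def by (rule L2_set_le_sum) simp
    also have "\<dots> \<le> (\<Sum>i::'n\<in>UNIV. \<Sum>j::'n\<in>UNIV. \<delta>)"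
      using G by (intro sum_mono order_trans[OF norm_le_l1_cart]) auto
    also have "\<dots> = ?N * \<delta>" by (simp add: power2_eq_square)
    finally have "dist G (mat 1) < d" using \<delta>(2) by (simp add: dist_norm)
    then show "\<bar>sqrt (det G) - 1\<bar> \<le> \<epsilon>" using d(2) by (simp add: less_imp_le)
    fix v assume v: "v \<bullet> (G *v v) \<le> 1"
    have "G *v v = v + (G - mat 1) *v v"
      by (simp add: matrix_vector_mult_diff_rdistrib)
    then have "v \<bullet> (G *v v) = (norm v)\<^sup>2 + v \<bullet> ((G - mat 1) *v v)"
      by (simp add: inner_add_right power2_norm_eq_inner)
    moreover have "\<bar>v \<bullet> ((G - mat 1) *v v)\<bar> \<le> norm v * (?N * \<delta> * norm v)"
    proof (rule order_trans[OF Cauchy_Schwarz_ineq2 mult_left_mono])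
      show "norm ((G - mat 1) *v v) \<le> ?N * \<delta> * norm v"
        using G by (intro norm_matrix_vector_bound) simp
    qed simp
    moreover have "norm v * (?N * \<delta> * norm v) \<le> (norm v)\<^sup>2 * (\<epsilon> / (1 + \<epsilon>))"
      using mult_left_mono[OF \<delta>(3), of "(norm v)\<^sup>2"] by (simp add: power2_eq_square mult_ac)
    ultimately have "(norm v)\<^sup>2 - (norm v)\<^sup>2 * (\<epsilon> / (1 + \<epsilon>)) \<le> 1" using v by linarith
    also have "(norm v)\<^sup>2 - (norm v)\<^sup>2 * (\<epsilon> / (1 + \<epsilon>)) = (norm v)\<^sup>2 / (1 + \<epsilon>)"
      using \<epsilon> by (simp add: field_simps)
    finally have "(norm v)\<^sup>2 \<le> 1 + \<epsilon>" using \<epsilon> by (simp add: divide_le_eq)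
    also have "\<dots> \<le> (1 + \<epsilon>)\<^sup>2" using \<epsilon> by (simp add: power2_eq_square algebra_simps)
    finally show "norm v \<le> 1 + \<epsilon>" by (rule power2_le_imp_le) (use \<epsilon> in simp)
  qed
qed

section \<open>Test fields supported in a chart\<close>

context c0_manifold
begin

text \<open>The chain rule through \<open>d\<close>, together with uniqueness of the derivative at
  an interior point of the image of \<open>c\<close>.\<close>

lemma jacobian_cocycle:
  assumes c: "c \<in> icharts" and d: "d \<in> \<A>" and e: "e \<in> \<A>" and p: "p \<in> fst c" "p \<in> fst d" "p \<in> fst e"
  shows "transition_jacobian c e p *v v = transition_jacobian d e p *v (transition_jacobian c d p *v v)"
proof -
  note cA = icharts_D(1)[OF c]
  let ?W = "snd c ` (fst c \<inter> (fst d \<inter> fst e))"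
  have W: "open ?W" "snd c p \<in> ?W"
    by (rule overlap_open[OF c open_Int[OF chart_open[OF d] chart_open[OF e]]], rule imageI, use p in simp)
  have eq: "(snd d \<circ> chart_inv c) (snd c p) = snd d p" using p cA by simp
  have "((snd e \<circ> chart_inv d) has_derivative (\<lambda>v. transition_jacobian d e p *v v))
    (at (snd d p) within snd d ` (fst d \<inter> fst e))"
    using transition_has_derivative[OF d e, of "snd d p"] p d by simp
  moreover have "(snd d \<circ> chart_inv c) ` ?W \<subseteq> snd d ` (fst d \<inter> fst e)" using cA by auto
  ultimately have 1: "((snd e \<circ> chart_inv d) has_derivative (\<lambda>v. transition_jacobian d e p *v v))
    (at ((snd d \<circ> chart_inv c) (snd c p)) within (snd d \<circ> chart_inv c) ` ?W)"
    unfolding eq by (rule has_derivative_subset)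
  have "((snd e \<circ> chart_inv d \<circ> (snd d \<circ> chart_inv c)) has_derivative
    ((\<lambda>v. transition_jacobian d e p *v v) \<circ> (\<lambda>v. transition_jacobian c d p *v v))) (at (snd c p) within ?W)"
    by (rule diff_chain_within[OF has_derivative_at_withinI[OF transition_derivative[OF c d p(1,2)]] 1])
  then have "((snd e \<circ> chart_inv d \<circ> (snd d \<circ> chart_inv c)) has_derivative
    ((\<lambda>v. transition_jacobian d e p *v v) \<circ> (\<lambda>v. transition_jacobian c d p *v v))) (at (snd c p))"
    unfolding at_within_open[OF W(2,1)] .
  then have "((snd e \<circ> chart_inv c) has_derivative
    ((\<lambda>v. transition_jacobian d e p *v v) \<circ> (\<lambda>v. transition_jacobian c d p *v v))) (at (snd c p))"
    by (rule has_derivative_transform_within_open[OF _ W]) (use cA d in auto)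
  from has_derivative_unique[OF this transition_derivative[OF c e p(1,3)]] show ?thesis
    by (simp add: fun_eq_iff)
qed

lemma jacobian_self:
  assumes c: "c \<in> icharts" and p: "p \<in> fst c"
  shows "transition_jacobian c c p *v v = v"
proof -
  note cA = icharts_D(1)[OF c]
  have "((snd c \<circ> chart_inv c) has_derivative (\<lambda>v. v)) (at (snd c p))"
    by (rule has_derivative_transform_within_open[OF has_derivative_ident icharts_D(2)[OF c]])
      (use p cA in auto)
  from has_derivative_unique[OF this transition_derivative[OF c cA p p]] show ?thesis
    by (simp add: fun_eq_iff)
qed

lemma metric_transition:
  assumes "c \<in> \<A>" "d \<in> \<A>" "p \<in> fst c" "p \<in> fst d"
  shows "(transition_jacobian c d p *v v) \<bullet> (g d p *v (transition_jacobian c d p *v v)) = v \<bullet> (g c p *v v)"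
proof -
  let ?J = "transition_jacobian c d p"
  have "g c p = transpose ?J ** g d p ** ?J"
    using C0_metric assms unfolding C0_metric_def by blast
  then have "v \<bullet> (g c p *v v) = v \<bullet> (transpose ?J *v (g d p *v (?J *v v)))"
    by (simp add: matrix_vector_mul_assoc[symmetric])
  also have "\<dots> = (?J *v v) \<bullet> (g d p *v (?J *v v))"
    by (metis dot_lmul_matrix vector_transpose_matrix transpose_transpose inner_commute)
  finally show ?thesis ..
qed

text \<open>The coordinate field is divided by the volume density, so that the field density is a
  multiple of \<open>Y\<close> and hence C^1, whatever the regularity of the metric. The factor s
  brings the g-length below 1.\<close>

lemma chart_test_field:
  assumes c: "c \<in> icharts" and adm: "admissible c y R"
    and Y: "Ck_on (Suc 0) UNIV Y" and supp: "\<And>x. x \<notin> cball y R \<Longrightarrow> Y x = 0"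
  shows "\<exists>s>0. \<exists>X. perimeter_test_field \<A> g X \<and> has_divergence \<A> g X
    (\<lambda>p. if p \<in> chart_cball c y R then s * divergence Y (snd c p) / vol_density c (snd c p) else 0)"
proof -
  note cA = icharts_D(1)[OF c]
  let ?S = "chart_cball c y R" and ?K = "chart_image c \<inter> cball y R"
  have S: "compact ?S" "?S \<subseteq> fst c" using chart_cball_compact[OF adm] by (auto simp: chart_cball_def)
  have Sc: "closed ?S" using S(1) compact_imp_closed by blast
  have dp: "0 < vol_density c (snd c p)" if "p \<in> fst c" for p using vol_density_pos[OF cA] that by simp
  have Yc: "continuous_on UNIV Y" by (rule Ck_on_1_continuous_on[OF Y])
  let ?q = "\<lambda>x. (Y x \<bullet> (g c (chart_inv c x) *v Y x)) / (vol_density c x)\<^sup>2"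
  have "continuous_on ?K ?q"
  proof (intro continuous_on_divide continuous_on_inner continuous_on_power)
    show "continuous_on ?K Y" by (rule continuous_on_subset[OF Yc]) simp
    have "continuous_on ?K (\<lambda>x. g c (chart_inv c x))"
      by (rule continuous_on_compose2[OF metric_continuous[OF cA] continuous_on_subset[OF chart_inv_continuous[OF cA]]])
        (use chart_inv_in[OF cA] in auto)
    then show "continuous_on ?K (\<lambda>x. g c (chart_inv c x) *v Y x)"
      unfolding matrix_vector_mult_def
      by (intro continuous_intros continuous_on_subset[OF Yc]) auto
    show "continuous_on ?K (vol_density c)"
      by (rule continuous_on_subset[OF vol_density_continuous[OF cA]]) simp
    show "\<forall>x\<in>?K. (vol_density c x)\<^sup>2 \<noteq> 0" using vol_density_pos[OF cA] by force
  qed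
  then have "compact (?q ` ?K)"
    using adm by (intro compact_continuous_image) (auto simp: admissible_def)
  from compact_imp_bounded[OF this, unfolded bounded_pos]
  obtain M where M: "0 < M" "\<forall>z\<in>?q ` ?K. norm z \<le> M" by (elim exE conjE)
  \<comment> \<open>\<open>M\<close> bounds the squared g-length of \<open>Y\<close> divided by the
    density. From s \<le> 1 and s M \<le> 1 follows s^2 M \<le> 1.\<close>
  define s where "s = 1 / (1 + M)"
  have s: "0 < s" "s\<^sup>2 * M \<le> 1"
  proof -
    show "0 < s" using M(1) by (simp add: s_def)
    have "s \<le> 1" "s * M \<le> 1" "0 \<le> s" using M(1) by (auto simp: s_def)
    then have "s * (s * M) \<le> 1 * 1" using M(1) by (intro mult_mono) auto
    then show "s\<^sup>2 * M \<le> 1" by (simp add: power2_eq_square mult.assoc)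
  qed
  define X0 where "X0 p = (s / vol_density c (snd c p)) *\<^sub>R Y (snd c p)" for p
  define X where "X d p = (if p \<in> ?S then transition_jacobian c d p *v X0 p else 0)" for d p
  let ?f = "\<lambda>p. if p \<in> ?S then s * divergence Y (snd c p) / vol_density c (snd c p) else 0"
  have field: "is_vector_field \<A> X"
    unfolding is_vector_field_def
  proof (intro ballI)
    fix d e p assume d: "d \<in> \<A>" "e \<in> \<A>" "p \<in> fst d \<inter> fst e"
    show "X e p = transition_jacobian d e p *v X d p"
    proof (cases "p \<in> ?S")
      case True
      then have "p \<in> fst c" using S(2) by blast
      from jacobian_cocycle[OF c d(1,2) this] d(3) True show ?thesis by (simp add: X_def)
    qed (simp add: X_def)
  qed
  have Xc: "X c p = X0 p" if "p \<in> fst c" for p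
  proof (cases "p \<in> ?S")
    case True
    then show ?thesis using jacobian_self[OF c that] by (simp add: X_def)
  next
    case False
    then have "snd c p \<notin> cball y R" using that by (simp add: chart_cball_def)
    then show ?thesis using False supp by (simp add: X_def X0_def)
  qed
  have supp_sub: "vector_field_support \<A> X \<subseteq> ?S"
    unfolding vector_field_support_def by (rule closure_minimal[OF _ Sc]) (auto simp: X_def)
  have "perimeter_test_field \<A> g X"
    unfolding perimeter_test_field_def
  proof (intro conjI ballI)
    show "compact (vector_field_support \<A> X)"
      using compact_Int_closed[OF S(1), of "vector_field_support \<A> X"] supp_sub
      by (simp add: vector_field_support_def Int_absorb1)
    show "vector_field_support \<A> X \<subseteq> \<I>"
      using supp_sub S(2) icharts_subset_interior[OF c] by blast
    fix d p assume d: "d \<in> \<A>" "p \<in> fst d"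
    show "X d p \<bullet> (g d p *v X d p) \<le> 1"
    proof (cases "p \<in> ?S")
      case True
      then have p: "p \<in> fst c" "snd c p \<in> ?K" by (auto simp: chart_cball_def)
      have "X d p \<bullet> (g d p *v X d p) = X0 p \<bullet> (g c p *v X0 p)"
        using metric_transition[OF cA d(1) p(1) d(2)] True by (simp add: X_def)
      also have "\<dots> = s\<^sup>2 * ?q (snd c p)"
        using p cA by (simp add: X0_def matrix_vector_mult_scaleR power2_eq_square)
      also have "\<dots> \<le> s\<^sup>2 * M"
      proof (rule mult_left_mono)
        have "norm (?q (snd c p)) \<le> M" using M(2) p(2) by blast
        then show "?q (snd c p) \<le> M" unfolding real_norm_def by (rule abs_le_D1)
      qed simp
      finally show ?thesis using s(2) by simp
    qed (simp add: X_def)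
  qed (rule field)
  moreover have "has_divergence \<A> g X ?f"
    unfolding has_divergence_iff
  proof
    fix p assume p: "p \<in> \<I>"
    show "\<exists>d. p \<in> fst d \<and> div_chart X ?f d"
    proof (cases "p \<in> fst c")
      case True
      have fd: "s *\<^sub>R Y x = field_density X c x" if "x \<in> chart_image c" for x
        using that vol_density_pos[OF cA that] cA by (auto simp: field_density_def Xc X0_def)
      have sY: "Ck_on (Suc 0) UNIV (\<lambda>x. s *\<^sub>R Y x)" by (rule Ck_on_1_scaleR[OF Ck_on_1_const Y])
      have "Ck_on (Suc 0) (chart_image c) (field_density X c)"
      proof (rule Ck_on_1_locally)
        fix x assume "x \<in> chart_image c"
        then show "\<exists>W h. open W \<and> x \<in> W \<and> Ck_on (Suc 0) W h \<and> (\<forall>y\<in>W. h y = field_density X c y)"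
          using icharts_D(2)[OF c] Ck_on_1_subset[OF sY, of "chart_image c"] fd
          by (intro exI[of _ "chart_image c"] exI[of _ "\<lambda>x. s *\<^sub>R Y x"]) blast
      qed
      moreover have "?f q = divergence (field_density X c) (snd c q) / vol_density c (snd c q)" if q: "q \<in> fst c" for q
      proof -
        have "((\<lambda>x. s *\<^sub>R Y x) has_derivative (\<lambda>v. s *\<^sub>R frechet_derivative Y (at (snd c q)) v)) (at (snd c q))"
          by (rule has_derivative_scaleR_right[OF Ck_on_1_has_derivative[OF Y UNIV_I]])
        then have "(field_density X c has_derivative (\<lambda>v. s *\<^sub>R frechet_derivative Y (at (snd c q)) v)) (at (snd c q))"
          by (rule has_derivative_transform_within_open[OF _ icharts_D(2)[OF c]]) (use q fd in auto)
        from frechet_derivative_at[OF this, symmetric]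
        have dv: "divergence (field_density X c) (snd c q) = s * divergence Y (snd c q)"
          by (simp add: divergence_def sum_distrib_left)
        show ?thesis
        proof (cases "q \<in> ?S")
          case False
          then have "snd c q \<notin> cball y R" using q by (simp add: chart_cball_def)
          from frechet_derivative_eq_0_outside[OF closed_cball supp this]
          have "divergence Y (snd c q) = 0" by (simp add: divergence_def)
          then show ?thesis using False dv by simp
        qed (simp add: dv)
      qed
      ultimately show ?thesis using True c by (intro exI[of _ c]) (simp add: div_chart_def del: Ck_on.simps)
    next
      case False
      then have pS: "p \<notin> ?S" using S(2) by blast
      obtain d where d: "d \<in> icharts" "p \<in> fst d" using ichart_exists[OF p] by blast
      \<comment> \<open>\<open>has_divergence\<close> asks for a C^1 density on the entire domain of
        a chart around p, so the chart is shrunk off the closed ball that carries the field.\<close>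
      let ?d = "(fst d \<inter> - ?S, snd d)"
      have oS: "open (- ?S)" using Sc by auto
      have dI: "?d \<in> icharts"
        using chart_restrict[OF icharts_D(1)[OF d(1)] oS] overlap_open[OF d(1) oS] by (simp add: icharts_def)
      have z: "field_density X ?d x = 0" if "x \<in> chart_image ?d" for x
      proof -
        have "chart_inv ?d x \<in> fst ?d" by (rule chart_inv_in[OF icharts_D(1)[OF dI] that])
        then show ?thesis by (simp add: field_density_def X_def)
      qed
      have der: "(field_density X ?d has_derivative (\<lambda>_. 0)) (at x)" if "x \<in> chart_image ?d" for x
        by (rule has_derivative_transform_within_open[of "\<lambda>_. 0", OF _ icharts_D(2)[OF dI] that]) (use z in auto)
      have C: "Ck_on (Suc 0) (chart_image ?d) (field_density X ?d)"
        by (rule Ck_on_1I[OF der]) auto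
      have "divergence (field_density X ?d) x = 0" if "x \<in> chart_image ?d" for x
        using frechet_derivative_at[OF der[OF that], symmetric] by (simp add: divergence_def)
      then have "\<forall>q\<in>fst ?d. ?f q = divergence (field_density X ?d) (snd ?d q) / vol_density ?d (snd ?d q)"
        by auto
      then have "div_chart X ?f ?d" unfolding div_chart_def using dI C by blast
      then show ?thesis using d(2) pS by (intro exI[of _ ?d]) simp
    qed
  qed
  ultimately show ?thesis using s(1) by blast
qed

end

section \<open>Adding a far away ball\<close>

text \<open>Doubling the radius makes the bound independent of \<rho>: since 6 t (1 - t) \<le> 3 / 2
  and (2 \<rho>)^2 - \<rho>^2 = 3 \<rho>^2, the weight is at most 1 / \<rho>^2, while |x - y|^2
  \<le> 4 \<rho>^2 on the support.\<close>

lemma cutoff_weight_bound: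
  fixes y :: "'a::euclidean_space"
  assumes \<rho>: "0 < \<rho>"
  shows "cutoff_weight y \<rho> (2 * \<rho>) x * ((x - y) \<bullet> (x - y)) \<le> 4"
proof (cases "x \<in> ball y (2 * \<rho>)")
  case False
  then have "cutoff_weight y \<rho> (2 * \<rho>) x = 0" using \<rho> by (intro cutoff_weight_eq_0) auto
  then show ?thesis by simp
next
  case True
  define t where "t = ((2 * \<rho>)\<^sup>2 - (x - y) \<bullet> (x - y)) / ((2 * \<rho>)\<^sup>2 - \<rho>\<^sup>2)"
  have den: "(2 * \<rho>)\<^sup>2 - \<rho>\<^sup>2 = 3 * \<rho>\<^sup>2" by (simp add: power2_eq_square)
  have "0 \<le> (2 * t - 1)\<^sup>2" by simp
  then have "6 * t * (1 - t) \<le> 3 / 2" by (simp add: power2_eq_square algebra_simps)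
  then have "max 0 (6 * t * (1 - t)) \<le> 3 / 2" by simp
  then have "max 0 (6 * t * (1 - t)) * 2 / (3 * \<rho>\<^sup>2) \<le> (3 / 2) * 2 / (3 * \<rho>\<^sup>2)"
    using \<rho> by (intro divide_right_mono mult_right_mono) auto
  moreover have "cutoff_weight y \<rho> (2 * \<rho>) x = max 0 (6 * t * (1 - t)) * 2 / (3 * \<rho>\<^sup>2)"
    by (simp only: cutoff_weight_def Let_def t_def den)
  ultimately have w: "cutoff_weight y \<rho> (2 * \<rho>) x \<le> 1 / \<rho>\<^sup>2" by simp
  have "norm (x - y) \<le> 2 * \<rho>" using True by (simp add: dist_norm norm_minus_commute)
  then have "(norm (x - y))\<^sup>2 \<le> (2 * \<rho>)\<^sup>2" by (intro power_mono) auto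
  then have "cutoff_weight y \<rho> (2 * \<rho>) x * ((x - y) \<bullet> (x - y)) \<le> 1 / \<rho>\<^sup>2 * (4 * \<rho>\<^sup>2)"
    using w \<rho> by (intro mult_mono) (auto simp: dot_square_norm power_mult_distrib)
  then show ?thesis using \<rho> by simp
qed

section \<open>Precompact open sets with controlled perimeter\<close>

context c0_manifold
begin

text \<open>Finite perimeter is asked for in the form of \<open>perimeter_approx\<close>, whose
  bounds add up under unions; this keeps the class closed under the steps of the
  construction.\<close>

definition nice :: "'a set \<Rightarrow> bool" where
  "nice \<Omega> \<longleftrightarrow> open \<Omega> \<and> compact (closure \<Omega>) \<and> (\<exists>b. perimeter_approx \<Omega> b)"

lemma perimeter_approx_nonneg: "perimeter_approx \<Omega> b \<Longrightarrow> 0 \<le> b"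
  unfolding perimeter_approx_def by (meson LIMSEQ_le_const)

lemma nice_empty: "nice {}"
  using perimeter_approx_empty by (auto simp: nice_def)

lemma nice_union: "nice \<Omega> \<Longrightarrow> nice \<Omega>' \<Longrightarrow> nice (\<Omega> \<union> \<Omega>')"
  using perimeter_approx_union[of \<Omega> _ \<Omega>'] unfolding nice_def
  by (metis closure_Un compact_Un open_Un)

lemma nice_finite_volume: "nice \<Omega> \<Longrightarrow> emeasure vol \<Omega> < \<infinity>"
  using emeasure_mono[of \<Omega> "closure \<Omega>" vol] emeasure_compact_finite[of "closure \<Omega>"] closure_subset[of \<Omega>]
  by (auto simp: nice_def)

lemma chart_ball_compact_closure:
  assumes "admissible c x r" shows "compact (closure (chart_ball c x r))"
proof -
  have K: "compact (chart_cball c x r)" by (rule chart_cball_compact[OF assms])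
  then have "closure (chart_ball c x r) \<subseteq> chart_cball c x r"
    by (intro closure_minimal chart_ball_subset compact_imp_closed)
  then show ?thesis using compact_Int_closed[OF K closed_closure, of "chart_ball c x r"] by (simp add: Int_absorb1)
qed

text \<open>The quadratic form has a positive minimum \<mu> on the compact product of the ball with
  the unit sphere, and 1 / sqrt \<mu> serves as \<Lambda>.\<close>

lemma metric_bounded_below:
  assumes adm: "admissible c x r"
  shows "\<exists>\<Lambda>\<ge>0. \<forall>p\<in>chart_cball c x r. \<forall>v. v \<bullet> (g c p *v v) \<le> 1 \<longrightarrow> norm v \<le> \<Lambda>"
proof (cases "chart_cball c x r = {}")
  case False
  have c: "c \<in> \<A>" using adm by (simp add: admissible_def)
  let ?B = "chart_cball c x r" and ?S = "sphere 0 1 :: (real ^ 'n) set"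
  let ?F = "\<lambda>z. snd z \<bullet> (g c (fst z) *v snd z)"
  have cont: "continuous_on (?B \<times> ?S) ?F"
  proof (intro continuous_on_inner continuous_on_snd continuous_on_id)
    have "continuous_on (?B \<times> ?S) (\<lambda>z. g c (fst z))"
      by (rule continuous_on_compose2[OF metric_continuous[OF c] continuous_on_fst[OF continuous_on_id]])
        (auto simp: chart_cball_def)
    then show "continuous_on (?B \<times> ?S) (\<lambda>z. g c (fst z) *v snd z)"
      unfolding matrix_vector_mult_def by (intro continuous_intros) auto
  qed
  have "compact (?B \<times> ?S)" by (intro compact_Times chart_cball_compact[OF adm] compact_sphere)
  moreover have "?B \<times> ?S \<noteq> {}" using False by simp
  ultimately obtain z where z: "z \<in> ?B \<times> ?S" "\<And>z'. z' \<in> ?B \<times> ?S \<Longrightarrow> ?F z \<le> ?F z'"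
    using continuous_attains_inf[OF _ _ cont] by blast
  let ?\<mu> = "?F z"
  have "snd z \<noteq> 0" "fst z \<in> fst c" using z(1) by (auto simp: chart_cball_def)
  then have \<mu>: "0 < ?\<mu>" using metric_inner_product[OF c] by (simp add: inner_product_matrix_def)
  have "norm v \<le> 1 / sqrt ?\<mu>" if p: "p \<in> ?B" and v: "v \<bullet> (g c p *v v) \<le> 1" for p v
  proof (cases "v = 0")
    case True
    then show ?thesis using \<mu> by simp
  next
    case False
    let ?u = "(1 / norm v) *\<^sub>R v"
    have "?\<mu> \<le> ?F (p, ?u)" using p False by (intro z(2)) auto
    also have "\<dots> = (v \<bullet> (g c p *v v)) / (norm v)\<^sup>2"
      by (simp add: matrix_vector_mult_scaleR power2_eq_square)
    also have "\<dots> \<le> 1 / (norm v)\<^sup>2" using v by (intro divide_right_mono) auto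
    finally have "(norm v)\<^sup>2 \<le> 1 / ?\<mu>" using \<mu> False by (simp add: field_simps)
    then have "sqrt ((norm v)\<^sup>2) \<le> sqrt (1 / ?\<mu>)" by (rule real_sqrt_le_mono)
    then show ?thesis by (simp add: real_sqrt_divide)
  qed
  then show ?thesis using \<mu> by (intro exI[of _ "1 / sqrt ?\<mu>"]) auto
qed (auto intro: exI[of _ 0])

lemma nice_chart_ball:
  assumes adm: "admissible c x r" shows "nice (chart_ball c x r)"
proof -
  have c: "c \<in> \<A>" and K: "compact (chart_image c \<inter> cball x r)"
    using adm by (auto simp: admissible_def)
  obtain \<Lambda> where \<Lambda>: "0 \<le> \<Lambda>" "\<And>p v. p \<in> chart_cball c x r \<Longrightarrow> v \<bullet> (g c p *v v) \<le> 1 \<Longrightarrow> norm v \<le> \<Lambda>"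
    using metric_bounded_below[OF adm] by blast
  have "compact (vol_density c ` (chart_image c \<inter> cball x r))"
    by (intro compact_continuous_image K continuous_on_subset[OF vol_density_continuous[OF c]]) auto
  from compact_imp_bounded[OF this, unfolded bounded_pos]
  obtain M where M: "0 < M" "\<forall>z\<in>vol_density c ` (chart_image c \<inter> cball x r). norm z \<le> M"
    by (elim exE conjE)
  have "perimeter_approx (chart_ball c x r) (\<Lambda> * M * (real CARD('n) * measure lborel (ball x r)) / r)"
  proof (rule perimeter_approx_chart_ball[OF adm \<Lambda>(1)])
    show "0 \<le> M" using M(1) by simp
    show "norm v \<le> \<Lambda>" if "p \<in> chart_ball c x r" "v \<bullet> (g c p *v v) \<le> 1" for p v
      using \<Lambda>(2) that chart_ball_subset by blast
    show "vol_density c z \<le> M" if z: "z \<in> chart_image c \<inter> ball x r" for z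
    proof -
      have "z \<in> chart_image c \<inter> cball x r" using z ball_subset_cball[of x r] by blast
      then have "norm (vol_density c z) \<le> M" using M(2) by blast
      then show ?thesis unfolding real_norm_def by (rule abs_le_D1)
    qed
  qed
  then show ?thesis
    unfolding nice_def using chart_ball_open[OF c] chart_ball_compact_closure[OF adm] by blast
qed

section \<open>The asymptotically flat end\<close>

context
  fixes K \<phi> a r h
  assumes flat: "C0_asymptotically_flat_end a r h" and e0: "(- K, \<phi>) \<in> \<A>"
    and img: "\<phi> ` (- K) = - cball a r" and gh: "\<And>p. p \<in> - K \<Longrightarrow> g (- K, \<phi>) p = h (\<phi> p)"
begin

definition "e = (- K, \<phi>)"

lemma e_ichart: "e \<in> icharts"
  using e0 img by (simp add: icharts_def e_def open_Compl)

lemma e_image: "chart_image e = - cball a r"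
  using img by (simp add: e_def)

lemma metric_near_infinity:
  assumes \<epsilon>: "0 < \<epsilon>"
  shows "\<exists>R. \<forall>x. R \<le> norm x \<longrightarrow> x \<in> chart_image e \<and> \<bar>vol_density e x - 1\<bar> \<le> \<epsilon> \<and>
    (\<forall>v. v \<bullet> (g e (chart_inv e x) *v v) \<le> 1 \<longrightarrow> norm v \<le> 1 + \<epsilon>)"
proof -
  obtain d where d: "0 < d" and near: "\<And>G :: real ^ 'n ^ 'n. \<forall>i j. \<bar>G $ i $ j - mat 1 $ i $ j\<bar> \<le> d \<Longrightarrow>
    \<bar>sqrt (det G) - 1\<bar> \<le> \<epsilon> \<and> (\<forall>v. v \<bullet> (G *v v) \<le> 1 \<longrightarrow> norm v \<le> 1 + \<epsilon>)"
    using near_identity[OF \<epsilon>] by blast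
  obtain C \<tau> where C: "0 < C" "0 < \<tau>" and decay: "\<And>x i j. x \<in> - cball a r \<Longrightarrow> x \<noteq> 0 \<Longrightarrow>
    \<bar>h x $ i $ j - mat 1 $ i $ j\<bar> \<le> C * norm x powr (- \<tau>)"
    using flat unfolding C0_asymptotically_flat_end_def by blast
  have "((\<lambda>t. C * t powr (- \<tau>)) \<longlongrightarrow> C * 0) at_top"
    using C(2) by (intro tendsto_mult_left tendsto_neg_powr filterlim_ident) simp
  then have "\<forall>\<^sub>F t in at_top. C * t powr (- \<tau>) < d"
    using d by (intro order_tendstoD(2)) auto
  then obtain R0 where R0: "\<And>t. R0 \<le> t \<Longrightarrow> C * t powr (- \<tau>) < d"
    by (auto simp: eventually_at_top_linorder)
  \<comment> \<open>The second entry puts x outside \<open>cball a r\<close> and away from the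
    origin, where the decay condition is void.\<close>
  define R where "R = max R0 (norm a + \<bar>r\<bar> + 1)"
  have "x \<in> chart_image e \<and> \<bar>vol_density e x - 1\<bar> \<le> \<epsilon> \<and>
    (\<forall>v. v \<bullet> (g e (chart_inv e x) *v v) \<le> 1 \<longrightarrow> norm v \<le> 1 + \<epsilon>)" if x: "R \<le> norm x" for x
  proof -
    have "norm x \<le> norm a + dist a x"
      using norm_triangle_ineq2[of x a] by (simp add: dist_norm norm_minus_commute)
    then have xin: "x \<in> - cball a r" using x by (auto simp: R_def)
    then have xe: "x \<in> chart_image e" by (simp add: e_image)
    have p: "chart_inv e x \<in> - K" "\<phi> (chart_inv e x) = x"
      using chart_inv_in[OF icharts_D(1)[OF e_ichart] xe] chart_chart_inv[OF icharts_D(1)[OF e_ichart] xe]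
      by (simp_all add: e_def)
    then have gx: "g e (chart_inv e x) = h x" using gh[OF p(1)] by (simp add: e_def)
    have "0 < R" unfolding R_def using norm_ge_zero[of a] abs_ge_zero[of r] by linarith
    then have "x \<noteq> 0" using x by auto
    have "\<forall>i j. \<bar>h x $ i $ j - mat 1 $ i $ j\<bar> \<le> d"
      using decay[OF xin \<open>x \<noteq> 0\<close>] R0[of "norm x"] x by (fastforce simp: R_def intro: order_trans less_imp_le)
    from near[OF this] show ?thesis using xe by (simp add: vol_density_def gx)
  qed
  then show ?thesis by blast
qed

text \<open>A substitute for boundedness of \<open>E\<close> in the coordinates of the end: the
  parts of \<open>E\<close> beyond radius i decrease to the empty set, and finite volume turns this
  into volumes tending to 0.\<close>

lemma volume_near_infinity:
  assumes E: "E \<in> sets borel" "emeasure vol E < \<infinity>" and t: "0 < t"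
  shows "\<exists>R. \<forall>S\<in>sets borel. S \<subseteq> fst e \<longrightarrow> (\<forall>p\<in>S. R < norm (snd e p)) \<longrightarrow> measure vol (E \<inter> S) < t"
proof -
  note eA = icharts_D(1)[OF e_ichart]
  define A where "A i = E \<inter> (fst e \<inter> snd e -` {x. real i < norm x})" for i :: nat
  have o: "open (fst e \<inter> snd e -` {x. real i < norm x})" for i :: nat
    by (intro continuous_open_preimage[OF chart_continuous[OF eA] chart_open[OF eA]] open_Collect_less continuous_intros)
  have A: "A i \<in> sets vol" for i using E(1) o[of i] by (simp add: A_def)
  have fin: "emeasure vol (A i) \<noteq> \<infinity>" for i
    using emeasure_mono[of "A i" E vol] E by (auto simp: A_def)
  have "decseq A" by (auto simp: decseq_def A_def)
  then have "(\<lambda>i. measure vol (A i)) \<longlonglongrightarrow> measure vol (\<Inter>i. A i)"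
    using A fin by (intro Lim_measure_decseq) auto
  moreover have "(\<Inter>i. A i) = {}"
  proof -
    have "p \<notin> (\<Inter>i. A i)" for p
    proof -
      obtain i :: nat where "norm (snd e p) \<le> real i" using real_arch_simple by blast
      then have "p \<notin> A i" by (simp add: A_def)
      then show ?thesis by blast
    qed
    then show ?thesis by blast
  qed
  ultimately have "\<forall>\<^sub>F i in sequentially. measure vol (A i) < t"
    using t by (intro order_tendstoD(2)) auto
  then obtain i where i: "measure vol (A i) < t" by (auto simp: eventually_sequentially)
  have "measure vol (E \<inter> S) < t" if S: "S \<in> sets borel" "S \<subseteq> fst e" "\<forall>p\<in>S. real i < norm (snd e p)" for S
  proof -
    have "measure vol (E \<inter> S) \<le> measure vol (A i)"
      using S E A[of i] fin[of i] by (intro measure_mono_fmeasurable) (auto simp: A_def fmeasurable_def less_top)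
    then show ?thesis using i by simp
  qed
  then show ?thesis by blast
qed

text \<open>The divergence of the test field is at least s n / 2 on the ball, and at least - 8 s on
  the rest of the doubled ball, by \<open>cutoff_weight_bound\<close> and a density of at least 1 /
  2. As n / 2 \<ge> 1, the hypothesis \<open>small\<close> makes the gain outweigh the loss on
  \<Omega>.\<close>

lemma far_ball_perimeter_pos:
  assumes \<rho>: "0 < \<rho>" and n: "CARD('n) \<ge> 3" and adm: "admissible e y (2 * \<rho>)"
    and dens: "\<And>x. x \<in> cball y (2 * \<rho>) \<Longrightarrow> x \<in> chart_image e \<and> \<bar>vol_density e x - 1\<bar> \<le> 1 / 2"
    and \<Omega>: "nice \<Omega>"
    and small: "8 * measure vol (\<Omega> \<inter> chart_cball e y (2 * \<rho>)) < measure vol (chart_ball e y \<rho>)"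
  shows "0 < perimeter \<A> g (\<Omega> \<union> chart_ball e y \<rho>)"
proof -
  note eA = icharts_D(1)[OF e_ichart]
  let ?S = "chart_cball e y (2 * \<rho>)" and ?B = "chart_ball e y \<rho>" and ?N = "real CARD('n)"
  let ?Y = "\<lambda>x. cutoff y \<rho> (2 * \<rho>) x *\<^sub>R (x - y)"
  have ab: "0 < \<rho>" "\<rho> < 2 * \<rho>" using \<rho> by auto
  have id: "Ck_on (Suc 0) UNIV (\<lambda>x. x - y)"
    by (rule Ck_on_1I[where f'="\<lambda>x v. v"]) (auto intro!: derivative_eq_intros)
  have Y: "Ck_on (Suc 0) UNIV ?Y"
    by (intro Ck_on_1_scaleR Ck_on_1_cutoff ab id)
  have supp: "?Y x = 0" if "x \<notin> cball y (2 * \<rho>)" for x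
  proof -
    have "x \<notin> ball y (2 * \<rho>)" using that ball_subset_cball by blast
    from cutoff_eq_0[OF ab this] show ?thesis by simp
  qed
  have divY: "divergence ?Y x = ?N * cutoff y \<rho> (2 * \<rho>) x - cutoff_weight y \<rho> (2 * \<rho>) x * ((x - y) \<bullet> (x - y))" for x
    using divergence_scaleR[OF cutoff_has_derivative[OF ab, of y x] Ck_on_1_has_derivative[OF id UNIV_I]]
    by (simp add: divergence_id mult.commute)
  obtain s X where s: "0 < s" and X: "perimeter_test_field \<A> g X" and f: "has_divergence \<A> g X
    (\<lambda>p. if p \<in> ?S then s * divergence ?Y (snd e p) / vol_density e (snd e p) else 0)"
    using chart_test_field[OF e_ichart adm Y supp] by blast
  define F where "F p = (if p \<in> ?S then s * divergence ?Y (snd e p) / vol_density e (snd e p) else 0)" for p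
  have f: "has_divergence \<A> g X F" using f by (simp add: F_def[abs_def])
  let ?\<Omega> = "\<Omega> \<union> ?B"
  have o: "open \<Omega>" "open ?B" using \<Omega> chart_ball_open[OF eA] by (auto simp: nice_def)
  have S: "compact ?S" by (rule chart_cball_compact[OF adm])
  have BS: "?B \<subseteq> ?S" using \<rho> by (auto simp: chart_ball_def chart_cball_def)
  have SI: "?S \<subseteq> \<I>" using icharts_subset_interior[OF e_ichart] by (auto simp: chart_cball_def)
  have Sb: "?S \<in> sets borel" using S by (simp add: borel_compact)
  \<comment> \<open>A pointwise lower bound for the integrand whose integral is explicit; points of
    the ball that also lie in \<Omega> are charged for both, which only lowers it.\<close>
  define G where "G p = s * (?N / 2 * indicator ?B p - 8 * indicator (\<Omega> \<inter> ?S) p)" for p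
  have fin: "emeasure vol ?B < \<infinity>" "emeasure vol (\<Omega> \<inter> ?S) < \<infinity>"
    using emeasure_mono[OF BS, of vol] emeasure_mono[of "\<Omega> \<inter> ?S" ?S vol] emeasure_compact_finite[OF S] Sb by auto
  have iG: "integrable vol G"
    unfolding G_def using fin o Sb
    by (intro integrable_mult_right Bochner_Integration.integrable_diff integrable_real_indicator) auto
  have vG: "integral\<^sup>L vol G = s * (?N / 2 * measure vol ?B - 8 * measure vol (\<Omega> \<inter> ?S))"
    unfolding G_def using fin o Sb
    by (subst integral_mult_right_zero, subst Bochner_Integration.integral_diff) (auto intro!: integrable_real_indicator)
  have "set_integrable vol \<I> F"
    by (rule set_integrable_test[OF X f divergence_continuous[OF X f] divergence_eq_0[OF X f]])
  then have "set_integrable vol (?\<Omega> \<inter> \<I>) F"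
    by (rule set_integrable_subset) (use o interior_open in auto)
  then have iF: "integrable vol (\<lambda>p. indicator (?\<Omega> \<inter> \<I>) p *\<^sub>R F p)" by (simp add: set_integrable_def)
  have le: "G p \<le> indicator (?\<Omega> \<inter> \<I>) p *\<^sub>R F p" for p
  proof (cases "p \<in> ?S")
    case False
    then show ?thesis using BS by (auto simp: G_def F_def indicator_def)
  next
    case True
    let ?x = "snd e p" and ?v = "vol_density e (snd e p)"
    have "?x \<in> cball y (2 * \<rho>)" using True by (simp add: chart_cball_def)
    then have "\<bar>?v - 1\<bar> \<le> 1 / 2" using dens by blast
    then have v: "1 / 2 \<le> ?v" "?v \<le> 2" by linarith+
    have Fp: "F p = s * divergence ?Y ?x / ?v" using True by (simp add: F_def)
    show ?thesis
    proof (cases "p \<in> ?B")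
      case B: True
      then have xb: "?x \<in> ball y \<rho>" by (simp add: chart_ball_def)
      then have "?x \<in> cball y \<rho>" using ball_subset_cball by blast
      then have "divergence ?Y ?x = ?N"
        using cutoff_eq_1[OF ab] cutoff_weight_eq_0_inside[OF ab xb] by (simp add: divY)
      then have "F p = s * ?N / ?v" by (simp add: Fp)
      moreover have "s * ?N / 2 \<le> s * ?N / ?v" using v s by (intro divide_left_mono) auto
      moreover have "G p \<le> s * ?N / 2" using s by (simp add: G_def indicator_def algebra_simps)
      ultimately have "G p \<le> F p" by linarith
      then show ?thesis using B True SI by (auto simp: indicator_def)
    next
      case B: False
      show ?thesis
      proof (cases "p \<in> \<Omega>")
        case False
        then show ?thesis using B by (simp add: G_def)
      next
        case O: True
        have "- 4 \<le> divergence ?Y ?x"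
          using cutoff_weight_bound[OF \<rho>, of y ?x] cutoff_bounds(1)[OF ab, of y ?x] unfolding divY
          by (smt (verit) mult_nonneg_nonneg of_nat_0_le_iff)
        then have "s * (- 4) / ?v \<le> s * divergence ?Y ?x / ?v"
          using s v by (intro divide_right_mono mult_left_mono) auto
        moreover have "s * (- 8) \<le> s * (- 4) / ?v"
          using s v by (simp add: field_simps)
        ultimately show ?thesis using B O True SI by (auto simp: G_def Fp indicator_def)
      qed
    qed
  qed
  have "0 < s * (?N / 2 * measure vol ?B - 8 * measure vol (\<Omega> \<inter> ?S))"
  proof -
    have "1 * measure vol ?B \<le> ?N / 2 * measure vol ?B" using n by (intro mult_right_mono) auto
    then show ?thesis using small s by simp
  qed
  also have "\<dots> \<le> integral\<^sup>L vol (\<lambda>p. indicator (?\<Omega> \<inter> \<I>) p *\<^sub>R F p)"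
    unfolding vG[symmetric] using iG iF le by (rule integral_mono)
  finally have "0 < ereal (LINT p:?\<Omega> \<inter> \<I>|vol. F p)" by (simp add: set_lebesgue_integral_def)
  also have "\<dots> \<le> perimeter \<A> g ?\<Omega>"
    unfolding perimeter_def by (rule Sup_upper) (use X f in blast)
  finally show ?thesis .
qed

lemma add_far_ball:
  assumes n: "CARD('n) \<ge> 3" and \<Omega>: "nice \<Omega>" and \<delta>: "0 < \<delta>"
  shows "\<exists>\<Omega>'. nice \<Omega>' \<and> \<Omega> \<subseteq> \<Omega>' \<and> 0 < perimeter \<A> g \<Omega>' \<and> perimeter \<A> g \<Omega>' < \<infinity> \<and>
    - \<delta> \<le> quasilocal_iso_mass \<A> g \<Omega>'"
proof -
  note eA = icharts_D(1)[OF e_ichart]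
  let ?n = "CARD('n)" and ?\<kappa> = "unit_ball_vol (real CARD('n))"
  let ?\<omega> = "real ?n * ?\<kappa>"
  have \<kappa>: "0 < ?\<kappa>" by simp
  have \<omega>: "0 < ?\<omega>" using \<kappa> n by (intro mult_pos_pos) auto
  obtain b where b: "perimeter_approx \<Omega> b" using \<Omega> by (auto simp: nice_def)
  have b0: "0 \<le> b" by (rule perimeter_approx_nonneg[OF b])
  \<comment> \<open>The product of \<omega> and \<beta> is b + 1: b for the perimeter of \<Omega>,
    and 1 for the deviation of the ball from the Euclidean area.\<close>
  define \<beta> where "\<beta> = (b + 1) / ?\<omega>"
  have \<beta>: "0 \<le> \<beta>" using b0 \<omega> by (simp add: \<beta>_def)
  define C where "C = 2 / ?\<omega> * (1 + ?\<kappa> * (2 * \<beta> + \<beta>\<^sup>2))"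
  have C: "0 \<le> C" unfolding C_def using \<omega> \<kappa> \<beta> by (intro mult_nonneg_nonneg add_nonneg_nonneg) auto
  \<comment> \<open>\<open>C / \<rho>\<close> is the loss in \<open>iso_mass_lower_bound\<close>;
    this radius makes it at most \<delta>.\<close>
  define \<rho> where "\<rho> = 1 + C / \<delta>"
  have \<rho>: "1 \<le> \<rho>" "C / \<rho> \<le> \<delta>"
  proof -
    have "0 \<le> C / \<delta>" using C \<delta> by simp
    then show "1 \<le> \<rho>" by (simp add: \<rho>_def)
    then have "C \<le> \<delta> * \<rho>" using \<delta> by (simp add: \<rho>_def distrib_left)
    then show "C / \<rho> \<le> \<delta>" using \<open>1 \<le> \<rho>\<close> by (simp add: divide_le_eq)
  qed
  have \<rho>0: "0 < \<rho>" using \<rho> by simp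
  \<comment> \<open>1 / 2 is the tolerance of \<open>far_ball_perimeter_pos\<close>; the other
    entries keep the errors of the ball in volume and in perimeter at most 1.\<close>
  define \<epsilon> where "\<epsilon> = min (1 / 2) (min (1 / (?\<kappa> * \<rho> ^ ?n)) (1 / (3 * (?\<omega> * \<rho> ^ (?n - 1)))))"
  have pos: "0 < ?\<kappa> * \<rho> ^ ?n" "0 < ?\<omega> * \<rho> ^ (?n - 1)" using \<kappa> \<omega> \<rho>0 by simp_all
  have \<epsilon>: "0 < \<epsilon>" "\<epsilon> \<le> 1 / 2" "\<epsilon> * (?\<kappa> * \<rho> ^ ?n) \<le> 1" "3 * \<epsilon> * (?\<omega> * \<rho> ^ (?n - 1)) \<le> 1"
  proof -
    show "0 < \<epsilon>" "\<epsilon> \<le> 1 / 2" using pos by (auto simp: \<epsilon>_def)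
    have "\<epsilon> \<le> 1 / (?\<kappa> * \<rho> ^ ?n)" "\<epsilon> \<le> 1 / (3 * (?\<omega> * \<rho> ^ (?n - 1)))" by (auto simp: \<epsilon>_def)
    then show "\<epsilon> * (?\<kappa> * \<rho> ^ ?n) \<le> 1" "3 * \<epsilon> * (?\<omega> * \<rho> ^ (?n - 1)) \<le> 1"
      using pos by (simp_all add: pos_le_divide_eq mult_ac del: divide_divide_eq_left)
  qed
  obtain R where R: "\<And>x. R \<le> norm x \<Longrightarrow> x \<in> chart_image e \<and> \<bar>vol_density e x - 1\<bar> \<le> \<epsilon> \<and>
    (\<forall>v. v \<bullet> (g e (chart_inv e x) *v v) \<le> 1 \<longrightarrow> norm v \<le> 1 + \<epsilon>)"
    using metric_near_infinity[OF \<epsilon>(1)] by blast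
  have \<Omega>b: "\<Omega> \<in> sets borel" using \<Omega> by (simp add: nice_def)
  \<comment> \<open>Eight times \<kappa> / 16 is \<kappa> / 2, the lower bound for the volume of the
    new ball in \<open>volB2\<close>.\<close>
  obtain R' where R': "\<And>S. S \<in> sets borel \<Longrightarrow> S \<subseteq> fst e \<Longrightarrow> \<forall>p\<in>S. R' < norm (snd e p) \<Longrightarrow>
      measure vol (\<Omega> \<inter> S) < ?\<kappa> / 16"
    using volume_near_infinity[OF \<Omega>b nice_finite_volume[OF \<Omega>], of "?\<kappa> / 16"] \<kappa> by auto
  \<comment> \<open>Any direction would do, hence \<open>axis undefined 1\<close>. The length puts
    all of \<open>cball y (2 * \<rho>)\<close> beyond both R and R'.\<close>
  define y :: "real ^ 'n" where "y = (2 * \<rho> + \<bar>R\<bar> + \<bar>R'\<bar> + 1) *\<^sub>R axis undefined 1"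
  have ny: "norm y = 2 * \<rho> + \<bar>R\<bar> + \<bar>R'\<bar> + 1"
    using \<rho>0 by (simp add: y_def norm_axis_1)
  have far: "R \<le> norm x" "R' < norm x" if "x \<in> cball y (2 * \<rho>)" for x
  proof -
    have "norm y \<le> norm x + dist y x" using norm_triangle_ineq2[of y x] by (simp add: dist_norm)
    then show "R \<le> norm x" "R' < norm x" using that ny by auto
  qed
  have sub: "cball y (2 * \<rho>) \<subseteq> chart_image e" using far R by blast
  have adm2: "admissible e y (2 * \<rho>)"
    unfolding admissible_def using eA \<rho>0 sub by (simp add: Int_absorb1)
  have adm: "admissible e y \<rho>" by (rule admissible_mono[OF adm2]) (use \<rho>0 in auto)
  let ?B = "chart_ball e y \<rho>" and ?S = "chart_cball e y (2 * \<rho>)"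
  have bsub: "ball y \<rho> \<subseteq> cball y (2 * \<rho>)" using \<rho>0 by auto
  have imB: "chart_image e \<inter> ball y \<rho> = ball y \<rho>" using bsub sub by blast
  have mball: "measure lborel (ball y \<rho>) = ?\<kappa> * \<rho> ^ ?n"
    using content_ball[of \<rho> y] \<rho>0 by simp
  have oB: "open ?B" by (rule chart_ball_open[OF eA])
  have volB: "?\<kappa> * \<rho> ^ ?n - \<epsilon> * (?\<kappa> * \<rho> ^ ?n) \<le> measure vol ?B"
  proof -
    have "ennreal (1 - \<epsilon>) * emeasure lborel (ball y \<rho>) = (\<integral>\<^sup>+x. ennreal (1 - \<epsilon>) * indicator (ball y \<rho>) x \<partial>lborel)"
      by (rule nn_integral_cmult_indicator[symmetric]) simp
    also have "\<dots> \<le> (\<integral>\<^sup>+x\<in>snd e ` ?B. ennreal (vol_density e x) \<partial>lborel)"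
      unfolding chart_image_chart_ball imB
    proof (rule nn_integral_mono)
      fix x
      show "ennreal (1 - \<epsilon>) * indicator (ball y \<rho>) x \<le> ennreal (vol_density e x) * indicator (ball y \<rho>) x"
      proof (cases "x \<in> ball y \<rho>")
        case True
        then have "\<bar>vol_density e x - 1\<bar> \<le> \<epsilon>" using R far bsub by blast
        then have "1 - \<epsilon> \<le> vol_density e x" by linarith
        then show ?thesis using True by (simp add: ennreal_leI)
      qed simp
    qed
    also have "\<dots> = emeasure vol ?B"
      by (rule emeasure_vol[OF eA, symmetric]) (use oB in \<open>auto simp: chart_ball_def\<close>)
    also have "\<dots> = ennreal (measure vol ?B)"
      using emeasure_chart_ball_finite[OF adm] by (intro emeasure_eq_ennreal_measure) auto
    also have "emeasure lborel (ball y \<rho>) = ennreal (?\<kappa> * \<rho> ^ ?n)"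
      unfolding mball[symmetric] using emeasure_lborel_ball_finite[of y \<rho>] by (intro emeasure_eq_ennreal_measure) auto
    finally have "ennreal ((1 - \<epsilon>) * (?\<kappa> * \<rho> ^ ?n)) \<le> ennreal (measure vol ?B)"
      using \<epsilon>(2) pos by (simp add: ennreal_mult)
    then show ?thesis by (simp add: ennreal_le_iff left_diff_distrib)
  qed
  have volB2: "?\<kappa> / 2 \<le> measure vol ?B"
  proof -
    have "\<epsilon> * (?\<kappa> * \<rho> ^ ?n) \<le> 1 / 2 * (?\<kappa> * \<rho> ^ ?n)" using \<epsilon>(2) pos by (intro mult_right_mono) auto
    moreover have "?\<kappa> * 1 \<le> ?\<kappa> * \<rho> ^ ?n" using \<kappa> \<rho>(1) by (intro mult_left_mono one_le_power) auto
    ultimately show ?thesis using volB by linarith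
  qed
  \<comment> \<open>One factor 1 + \<epsilon> bounds the Euclidean length of test vectors, the other
    the volume density.\<close>
  have approxB: "perimeter_approx ?B ((1 + \<epsilon>) * (1 + \<epsilon>) * (real CARD('n) * measure lborel (ball y \<rho>)) / \<rho>)"
  proof (rule perimeter_approx_chart_ball[OF adm])
    show "0 \<le> 1 + \<epsilon>" "0 \<le> 1 + \<epsilon>" using \<epsilon>(1) by auto
    show "norm v \<le> 1 + \<epsilon>" if p: "p \<in> ?B" "v \<bullet> (g e p *v v) \<le> 1" for p v
    proof -
      have "snd e p \<in> ball y \<rho>" "chart_inv e (snd e p) = p" using p eA by (auto simp: chart_ball_def)
      moreover from this have "R \<le> norm (snd e p)" using far bsub by blast
      ultimately show ?thesis using R[of "snd e p"] p(2) by simp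
    qed
    show "vol_density e z \<le> 1 + \<epsilon>" if "z \<in> chart_image e \<inter> ball y \<rho>" for z
    proof -
      have "\<bar>vol_density e z - 1\<bar> \<le> \<epsilon>" using R far bsub that by blast
      then show ?thesis by linarith
    qed
  qed
  have bB: "(1 + \<epsilon>) * (1 + \<epsilon>) * (real CARD('n) * measure lborel (ball y \<rho>)) / \<rho> \<le> ?\<omega> * \<rho> ^ (?n - 1) + 1"
  proof -
    have "\<rho> ^ ?n = \<rho> * \<rho> ^ (?n - 1)" using n by (simp add: power_eq_if)
    then have "(1 + \<epsilon>) * (1 + \<epsilon>) * (real CARD('n) * measure lborel (ball y \<rho>)) / \<rho> =
      (1 + \<epsilon>) * (1 + \<epsilon>) * (?\<omega> * \<rho> ^ (?n - 1))"
      unfolding mball using \<rho>0 by (simp add: field_simps)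
    also have "\<dots> \<le> (1 + 3 * \<epsilon>) * (?\<omega> * \<rho> ^ (?n - 1))"
    proof (rule mult_right_mono)
      have "\<epsilon> * \<epsilon> \<le> 1 * \<epsilon>" using \<epsilon> by (intro mult_right_mono) auto
      then show "(1 + \<epsilon>) * (1 + \<epsilon>) \<le> 1 + 3 * \<epsilon>" by (simp add: algebra_simps)
    qed (use pos in simp)
    also have "\<dots> \<le> ?\<omega> * \<rho> ^ (?n - 1) + 1" using \<epsilon>(4) unfolding distrib_right by linarith
    finally show ?thesis .
  qed
  let ?\<Omega>' = "\<Omega> \<union> ?B"
  have nice': "nice ?\<Omega>'" by (rule nice_union[OF \<Omega> nice_chart_ball[OF adm]])
  have "perimeter \<A> g ?\<Omega>' \<le> ereal (b + (1 + \<epsilon>) * (1 + \<epsilon>) * (real CARD('n) * measure lborel (ball y \<rho>)) / \<rho>)"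
    by (rule perimeter_approx_bound[OF perimeter_approx_union[OF b approxB]]) (use nice' in \<open>simp add: nice_def\<close>)
  also have "\<dots> \<le> ereal (?\<omega> * (\<rho> ^ (?n - 1) + \<beta>))"
  proof -
    have "?\<omega> * \<beta> = b + 1" unfolding \<beta>_def using \<omega> by (metis less_irrefl nonzero_mult_div_cancel_left times_divide_eq_right)
    then show ?thesis using bB unfolding ereal_less_eq distrib_left by linarith
  qed
  finally have Pup: "perimeter \<A> g ?\<Omega>' \<le> ereal (?\<omega> * (\<rho> ^ (?n - 1) + \<beta>))" .
  have Sb: "?S \<in> sets borel" using chart_cball_compact[OF adm2] by (simp add: borel_compact)
  have "measure vol (\<Omega> \<inter> ?S) < ?\<kappa> / 16"
    using far(2) by (intro R' Sb) (auto simp: chart_cball_def)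
  then have small: "8 * measure vol (\<Omega> \<inter> ?S) < measure vol ?B" using volB2 by linarith
  have Ppos: "0 < perimeter \<A> g ?\<Omega>'"
  proof (rule far_ball_perimeter_pos[OF \<rho>0 n adm2 _ \<Omega> small])
    show "x \<in> chart_image e \<and> \<bar>vol_density e x - 1\<bar> \<le> 1 / 2" if "x \<in> cball y (2 * \<rho>)" for x
      using R[OF far(1)[OF that]] \<epsilon>(2) by auto
  qed
  obtain P where P: "perimeter \<A> g ?\<Omega>' = ereal P"
    using Pup Ppos by (cases "perimeter \<A> g ?\<Omega>'") auto
  have "measure vol ?B \<le> measure vol ?\<Omega>'"
    using oB nice' nice_finite_volume[OF nice']
    by (intro measure_mono_fmeasurable) (auto simp: fmeasurable_def nice_def)
  then have V: "?\<kappa> * \<rho> ^ ?n - 1 \<le> measure vol ?\<Omega>'" using volB \<epsilon>(3) by linarith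
  have "- (2 / ?\<omega> * (1 + ?\<kappa> * (2 * \<beta> + \<beta>\<^sup>2))) / \<rho> \<le>
    2 / ?\<omega> * (?\<omega> / P) powr (2 / (real ?n - 1)) *
      (measure vol ?\<Omega>' - 1 / (?n * ?\<omega> powr (1 / (real ?n - 1))) * P powr (real ?n / (real ?n - 1)))"
    by (rule iso_mass_lower_bound[OF n \<kappa> refl _ _ \<beta> \<rho>(1) V measure_nonneg]) (use P Ppos Pup in auto)
  then have "- (C / \<rho>) \<le> quasilocal_iso_mass \<A> g ?\<Omega>'"
    by (simp add: quasilocal_iso_mass_def unit_sphere_area_def Let_def P C_def)
  then show ?thesis using nice' Ppos P \<rho>(2) by (intro exI[of _ ?\<Omega>']) auto
qed

text \<open>By Lindelof, countably many nice sets \<open>U i\<close> cover the manifold. Stage i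
  absorbs \<open>U i\<close>, which forces the union to be everything, before a far ball repairs the
  mass up to 1 / (i + 1). A single exhaustion bounds the supremum from below.\<close>

lemma exhaustion_nonneg_mass:
  assumes n: "CARD('n) \<ge> 3"
  shows "0 \<le> iso_mass \<A> g"
proof -
  define F where "F = {U. nice U}"
  have "\<exists>U\<in>F. p \<in> U" for p
  proof -
    obtain c where c: "c \<in> \<A>" "p \<in> fst c" using charts_cover by blast
    obtain r where adm: "admissible c (snd c p) r" using admissible_exists[OF c] by blast
    then have "p \<in> chart_ball c (snd c p) r" using c by (simp add: chart_ball_def admissible_def)
    then show ?thesis using nice_chart_ball[OF adm] by (auto simp: F_def)
  qed
  then have cover: "\<Union>F = UNIV" by blast
  have "\<And>S. S \<in> F \<Longrightarrow> openin (top_of_set UNIV) S" by (simp add: F_def nice_def)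
  then obtain F' where F': "F' \<subseteq> F" "countable F'" "\<Union>F' = \<Union>F"
    using Lindelof_openin[of F UNIV] by metis
  then have "F' \<noteq> {}" using cover by auto
  define U where "U = from_nat_into F'"
  have U: "range U = F'" unfolding U_def by (rule range_from_nat_into[OF \<open>F' \<noteq> {}\<close> F'(2)])
  then have niceU: "nice (U i)" for i using F'(1) unfolding F_def by blast
  have UU: "(\<Union>i. U i) = UNIV" using U F'(3) cover by simp
  \<comment> \<open>Niceness belongs to the invariant because the next stage needs a perimeter bound
    that is additive, not just finiteness of the perimeter.\<close>
  define Q where "Q i \<Omega> \<longleftrightarrow> nice \<Omega> \<and> U i \<subseteq> \<Omega> \<and> 0 < perimeter \<A> g \<Omega> \<and> perimeter \<A> g \<Omega> < \<infinity> \<and>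
    - (1 / real (Suc i)) \<le> quasilocal_iso_mass \<A> g \<Omega>" for i \<Omega>
  have step: "\<exists>\<Omega>'. Q i \<Omega>' \<and> \<Omega> \<subseteq> \<Omega>'" if "nice \<Omega>" for i \<Omega>
    using add_far_ball[OF n nice_union[OF that niceU[of i]], of "1 / real (Suc i)"] unfolding Q_def by auto
  have "\<exists>\<Omega>. \<forall>i. Q i (\<Omega> i) \<and> \<Omega> i \<subseteq> \<Omega> (Suc i)"
  proof (rule dependent_nat_choice)
    show "\<exists>\<Omega>. Q 0 \<Omega>" using step[OF nice_empty] by blast
    show "\<exists>\<Omega>'. Q (Suc i) \<Omega>' \<and> \<Omega> \<subseteq> \<Omega>'" if "Q i \<Omega>" for \<Omega> i
      using step[of \<Omega> "Suc i"] that unfolding Q_def by blast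
  qed
  then obtain \<Omega> where \<Omega>: "\<And>i. Q i (\<Omega> i)" "\<And>i. \<Omega> i \<subseteq> \<Omega> (Suc i)" by blast
  have "exhaustion \<A> g \<Omega>"
    unfolding exhaustion_def
  proof (intro conjI allI)
    show "(\<Union>i. \<Omega> i) = UNIV" using UU \<Omega>(1) unfolding Q_def by blast
  qed (use \<Omega> in \<open>auto simp: Q_def nice_def\<close>)
  moreover have "0 \<le> limsup (\<lambda>i. ereal (quasilocal_iso_mass \<A> g (\<Omega> i)))"
  proof -
    have "(\<lambda>i. - (1 / real (Suc i))) \<longlonglongrightarrow> - 0"
      by (intro tendsto_minus LIMSEQ_Suc[OF lim_1_over_n])
    then have "(\<lambda>i. ereal (- (1 / real (Suc i)))) \<longlonglongrightarrow> ereal 0" by simp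
    then have "limsup (\<lambda>i. ereal (- (1 / real (Suc i)))) = 0"
      by (metis lim_imp_Limsup sequentially_bot zero_ereal_def)
    moreover have "limsup (\<lambda>i. ereal (- (1 / real (Suc i)))) \<le> limsup (\<lambda>i. ereal (quasilocal_iso_mass \<A> g (\<Omega> i)))"
      by (rule Limsup_mono) (use \<Omega>(1) in \<open>auto simp: Q_def\<close>)
    ultimately show ?thesis by simp
  qed
  ultimately show ?thesis unfolding iso_mass_def by (intro SUP_upper2) auto
qed

end

end

theorem theorem7:
  fixes a :: "real ^ 'n::finite" and r :: real and h :: "real ^ 'n \<Rightarrow> real ^ 'n ^ 'n"
    and \<A> :: "('a::{second_countable_topology, t2_space}, 'n) chart set" and g :: "('a, 'n) metric"
  assumes "CARD('n) \<ge> 3"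
    and "C0_asymptotically_flat_end a r h"
    and "one_ended_manifold_with_end \<A> g a r h"
  shows "iso_mass \<A> g \<ge> 0"
proof -
  from assms(3) interpret c0_manifold \<A> g
    by unfold_locales (simp_all add: one_ended_manifold_with_end_def)
  from assms(3) obtain K \<phi> where "(- K, \<phi>) \<in> \<A>" "\<phi> ` (- K) = - cball a r"
    "\<And>p. p \<in> - K \<Longrightarrow> g (- K, \<phi>) p = h (\<phi> p)"
    unfolding one_ended_manifold_with_end_def by blast
  from exhaustion_nonneg_mass[OF assms(2) this assms(1)] show ?thesis .
qed

end
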